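(* There exist universal constants $C,C_0>0$ such that the following holds. Let $K\ge2$, $\sigma>0$, $\underline{r}>0$, and let the true parameter $\theta^*\in\mathbb{R}^{2K}$ have Fourier magnitudes $r_k\ge\underline{r}$ for each $k=1,\dots,K$. Let $\hat\theta$ be either of the method-of-moments estimators $\hat\theta^{\mathrm{oracle}}$ or $\hat\theta^{\mathrm{opt}}$ based on $N$ samples. If $$N\ge C_0\Big(\frac{\sigma^6}{\underline{r}^6}\log K+\frac{\sigma^3}{\underline{r}^3}(\log K)^{3/2}\Big),$$ then $$\mathbb{E}[L(\hat\theta,\theta^* )]\le CK\Big(\frac{\sigma^2}{N}+\frac{\sigma^4}{N\underline{r}^2}\Big)+\frac{C\|\theta^*\|^2}{K}\Big(\frac{K\sigma^2}{N\underline{r}^2}+\frac{\sigma^6}{N\underline{r}^6}\Big).$$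
   Context: Model. $K\ge2$, $N\ge1$ integers, $\sigma>0$ known. The true parameter is $\theta^*=(r_k\cos\phi_k,r_k\sin\phi_k)_{k=1}^K\in\mathbb{R}^{2K}$ with $r_k\ge0$ and $\phi_k\in[-\pi,\pi)$ regarded as real numbers. For $\alpha\in\mathcal{A}=[-\pi,\pi)$, $g(\alpha)\in\mathbb{R}^{2K\times2K}$ is block diagonal with $k$-th $2\times 2$ block $\begin{pmatrix}\cos k\alpha&-\sin k\alpha\\ \sin k\alpha&\cos k\alpha\end{pmatrix}$. Observations: $y^{(m)}=g(\alpha^{(m)})\theta^*+\sigma\varepsilon^{(m)}$, $m=1,\dots,N$, with $\alpha^{(m)}$ i.i.d. uniform on $[-\pi,\pi)$, $\varepsilon^{(m)}$ i.i.d. $\mathcal{N}(0,I_{2K})$, all independent; $\mathbb{E}$ is expectation under this model. Loss: $L(\hat\theta,\theta)=\min_{\alpha\in\mathcal{A}}\|\hat\theta-g(\alpha)\theta\|^2$. Put $\tilde y_k^{(m)}=y_{k,1}^{(m)}+iy_{k,2}^{(m)}\in\mathbb{C}$. Notation. $\operatorname{Arg}z\in[-\pi,\pi)$ is the principal argument; for $x\in\mathbb{R}$, $|x|_{\mathcal{A}}=\min_{j\in\mathbb{Z}}|x+2\pi j|$; $\mathcal{I}=\{(k,l):k,l\in\{1,\dots,K\},\,k+l\le K\}$. Estimators. (1) $\hat r_k=\big(\frac1N\sum_{m=1}^N|\tilde y_k^{(m)}|^2-2\sigma^2\big)_+^{1/2}$. (2) For $(k,l)\in\mathcal{I}$, $\hat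 B_{k,l}=\frac1N\sum_{m=1}^N\tilde y_{k+l}^{(m)}\,\overline{\tilde y_k^{(m)}}\,\overline{\tilde y_l^{(m)}}$, and $\hat\Phi_{k,l}\in\mathbb{R}$ is a version of its argument, i.e. $\hat\Phi_{k,l}-\operatorname{Arg}\hat B_{k,l}\in2\pi\mathbb{Z}$, chosen as specified below. (3) $\hat\phi$ is the least-squares estimator $\hat\phi=\operatorname{argmin}_{\phi\in\mathbb{R}^K}\sum_{(k,l)\in\mathcal{I}}(\hat\Phi_{k,l}-(\phi_{k+l}-\phi_k-\phi_l))^2$, given explicitly by $\hat\phi=M^\dagger\hat\Phi$, where $M\in\mathbb{R}^{\mathcal{I}\times K}$ has row $(k,l)$ equal to $e_{k+l}-e_k-e_l$ and $M^\dagger$ is the Moore–Penrose pseudo-inverse. Then $\hat\theta=(\hat r_k\cos\hat\phi_k,\hat r_k\sin\hat\phi_k)_{k=1}^K$. Oracle choice, giving $\hat\theta^{\mathrm{oracle}}$: with $\Phi_{k,l}=\phi_{k+l}-\phi_k-\phi_l\in\mathbb{R}$ (true phases, arithmetic in $\mathbb{R}$), $\hat\Phi_{k,l}=\hat\Phi^{\mathrm{oracle}}_{k,l}$ is the unique version of the argument of $\hat B_{k,l}$ in $[\Phi_{k,l}-\pi,\Phi_{k,l}+\pi)$. Optimization choice, giving $\hat\theta^{\mathrm{opt}}$: let $\tilde\phi\in[-\pi,\pi)^K$ be any minimizer over $\phi\in\mathcal{A}^K$ of $\max_{(k,l)\in\mathcal{I}}|\operatorname{Arg}\hat B_{k,l}-(\phi_{k+l}-\phi_k-\phi_l)|_{\mathcal{A}}$,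 set $\tilde\Phi_{k,l}=\tilde\phi_{k+l}-\tilde\phi_k-\tilde\phi_l\in\mathbb{R}$ (arithmetic in $\mathbb{R}$), and let $\hat\Phi_{k,l}=\hat\Phi^{\mathrm{opt}}_{k,l}$ be the unique version of the argument of $\hat B_{k,l}$ in $[\tilde\Phi_{k,l}-\pi,\tilde\Phi_{k,l}+\pi)$. *)

theory Defs
  imports "HOL-Probability.Probability"
begin

text \<open>
  A vector of \<open>\<real>\<^bsup>2K\<^esup>\<close> is a family of \<open>2\<close>-dimensional blocks \<open>\<theta> k :: real^2\<close>; only the blocks with
  \<open>k \<in> {1..K}\<close> are ever used. Likewise the values of \<open>\<phi> :: nat \<Rightarrow> real\<close> matter only on \<open>{1..K}\<close>.
\<close>

subsection \<open>Model\<close>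

definition rotation :: "real \<Rightarrow> real^2^2" where
  "rotation t = vector [vector [cos t, - sin t], vector [sin t, cos t]]"

definition act :: "real \<Rightarrow> (nat \<Rightarrow> real^2) \<Rightarrow> nat \<Rightarrow> real^2" where
  "act \<alpha> \<theta> k = rotation (real k * \<alpha>) *v \<theta> k"

definition from_polar :: "(nat \<Rightarrow> real) \<Rightarrow> (nat \<Rightarrow> real) \<Rightarrow> nat \<Rightarrow> real^2" where
  "from_polar r \<phi> k = vector [r k * cos (\<phi> k), r k * sin (\<phi> k)]"

definition sq_norm :: "nat \<Rightarrow> (nat \<Rightarrow> real^2) \<Rightarrow> real" where
  "sq_norm K \<theta> = (\<Sum>k=1..K. (norm (\<theta> k))\<^sup>2)"

text \<open>The infimum is attained, since the squared distance is continuous and \<open>2\<pi>\<close>-periodic in \<open>\<alpha>\<close>.\<close>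

definition loss :: "nat \<Rightarrow> (nat \<Rightarrow> real^2) \<Rightarrow> (nat \<Rightarrow> real^2) \<Rightarrow> real" where
  "loss K \<theta>' \<theta> = (INF \<alpha>\<in>{-pi..<pi}. sq_norm K (\<lambda>k. \<theta>' k - act \<alpha> \<theta> k))"

text \<open>
  The sample space carries the rotations \<open>fst \<omega> m\<close> and the noise coordinates \<open>snd \<omega> (m, k, j)\<close>.
  The product measure expresses that all of these are independent.
\<close>

type_synonym sample = "(nat \<Rightarrow> real) \<times> (nat \<times> nat \<times> 2 \<Rightarrow> real)"

definition sample_space :: "nat \<Rightarrow> nat \<Rightarrow> sample measure" where
  "sample_space K N =
     (\<Pi>\<^sub>M m\<in>{1..N}. uniform_measure lborel {-pi..<pi}) \<Otimes>\<^sub>M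
     (\<Pi>\<^sub>M i\<in>{1..N} \<times> {1..K} \<times> UNIV. density lborel std_normal_density)"

definition obs :: "real \<Rightarrow> (nat \<Rightarrow> real^2) \<Rightarrow> sample \<Rightarrow> nat \<Rightarrow> nat \<Rightarrow> real^2" where
  "obs \<sigma> \<theta> \<omega> m k = act (fst \<omega> m) \<theta> k + \<sigma> *\<^sub>R (\<chi> j. snd \<omega> (m, k, j))"

subsection \<open>Arguments\<close>

text \<open>The library's \<open>Arg\<close> takes values in \<open>(-\<pi>, \<pi>]\<close>; here the range is \<open>[-\<pi>, \<pi>)\<close>. \<open>princ_arg 0 = 0\<close>.\<close>

definition princ_arg :: "complex \<Rightarrow> real" where
  "princ_arg z = (if Arg z = pi then -pi else Arg z)"

definition circ_abs :: "real \<Rightarrow> real" where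
  "circ_abs x = (INF j::int. \<bar>x + 2 * pi * of_int j\<bar>)"

definition arg_near :: "real \<Rightarrow> complex \<Rightarrow> real" where
  "arg_near c z =
     (THE v. v \<in> {c - pi..<c + pi} \<and> (\<exists>j::int. v - princ_arg z = 2 * pi * of_int j))"

subsection \<open>Moore--Penrose pseudo-inverse\<close>

text \<open>
  A matrix with finite row index set \<open>I\<close> and column index set \<open>J\<close> is a function \<open>A :: 'i \<Rightarrow> 'j \<Rightarrow> real\<close>,
  of which only the entries in \<open>I \<times> J\<close> matter. The pseudo-inverse is the unique solution of the four
  Penrose equations; requiring zero entries outside \<open>J \<times> I\<close> makes it unique as a function.
\<close>

definition mat_prod :: "'j set \<Rightarrow> ('i \<Rightarrow> 'j \<Rightarrow> real) \<Rightarrow> ('j \<Rightarrow> 'k \<Rightarrow> real) \<Rightarrow> 'i \<Rightarrow> 'k \<Rightarrow> real" where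
  "mat_prod J A B i k = (\<Sum>j\<in>J. A i j * B j k)"

definition is_pinv :: "'i set \<Rightarrow> 'j set \<Rightarrow> ('i \<Rightarrow> 'j \<Rightarrow> real) \<Rightarrow> ('j \<Rightarrow> 'i \<Rightarrow> real) \<Rightarrow> bool" where
  "is_pinv I J A P \<longleftrightarrow>
     (\<forall>j i. (j, i) \<notin> J \<times> I \<longrightarrow> P j i = 0) \<and>
     (\<forall>i\<in>I. \<forall>j\<in>J. mat_prod I (mat_prod J A P) A i j = A i j) \<and>
     (\<forall>j\<in>J. \<forall>i\<in>I. mat_prod J (mat_prod I P A) P j i = P j i) \<and>
     (\<forall>i\<in>I. \<forall>i'\<in>I. mat_prod J A P i i' = mat_prod J A P i' i) \<and>
     (\<forall>j\<in>J. \<forall>j'\<in>J. mat_prod I P A j j' = mat_prod I P A j' j)"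

definition pinv :: "'i set \<Rightarrow> 'j set \<Rightarrow> ('i \<Rightarrow> 'j \<Rightarrow> real) \<Rightarrow> 'j \<Rightarrow> 'i \<Rightarrow> real" where
  "pinv I J A = (THE P. is_pinv I J A P)"

subsection \<open>Estimators\<close>

text \<open>The data \<open>y m k\<close> is the \<open>k\<close>-th block of the \<open>m\<close>-th observation.\<close>

definition ytilde :: "(nat \<Rightarrow> nat \<Rightarrow> real^2) \<Rightarrow> nat \<Rightarrow> nat \<Rightarrow> complex" where
  "ytilde y m k = Complex (y m k $ 1) (y m k $ 2)"

definition index_pairs :: "nat \<Rightarrow> (nat \<times> nat) set" where
  "index_pairs K = {(k, l). k \<in> {1..K} \<and> l \<in> {1..K} \<and> k + l \<le> K}"

definition r_hat :: "nat \<Rightarrow> real \<Rightarrow> (nat \<Rightarrow> nat \<Rightarrow> real^2) \<Rightarrow> nat \<Rightarrow> real" where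
  "r_hat N \<sigma> y k =
     sqrt (max 0 ((1 / real N) * (\<Sum>m=1..N. (cmod (ytilde y m k))\<^sup>2) - 2 * \<sigma>\<^sup>2))"

definition B_hat :: "nat \<Rightarrow> (nat \<Rightarrow> nat \<Rightarrow> real^2) \<Rightarrow> nat \<times> nat \<Rightarrow> complex" where
  "B_hat N y = (\<lambda>(k, l). (1 / of_nat N) *
     (\<Sum>m=1..N. ytilde y m (k + l) * cnj (ytilde y m k) * cnj (ytilde y m l)))"

definition phase_diff :: "(nat \<Rightarrow> real) \<Rightarrow> nat \<times> nat \<Rightarrow> real" where
  "phase_diff \<phi> = (\<lambda>(k, l). \<phi> (k + l) - \<phi> k - \<phi> l)"

definition phase_mat :: "nat \<times> nat \<Rightarrow> nat \<Rightarrow> real" where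
  "phase_mat = (\<lambda>(k, l) j. of_bool (j = k + l) - of_bool (j = k) - of_bool (j = l))"

definition phi_hat :: "nat \<Rightarrow> (nat \<times> nat \<Rightarrow> real) \<Rightarrow> nat \<Rightarrow> real" where
  "phi_hat K \<Phi> k = (\<Sum>p\<in>index_pairs K. pinv (index_pairs K) {1..K} phase_mat k p * \<Phi> p)"

text \<open>
  The version of the argument of each \<open>B_hat\<close> is the one within \<open>[-\<pi>, \<pi>)\<close> of the phase difference of the
  reference phases \<open>\<psi>\<close>: the true phases for the oracle estimator, and phases satisfying
  \<open>opt_phases\<close> for the optimization-based estimator.
\<close>

definition mom_estimator ::
    "nat \<Rightarrow> nat \<Rightarrow> real \<Rightarrow> (nat \<Rightarrow> nat \<Rightarrow> real^2) \<Rightarrow> (nat \<Rightarrow> real) \<Rightarrow> nat \<Rightarrow> real^2" where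
  "mom_estimator K N \<sigma> y \<psi> =
     from_polar (r_hat N \<sigma> y) (phi_hat K (\<lambda>p. arg_near (phase_diff \<psi> p) (B_hat N y p)))"

definition opt_phases :: "nat \<Rightarrow> nat \<Rightarrow> (nat \<Rightarrow> nat \<Rightarrow> real^2) \<Rightarrow> (nat \<Rightarrow> real) \<Rightarrow> bool" where
  "opt_phases K N y = is_arg_min
     (\<lambda>\<phi>. Max ((\<lambda>p. circ_abs (princ_arg (B_hat N y p) - phase_diff \<phi> p)) ` index_pairs K))
     (\<lambda>\<phi>. \<phi> \<in> {1..K} \<rightarrow> {-pi..<pi})"

subsection \<open>Risk\<close>

text \<open>
  The expected loss, as the integral of a nonnegative function with values in \<open>[0, \<infinity>]\<close>: a finite
  upper bound on it includes integrability of the loss. For an estimator that is not a measurable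
  function of the sample (possible if minimizers are selected non-measurably) it is the lower
  integral.
\<close>

definition risk :: "nat \<Rightarrow> nat \<Rightarrow> (sample \<Rightarrow> nat \<Rightarrow> real^2) \<Rightarrow> (nat \<Rightarrow> real^2) \<Rightarrow> ennreal" where
  "risk K N est \<theta> = (\<integral>\<^sup>+ \<omega>. ennreal (loss K (est \<omega>) \<theta>) \<partial>sample_space K N)"

definition risk_bound :: "real \<Rightarrow> nat \<Rightarrow> nat \<Rightarrow> real \<Rightarrow> real \<Rightarrow> (nat \<Rightarrow> real^2) \<Rightarrow> real" where
  "risk_bound C K N \<sigma> r0 \<theta> =
     C * real K * (\<sigma>^2 / real N + \<sigma>^4 / (real N * r0^2)) +
     C * sq_norm K \<theta> / real K *
       (real K * \<sigma>^2 / (real N * r0^2) + \<sigma>^6 / (real N * r0^6))"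

end

theory Submission
  imports Defs
begin

text \<open>
  Rotating the noise of block \<open>k\<close> of a sample against the phase \<open>\<phi> k + k * \<alpha>\<close> of the signal turns it into
  independent standard complex Gaussians, and \<open>B_hat\<close> at \<open>p\<close> becomes a positive multiple of
  \<open>cis (phase_diff \<phi> p) * (1 + X p)\<close>, where \<open>X p\<close> is an average of independent centred cubic polynomials in
  the noise. When all \<open>X p\<close> are at most \<open>1/2\<close> in modulus, both choices of the arguments lead, up to
  multiples of \<open>2 * pi\<close> and a shift along the orbit, to the error \<open>M\<^sup>\<dagger> (Arg (1 + X))\<close>. The matrix
  \<open>M\<^sup>T M\<close> is a weighted graph Laplacian with spectral gap of order \<open>K\<close>, so the rows of \<open>M\<^sup>\<dagger>\<close> have bounded
  \<open>l\<^sup>1\<close>-norm and entries \<open>O(1/K)\<close>.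

  Extend the argument to a smooth odd function. The error then has mean zero by conjugation symmetry,
  and the Efron--Stein inequality over samples bounds its variance by the second moment of a linear
  combination of the cubic polynomials. Their quadratic and cubic monomials are orthogonal, which gains
  the factor \<open>1/K\<close> in front of \<open>\<sigma> ^ 6\<close>. The condition on the sample size makes the event that some \<open>X p\<close>
  exceeds \<open>1/2\<close> negligible, by truncation of the Gaussians and a Chernoff bound.
\<close>

subsection \<open>Phase differences\<close>

text \<open>Two obstacles shape the proof. Expanding the argument of the averaged products directly
  leaves a squared remainder of order \<open>S ^ 12 / N\<^sup>2\<close> with
  \<open>S = \<sigma> / r0\<close>; the condition \<open>S ^ 6 \<le> N\<close> reduces this only to
  \<open>S ^ 6 / N\<close>, so the factor \<open>1 / K\<close> is lost. Efron--Stein applies the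
  expansion to one sample at a time, where increments have size \<open>1 / N\<close>, and the
  remainders then add up to at most a multiple of \<open>S\<^sup>2 / N\<close>. This needs a
  function that is smooth on the whole plane: conditioning on the good event would destroy
  independence and the conjugation symmetry, so the bad event enters only as an additive term with a
  crude bound for the loss. Cubic polynomials in Gaussians have no exponential moments. Truncating
  at \<open>\<rho> = N powr (1/3) / S\<close> balances the truncation error
  \<open>exp (- \<rho>\<^sup>2 / 4)\<close> against the Chernoff exponent. Both exponents, of order
  \<open>N / S ^ 6\<close> and \<open>N powr (2/3) / S\<^sup>2\<close>, must exceed a multiple of
  \<open>ln K\<close> to survive a union bound over at most \<open>K\<^sup>2\<close> pairs; these
  are the two terms of the sample-size condition, and the power \<open>3/2\<close> of the logarithm
  stems from the second.\<close>

lemma finite_index_pairs [simp]: "finite (index_pairs K)"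
proof -
  have "index_pairs K \<subseteq> {1..K} \<times> {1..K}" by (auto simp: index_pairs_def)
  thus ?thesis by (rule finite_subset) auto
qed

lemma card_index_pairs_le: "card (index_pairs K) \<le> K\<^sup>2"
proof -
  have "index_pairs K \<subseteq> {1..K} \<times> {1..K}" by (auto simp: index_pairs_def)
  hence "card (index_pairs K) \<le> card ({1..K} \<times> {1..K})" by (intro card_mono) auto
  thus ?thesis by (simp add: power2_eq_square)
qed

lemma sum_index_pairs:
  fixes f :: "nat \<times> nat \<Rightarrow> 'a::comm_semiring_1"
  shows "sum f (index_pairs K) = (\<Sum>a=1..K. \<Sum>b=1..K. of_bool (a + b \<le> K) * f (a, b))"
proof -
  have "(\<Sum>a=1..K. \<Sum>b=1..K. of_bool (a + b \<le> K) * f (a, b))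
      = (\<Sum>p\<in>{1..K}\<times>{1..K}. of_bool (fst p + snd p \<le> K) * f p)"
    by (subst sum.cartesian_product) (simp only: case_prod_unfold prod.collapse)
  also have "\<dots> = (\<Sum>p\<in>{1..K}\<times>{1..K}. if p \<in> index_pairs K then f p else 0)"
    by (intro sum.cong) (auto simp: index_pairs_def)
  also have "\<dots> = sum f ({1..K}\<times>{1..K} \<inter> index_pairs K)"
    by (simp add: sum.inter_restrict)
  also have "{1..K}\<times>{1..K} \<inter> index_pairs K = index_pairs K"
    by (auto simp: index_pairs_def)
  finally show ?thesis by simp
qed

lemma sum_index_pairs_add:
  fixes f :: "nat \<Rightarrow> nat \<Rightarrow> 'a::comm_semiring_1"
  shows "(\<Sum>(a, b)\<in>index_pairs K. f (a + b) a) = (\<Sum>j=1..K. \<Sum>a=1..K. of_bool (a < j) * f j a)"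
proof -
  have "(\<Sum>(a, b)\<in>index_pairs K. f (a + b) a) = (\<Sum>(j,a)\<in>{(j,a). j \<in> {1..K} \<and> a \<in> {1..K} \<and> a < j}. f j a)"
    by (rule sum.reindex_bij_witness[where i = "\<lambda>(j,a). (a, j - a)" and j = "\<lambda>(a,b). (a+b,a)"])
       (auto simp: index_pairs_def)
  also have "\<dots> = (\<Sum>p\<in>{1..K}\<times>{1..K} \<inter> {p. snd p < fst p}. f (fst p) (snd p))"
    by (intro sum.cong) (auto simp: case_prod_unfold)
  also have "\<dots> = (\<Sum>p\<in>{1..K}\<times>{1..K}. if p \<in> {p. snd p < fst p} then f (fst p) (snd p) else 0)"
    by (subst sum.inter_restrict) auto
  also have "\<dots> = (\<Sum>p\<in>{1..K}\<times>{1..K}. of_bool (snd p < fst p) * f (fst p) (snd p))"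
    by (intro sum.cong) auto
  also have "\<dots> = (\<Sum>j=1..K. \<Sum>a=1..K. of_bool (a < j) * f j a)"
    by (subst sum.cartesian_product) (simp only: case_prod_unfold)
  finally show ?thesis .
qed

lemma sum_index_pairs_swap:
  "(\<Sum>(a, b)\<in>index_pairs K. f a b) = (\<Sum>(a, b)\<in>index_pairs K. f b a)"
  by (rule sum.reindex_bij_witness[where i = "\<lambda>(a,b). (b,a)" and j = "\<lambda>(a,b). (b,a)"])
     (auto simp: index_pairs_def)

lemma sum_index_pairs_fst:
  fixes f :: "nat \<Rightarrow> real"
  shows "(\<Sum>(a, b)\<in>index_pairs K. f a) = (\<Sum>j=1..K. (real K - real j) * f j)"
proof -
  have "(\<Sum>(a, b)\<in>index_pairs K. f a) = (\<Sum>a=1..K. \<Sum>b=1..K. of_bool (a + b \<le> K) * f a)"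
    by (subst sum_index_pairs) simp
  also have "\<dots> = (\<Sum>a=1..K. (real K - real a) * f a)"
  proof (intro sum.cong refl)
    fix a assume a: "a \<in> {1..K}"
    have "(\<Sum>b=1..K. of_bool (a + b \<le> K) * f a) = (\<Sum>b=1..K. of_bool (a + b \<le> K)) * f a"
      by (simp add: sum_distrib_right)
    also have "(\<Sum>b=1..K. of_bool (a + b \<le> K) :: real) = card ({1..K} \<inter> {b. a + b \<le> K})"
      by (simp add: sum_of_bool_eq)
    also have "{1..K} \<inter> {b. a + b \<le> K} = {1..K-a}" by auto
    also have "real (card {1..K-a}) = real K - real a" using a by (simp add: of_nat_diff)
    finally show "(\<Sum>b=1..K. of_bool (a + b \<le> K) * f a) = (real K - real a) * f a" .
  qed
  finally show ?thesis .
qed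

lemma sum_index_pairs_sum:
  fixes f :: "nat \<Rightarrow> real"
  shows "(\<Sum>(a, b)\<in>index_pairs K. f (a + b)) = (\<Sum>j=1..K. (real j - 1) * f j)"
proof -
  have "(\<Sum>(a, b)\<in>index_pairs K. f (a + b)) = (\<Sum>j=1..K. \<Sum>a=1..K. of_bool (a < j) * f j)"
    by (rule sum_index_pairs_add)
  also have "\<dots> = (\<Sum>j=1..K. (real j - 1) * f j)"
  proof (intro sum.cong refl)
    fix j assume a: "j \<in> {1..K}"
    have "(\<Sum>b=1..K. of_bool (b < j) * f j) = (\<Sum>b=1..K. of_bool (b < j)) * f j"
      by (simp add: sum_distrib_right)
    also have "(\<Sum>b=1..K. of_bool (b < j) :: real) = card ({1..K} \<inter> {b. b < j})"
      by (simp add: sum_of_bool_eq)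
    also have "{1..K} \<inter> {b. b < j} = {1..<j}" using a by auto
    also have "real (card {1..<j}) = real j - 1" using a by (simp add: of_nat_diff)
    finally show "(\<Sum>b=1..K. of_bool (b < j) * f j) = (real j - 1) * f j" .
  qed
  finally show ?thesis .
qed

text \<open>Of the nine products in the expansion, the mixed ones \<open>f i * g j\<close> get the
  coefficient \<open>2 * ([i + j \<le> K] - [j < i] - [i < j])\<close>, which is
  \<open>2 * ([i = j] - [K < i + j])\<close>. The normal matrix M^T M is thus a diagonal matrix
  minus twice the 0-1 pattern \<open>K < i + j\<close>.\<close>

lemma phase_diff_inner:
  fixes f g :: "nat \<Rightarrow> real"
  shows "(\<Sum>p\<in>index_pairs K. phase_diff f p * phase_diff g p) =
     (\<Sum>j=1..K. (2 * real K + 1 - real j) * (f j * g j))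
     - 2 * (\<Sum>i=1..K. \<Sum>j=1..K. of_bool (K < i + j) * (f i * g j))"
proof -
  let ?I = "index_pairs K"
  let ?S = "\<lambda>h :: nat \<Rightarrow> nat \<Rightarrow> real. \<Sum>i=1..K. \<Sum>j=1..K. h i j"
  have ar1: "x = a + b + b + c + c - d - d - e - e \<Longrightarrow> x = a + 2 * b + 2 * (c - d - e)"
    for x a b c d e :: real by simp
  have ar2: "x = a + 2 * b + 2 * (c - d - e) \<Longrightarrow> c - d - e = y - z \<Longrightarrow> x = (a + 2 * b + 2 * y) - 2 * z"
    for x a b c d e y z :: real by simp
  have "(\<Sum>p\<in>?I. phase_diff f p * phase_diff g p) =
     (\<Sum>(a,b)\<in>?I. f (a+b) * g (a+b)) + (\<Sum>(a,b)\<in>?I. f a * g a) + (\<Sum>(a,b)\<in>?I. f b * g b)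
     + (\<Sum>(a,b)\<in>?I. f a * g b) + (\<Sum>(a,b)\<in>?I. f b * g a)
     - (\<Sum>(a,b)\<in>?I. f (a+b) * g a) - (\<Sum>(a,b)\<in>?I. f (a+b) * g b)
     - (\<Sum>(a,b)\<in>?I. f a * g (a+b)) - (\<Sum>(a,b)\<in>?I. f b * g (a+b))"
    by (simp add: sum.distrib[symmetric] sum_subtractf[symmetric] phase_diff_def case_prod_unfold algebra_simps)
  also have "(\<Sum>(a,b)\<in>?I. f b * g b) = (\<Sum>(a,b)\<in>?I. f a * g a)"
    by (subst sum_index_pairs_swap) simp
  also have "(\<Sum>(a,b)\<in>?I. f b * g a) = (\<Sum>(a,b)\<in>?I. f a * g b)"
    by (rule sum_index_pairs_swap)
  also have "(\<Sum>(a,b)\<in>?I. f (a+b) * g b) = (\<Sum>(a,b)\<in>?I. f (a+b) * g a)"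
    by (subst sum_index_pairs_swap) (simp add: add.commute)
  also have "(\<Sum>(a,b)\<in>?I. f b * g (a+b)) = (\<Sum>(a,b)\<in>?I. f a * g (a+b))"
    by (subst sum_index_pairs_swap) (simp add: add.commute)
  also have "(\<Sum>(a,b)\<in>?I. f (a+b) * g (a+b)) = (\<Sum>j=1..K. (real j - 1) * (f j * g j))"
    by (rule sum_index_pairs_sum)
  also have "(\<Sum>(a,b)\<in>?I. f a * g a) = (\<Sum>j=1..K. (real K - real j) * (f j * g j))"
    by (rule sum_index_pairs_fst)
  also have "(\<Sum>(a,b)\<in>?I. f a * g b) = ?S (\<lambda>i j. of_bool (i + j \<le> K) * (f i * g j))"
    by (subst sum_index_pairs) simp
  also have "(\<Sum>(a,b)\<in>?I. f (a+b) * g a) = ?S (\<lambda>i j. of_bool (j < i) * (f i * g j))"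
    by (rule sum_index_pairs_add)
  also have "(\<Sum>(a,b)\<in>?I. f a * g (a+b)) = ?S (\<lambda>i j. of_bool (i < j) * (f i * g j))"
    by (subst sum_index_pairs_add[where f = "\<lambda>j a. f a * g j"], subst sum.swap) simp
  finally have *: "(\<Sum>p\<in>?I. phase_diff f p * phase_diff g p) =
      (\<Sum>j=1..K. (real j - 1) * (f j * g j)) + 2 * (\<Sum>j=1..K. (real K - real j) * (f j * g j)) +
      2 * (?S (\<lambda>i j. of_bool (i + j \<le> K) * (f i * g j)) - ?S (\<lambda>i j. of_bool (j < i) * (f i * g j))
         - ?S (\<lambda>i j. of_bool (i < j) * (f i * g j)))"
    by (rule ar1)
  have "?S (\<lambda>i j. of_bool (i + j \<le> K) * (f i * g j)) - ?S (\<lambda>i j. of_bool (j < i) * (f i * g j))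
         - ?S (\<lambda>i j. of_bool (i < j) * (f i * g j)) =
        ?S (\<lambda>i j. of_bool (i + j \<le> K) * (f i * g j) - of_bool (j < i) * (f i * g j) - of_bool (i < j) * (f i * g j))"
    by (simp only: sum_subtractf)
  also have "\<dots> =
        ?S (\<lambda>i j. of_bool (i = j) * (f i * g j) - of_bool (K < i + j) * (f i * g j))"
    by (intro sum.cong refl) (auto simp: of_bool_def)
  also have "\<dots> = (\<Sum>i=1..K. \<Sum>j=1..K. of_bool (i = j) * (f i * g j)) - ?S (\<lambda>i j. of_bool (K < i + j) * (f i * g j))"
    by (simp only: sum_subtractf)
  also have "(\<Sum>i=1..K. \<Sum>j=1..K. of_bool (i = j) * (f i * g j)) = (\<Sum>i=1..K. f i * g i)"
  proof (intro sum.cong refl)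
    fix i assume "i \<in> {1..K}"
    have "(\<Sum>j=1..K. of_bool (i = j) * (f i * g j)) = (\<Sum>j=1..K. if i = j then f i * g j else 0)"
      by (intro sum.cong) auto
    thus "(\<Sum>j=1..K. of_bool (i = j) * (f i * g j)) = f i * g i"
      using \<open>i \<in> {1..K}\<close> by simp
  qed
  finally have "(\<Sum>p\<in>?I. phase_diff f p * phase_diff g p) =
      ((\<Sum>j=1..K. (real j - 1) * (f j * g j)) + 2 * (\<Sum>j=1..K. (real K - real j) * (f j * g j)) +
      2 * (\<Sum>j=1..K. f j * g j)) - 2 * ?S (\<lambda>i j. of_bool (K < i + j) * (f i * g j))"
    by (rule ar2[OF *])
  also have "(\<Sum>j=1..K. (real j - 1) * (f j * g j)) + 2 * (\<Sum>j=1..K. (real K - real j) * (f j * g j)) +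
      2 * (\<Sum>j=1..K. f j * g j) = (\<Sum>j=1..K. (2 * real K + 1 - real j) * (f j * g j))"
    by (simp only: sum_distrib_left sum.distrib[symmetric]) (intro sum.cong refl, simp add: algebra_simps)
  finally show ?thesis .
qed

lemma sum_phase_mat:
  assumes "p \<in> index_pairs K"
  shows "(\<Sum>j=1..K. phase_mat p j * f j) = phase_diff f p"
proof -
  obtain a b where p: "p = (a, b)" by force
  have ab: "a \<in> {1..K}" "b \<in> {1..K}" "a + b \<in> {1..K}" using assms by (auto simp: p index_pairs_def)
  have eq: "(\<Sum>j=1..K. of_bool (j = i) * f j) = f i" if "i \<in> {1..K}" for i
  proof -
    have "(\<Sum>j=1..K. of_bool (j = i) * f j) = (\<Sum>j=1..K. if j = i then f j else 0)"
      by (intro sum.cong) auto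
    thus ?thesis using that by simp
  qed
  have "(\<Sum>j=1..K. phase_mat p j * f j) = (\<Sum>j=1..K. of_bool (j = a + b) * f j)
     - (\<Sum>j=1..K. of_bool (j = a) * f j) - (\<Sum>j=1..K. of_bool (j = b) * f j)"
    by (simp only: sum_subtractf[symmetric]) (simp add: p phase_mat_def algebra_simps)
  thus ?thesis using ab by (simp only: eq) (simp add: p phase_diff_def)
qed

lemma phase_mat_eq: "phase_mat p j = phase_diff (\<lambda>i. of_bool (i = j)) p"
  by (auto simp: phase_mat_def phase_diff_def case_prod_unfold of_bool_def)

text \<open>The row \<open>j\<close> of the normal matrix applied to \<open>f\<close>: column
  \<open>j\<close> of the phase matrix is the phase difference of a unit vector.\<close>

lemma sum_phase_diff_phase_mat:
  assumes "j \<in> {1..K}"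
  shows "(\<Sum>p\<in>index_pairs K. phase_diff f p * phase_mat p j) =
     (2 * real K + 1 - real j) * f j - 2 * (\<Sum>i=1..K. of_bool (K < i + j) * f i)"
proof -
  have 1: "(\<Sum>i=1..K. (2 * real K + 1 - real i) * (f i * of_bool (i = j))) =
     (\<Sum>i=1..K. if i = j then (2 * real K + 1 - real i) * f i else 0)"
    by (intro sum.cong) auto
  have 2: "(\<Sum>l=1..K. of_bool (K < i + l) * (f i * of_bool (l = j))) = of_bool (K < i + j) * f i" for i
  proof -
    have "(\<Sum>l=1..K. of_bool (K < i + l) * (f i * of_bool (l = j)))
      = (\<Sum>l=1..K. if l = j then of_bool (K < i + l) * f i else 0)"
      by (intro sum.cong) auto
    thus ?thesis using assms by simp
  qed
  show ?thesis
    using assms by (simp only: phase_mat_eq phase_diff_inner 1 2) simp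
qed

text \<open>A rotation by \<open>\<alpha>\<close> adds \<open>k * \<alpha>\<close> to the phase of
  block \<open>k\<close>. This direction along the orbit is invisible to the data and lies in the
  kernel of the phase matrix.\<close>

lemma phase_diff_linear [simp]: "phase_diff real p = 0"
  by (simp add: phase_diff_def case_prod_unfold)

lemma phase_diff_add: "phase_diff (\<lambda>j. f j + g j) p = phase_diff f p + phase_diff g p"
  by (simp add: phase_diff_def case_prod_unfold)

lemma phase_diff_diff: "phase_diff (\<lambda>j. f j - g j) p = phase_diff f p - phase_diff g p"
  by (simp add: phase_diff_def case_prod_unfold)

lemma phase_diff_cmult: "phase_diff (\<lambda>j. c * f j) p = c * phase_diff f p"
  by (simp add: phase_diff_def case_prod_unfold algebra_simps)

lemma phase_diff_sum: "phase_diff (\<lambda>j. \<Sum>i\<in>A. f i j) p = (\<Sum>i\<in>A. phase_diff (f i) p)"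
  by (simp add: phase_diff_def case_prod_unfold sum_subtractf)

text \<open>Substituting \<open>f j = j * u j\<close> turns the normal matrix into a weighted graph Laplacian, on
  which the spectral gap can be read off.\<close>

lemma phase_diff_energy:
  "(\<Sum>p\<in>index_pairs K. (phase_diff (\<lambda>j. real j * u j) p)\<^sup>2) =
    (\<Sum>i=1..K. \<Sum>j=1..K. of_bool (K < i + j) * (real i * real j * (u i - u j)\<^sup>2))"
proof -
  let ?S = "\<lambda>h :: nat \<Rightarrow> nat \<Rightarrow> real. \<Sum>i=1..K. \<Sum>j=1..K. h i j"
  have ar: "x + x - 2 * y = 2 * x - 2 * y" for x y :: real by simp
  \<comment> \<open>Since \<open>real\<close> is in the kernel, row \<open>j\<close> of the normal
    matrix vanishes on it; this evaluates the weighted degree of vertex \<open>j\<close> in the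
    graph with edges \<open>K < i + j\<close>.\<close>
  have deg: "2 * (\<Sum>i=1..K. of_bool (K < i + j) * real i) = (2 * real K + 1 - real j) * real j"
    if "j \<in> {1..K}" for j
    using sum_phase_diff_phase_mat[OF that, of real] by simp
  have 1: "2 * ?S (\<lambda>i j. of_bool (K < i + j) * (real i * real j * (u j)\<^sup>2)) =
     (\<Sum>j=1..K. (2 * real K + 1 - real j) * ((real j * u j) * (real j * u j)))"
  proof -
    have "2 * ?S (\<lambda>i j. of_bool (K < i + j) * (real i * real j * (u j)\<^sup>2)) =
       (\<Sum>j=1..K. (2 * (\<Sum>i=1..K. of_bool (K < i + j) * real i)) * (real j * (u j)\<^sup>2))"
      by (subst sum.swap) (simp only: sum_distrib_left sum_distrib_right mult_ac)
    also have "\<dots> = (\<Sum>j=1..K. (2 * real K + 1 - real j) * real j * (real j * (u j)\<^sup>2))"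
      by (intro sum.cong refl) (simp only: deg)
    finally show ?thesis by (simp only: power2_eq_square mult_ac)
  qed
  have 2: "?S (\<lambda>i j. of_bool (K < i + j) * (real i * real j * (u i)\<^sup>2)) =
      ?S (\<lambda>i j. of_bool (K < i + j) * (real i * real j * (u j)\<^sup>2))"
    by (subst sum.swap) (simp only: add.commute mult.commute)
  have "?S (\<lambda>i j. of_bool (K < i + j) * (real i * real j * (u i - u j)\<^sup>2)) =
     ?S (\<lambda>i j. of_bool (K < i + j) * (real i * real j * (u i)\<^sup>2) +
         of_bool (K < i + j) * (real i * real j * (u j)\<^sup>2)
       - 2 * (of_bool (K < i + j) * ((real i * u i) * (real j * u j))))"
    by (intro sum.cong refl) (simp add: algebra_simps power2_eq_square)
  also have "\<dots> = ?S (\<lambda>i j. of_bool (K < i + j) * (real i * real j * (u i)\<^sup>2)) +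
     ?S (\<lambda>i j. of_bool (K < i + j) * (real i * real j * (u j)\<^sup>2))
       - 2 * ?S (\<lambda>i j. of_bool (K < i + j) * ((real i * u i) * (real j * u j)))"
    by (simp only: sum.distrib sum_subtractf sum_distrib_left)
  also have "\<dots> = (\<Sum>p\<in>index_pairs K. (phase_diff (\<lambda>j. real j * u j) p)\<^sup>2)"
    unfolding power2_eq_square[of "phase_diff _ _"] phase_diff_inner 2 1[symmetric]
    by (rule ar)
  finally show ?thesis by simp
qed

subsection \<open>The pseudo-inverse of the phase matrix\<close>

text \<open>Indices above \<open>K / 2\<close> form a complete subgraph \<open>T\<close> with
  weights at least \<open>K\<^sup>2 / 4\<close>, so the values \<open>u\<close> on \<open>T\<close>
  concentrate around one constant \<open>c\<close>. Every other index has enough neighbours in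
  \<open>T\<close> to be tied to \<open>c\<close> as well. The constant 40 is 8 for the edges into
  \<open>T\<close> plus 4 times 8 for the energy within \<open>T\<close>.\<close>

lemma phase_diff_gap:
  assumes K: "K \<ge> 1"
  obtains c where "real K * (\<Sum>j=1..K. (f j - c * real j)\<^sup>2) \<le> 40 * (\<Sum>p\<in>index_pairs K. (phase_diff f p)\<^sup>2)"
proof -
  define u where "u j = f j / real j" for j
  define E where "E = (\<Sum>p\<in>index_pairs K. (phase_diff f p)\<^sup>2)"
  define T where "T = {i\<in>{1..K}. K < 2 * i}"
  have Teq: "T = {K div 2 + 1..K}" unfolding T_def by auto
  have [simp]: "finite T" unfolding T_def by auto
  have cT: "real K \<le> 2 * real (card T)" unfolding Teq by simp
  have "phase_diff (\<lambda>j. real j * u j) p = phase_diff f p" if "p \<in> index_pairs K" for p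
    using that by (auto simp: phase_diff_def u_def index_pairs_def)
  hence E1: "E = (\<Sum>i=1..K. \<Sum>j=1..K. of_bool (K < i + j) * (real i * real j * (u i - u j)\<^sup>2))"
    unfolding E_def phase_diff_energy[symmetric] by (intro sum.cong) auto
  have E2: "(\<Sum>i\<in>T. \<Sum>j\<in>T. (real K)\<^sup>2 / 4 * (u i - u j)\<^sup>2) \<le> E"
  proof -
    have "(\<Sum>i\<in>T. \<Sum>j\<in>T. (real K)\<^sup>2 / 4 * (u i - u j)\<^sup>2)
        \<le> (\<Sum>i\<in>T. \<Sum>j\<in>T. of_bool (K < i + j) * (real i * real j * (u i - u j)\<^sup>2))"
    proof (intro sum_mono)
      fix i j assume ij: "i \<in> T" "j \<in> T"
      hence "K \<le> 2 * i" "K \<le> 2 * j" "K < i + j" by (auto simp: T_def)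
      hence "real K \<le> 2 * real i" "real K \<le> 2 * real j" by linarith+
      hence "real K * real K \<le> (2 * real i) * (2 * real j)" by (intro mult_mono) auto
      hence "(real K)\<^sup>2 / 4 * (u i - u j)\<^sup>2 \<le> real i * real j * (u i - u j)\<^sup>2"
        by (intro mult_right_mono) (auto simp: power2_eq_square)
      thus "(real K)\<^sup>2 / 4 * (u i - u j)\<^sup>2 \<le> of_bool (K < i + j) * (real i * real j * (u i - u j)\<^sup>2)"
        using \<open>K < i + j\<close> by simp
    qed
    also have "\<dots> \<le> (\<Sum>i\<in>{1..K}. \<Sum>j\<in>T. of_bool (K < i + j) * (real i * real j * (u i - u j)\<^sup>2))"
      by (intro sum_mono2 sum_nonneg mult_nonneg_nonneg) (auto simp: T_def)
    also have "\<dots> \<le> (\<Sum>i\<in>{1..K}. \<Sum>j\<in>{1..K}. of_bool (K < i + j) * (real i * real j * (u i - u j)\<^sup>2))"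
      by (intro sum_mono sum_mono2 mult_nonneg_nonneg) (auto simp: T_def)
    finally show ?thesis using E1 by simp
  qed
  \<comment> \<open>Averaging: some vertex carries at most the average share of the energy within
    \<open>T\<close>, and its value becomes \<open>c\<close>.\<close>
  have "\<exists>i\<in>T. real (card T) * (\<Sum>j\<in>T. (real K)\<^sup>2 / 4 * (u i - u j)\<^sup>2) \<le> E"
  proof (rule ccontr)
    assume "\<not> ?thesis"
    hence "E < real (card T) * (\<Sum>j\<in>T. (real K)\<^sup>2 / 4 * (u i - u j)\<^sup>2)" if "i \<in> T" for i
      using that by force
    moreover have "T \<noteq> {}" using K unfolding Teq by auto
    ultimately have "(\<Sum>i\<in>T. E) < (\<Sum>i\<in>T. real (card T) * (\<Sum>j\<in>T. (real K)\<^sup>2 / 4 * (u i - u j)\<^sup>2))"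
      by (intro sum_strict_mono) auto
    also have "\<dots> = real (card T) * (\<Sum>i\<in>T. \<Sum>j\<in>T. (real K)\<^sup>2 / 4 * (u i - u j)\<^sup>2)"
      by (simp only: sum_distrib_left)
    also have "\<dots> \<le> real (card T) * E" using E2 by (intro mult_left_mono) auto
    finally show False by simp
  qed
  then obtain i0 where i0: "i0 \<in> T" "real (card T) * (\<Sum>j\<in>T. (real K)\<^sup>2 / 4 * (u i0 - u j)\<^sup>2) \<le> E" by blast
  define c where "c = u i0"
  define V where "V = (\<Sum>j\<in>T. (u j - c)\<^sup>2)"
  have V0: "V \<ge> 0" unfolding V_def by (intro sum_nonneg) auto
  have V1: "real K ^ 3 * V \<le> 8 * E"
  proof -
    have "(\<Sum>j\<in>T. (real K)\<^sup>2 / 4 * (u i0 - u j)\<^sup>2) = (real K)\<^sup>2 / 4 * V"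
      unfolding V_def c_def sum_distrib_left by (intro sum.cong refl) (simp add: power2_commute)
    hence "real (card T) * ((real K)\<^sup>2 / 4 * V) \<le> E" using i0(2) by (simp only:)
    moreover have "(real K / 2) * ((real K)\<^sup>2 / 4 * V) \<le> real (card T) * ((real K)\<^sup>2 / 4 * V)"
      using cT V0 by (intro mult_right_mono) auto
    ultimately have "(real K / 2) * ((real K)\<^sup>2 / 4 * V) \<le> E" by linarith
    thus ?thesis by (simp add: power2_eq_square power3_eq_cube)
  qed
  have main: "real K * (f j - c * real j)\<^sup>2 \<le>
      8 * (\<Sum>i=1..K. of_bool (K < i + j) * (real i * real j * (u i - u j)\<^sup>2)) + 4 * (real K)\<^sup>2 * V"
    if j: "j \<in> {1..K}" for j
  proof -
    \<comment> \<open>The neighbours of \<open>j\<close> inside \<open>T\<close>. There are at least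
      \<open>j / 2\<close> of them, which makes up for the small edge weights of low
      indices.\<close>
    define A where "A = T \<inter> {i. K < i + j}"
    have AT: "A \<subseteq> T" and [simp]: "finite A" unfolding A_def by auto
    have "{max (K div 2 + 1) (K + 1 - j)..K} \<subseteq> A" using j unfolding A_def Teq by auto
    hence "card {max (K div 2 + 1) (K + 1 - j)..K} \<le> card A" by (intro card_mono) auto
    hence cA: "real j \<le> 2 * real (card A)" using j by (simp add: max_def split: if_splits)
    have sq: "(u j - c)\<^sup>2 \<le> 2 * (u i - u j)\<^sup>2 + 2 * (u i - c)\<^sup>2" for i
    proof -
      have "(u j - c)\<^sup>2 = ((u i - c) - (u i - u j))\<^sup>2" by simp
      also have "\<dots> \<le> 2 * (u i - u j)\<^sup>2 + 2 * (u i - c)\<^sup>2"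
        using zero_le_power2[of "(u i - c) + (u i - u j)"] by (simp add: power2_eq_square algebra_simps)
      finally show ?thesis .
    qed
    have "real K * (f j - c * real j)\<^sup>2 = real K * real j * (real j * (u j - c)\<^sup>2)"
      using j by (simp add: u_def power2_eq_square field_simps)
    also have "\<dots> \<le> real K * real j * (2 * real (card A) * (u j - c)\<^sup>2)"
      using cA by (intro mult_left_mono mult_right_mono) auto
    also have "\<dots> = 2 * (\<Sum>i\<in>A. real K * real j * (u j - c)\<^sup>2)" by simp
    also have "\<dots> \<le> 2 * (\<Sum>i\<in>A. 4 * (of_bool (K < i + j) * (real i * real j * (u i - u j)\<^sup>2))
         + 2 * real K * real K * (u i - c)\<^sup>2)"
    proof (intro mult_left_mono sum_mono)
      fix i assume i: "i \<in> A"
      hence iK: "real K \<le> 2 * real i" "K < i + j" by (auto simp: A_def T_def)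
      have "real K * real j * (u j - c)\<^sup>2 \<le> real K * real j * (2 * (u i - u j)\<^sup>2 + 2 * (u i - c)\<^sup>2)"
        using sq by (intro mult_left_mono) auto
      also have "\<dots> = real K * (real j * 2 * (u i - u j)\<^sup>2) + real j * (2 * real K * (u i - c)\<^sup>2)"
        by (simp add: algebra_simps)
      also have "\<dots> \<le> (2 * real i) * (real j * 2 * (u i - u j)\<^sup>2) + real K * (2 * real K * (u i - c)\<^sup>2)"
        using iK j by (intro add_mono mult_right_mono) auto
      finally show "real K * real j * (u j - c)\<^sup>2 \<le> 4 * (of_bool (K < i + j) * (real i * real j * (u i - u j)\<^sup>2))
         + 2 * real K * real K * (u i - c)\<^sup>2" using iK by (simp add: algebra_simps)
    qed auto
    also have "\<dots> = 8 * (\<Sum>i\<in>A. of_bool (K < i + j) * (real i * real j * (u i - u j)\<^sup>2))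
        + 4 * (real K)\<^sup>2 * (\<Sum>i\<in>A. (u i - c)\<^sup>2)"
      unfolding sum.distrib distrib_left sum_distrib_left
      by (intro arg_cong2[where f = "(+)"] sum.cong refl) (auto simp: power2_eq_square)
    also have "\<dots> \<le> 8 * (\<Sum>i=1..K. of_bool (K < i + j) * (real i * real j * (u i - u j)\<^sup>2)) + 4 * (real K)\<^sup>2 * V"
      unfolding V_def using AT
      by (intro add_mono mult_left_mono sum_mono2 mult_nonneg_nonneg) (auto simp: T_def)
    finally show ?thesis .
  qed
  have "real K * (\<Sum>j=1..K. (f j - c * real j)\<^sup>2) = (\<Sum>j=1..K. real K * (f j - c * real j)\<^sup>2)"
    by (simp only: sum_distrib_left)
  also have "\<dots> \<le> (\<Sum>j=1..K. 8 * (\<Sum>i=1..K. of_bool (K < i + j) * (real i * real j * (u i - u j)\<^sup>2)) + 4 * (real K)\<^sup>2 * V)"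
    by (intro sum_mono main) auto
  also have "\<dots> = 8 * (\<Sum>j=1..K. \<Sum>i=1..K. of_bool (K < i + j) * (real i * real j * (u i - u j)\<^sup>2)) + 4 * (real K)^3 * V"
    by (simp add: sum.distrib sum_distrib_left[symmetric] power2_eq_square power3_eq_cube del: sum_mult_of_bool_eq sum_of_bool_mult_eq)
  also have "\<dots> = 8 * E + 4 * (real K)^3 * V" unfolding E1 by (subst sum.swap) simp
  also have "\<dots> \<le> 40 * E" using V1 by linarith
  finally show ?thesis using that unfolding E_def by blast
qed

section \<open>Least squares and the Penrose equations\<close>

text \<open>Gram--Schmidt by induction on the columns: the new column is replaced by its residual
  \<open>m\<close> against the old ones, and the residual \<open>r\<close> of \<open>y\<close> is
  then corrected by a multiple of \<open>m\<close>. The multiple is the usual projection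
  coefficient, or 0 if \<open>m\<close> has norm 0.\<close>

lemma normal_equations_solvable:
  fixes M :: "'i \<Rightarrow> 'j \<Rightarrow> real"
  assumes "finite J"
  shows "\<exists>x. \<forall>j\<in>J. (\<Sum>p\<in>I. M p j * (y p - (\<Sum>i\<in>J. M p i * x i))) = 0"
  using assms
proof (induction J arbitrary: y rule: finite_induct)
  case (insert j0 J)
  obtain z where z: "\<forall>j\<in>J. (\<Sum>p\<in>I. M p j * (M p j0 - (\<Sum>i\<in>J. M p i * z i))) = 0"
    using insert.IH[of "\<lambda>p. M p j0"] by blast
  obtain x where x: "\<forall>j\<in>J. (\<Sum>p\<in>I. M p j * (y p - (\<Sum>i\<in>J. M p i * x i))) = 0"
    using insert.IH[of y] by blast
  define m where "m p = M p j0 - (\<Sum>i\<in>J. M p i * z i)" for p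
  define r where "r p = y p - (\<Sum>i\<in>J. M p i * x i)" for p
  have m: "(\<Sum>p\<in>I. M p j * m p) = 0" if "j \<in> J" for j using z that by (simp add: m_def)
  have r: "(\<Sum>p\<in>I. M p j * r p) = 0" if "j \<in> J" for j using x that by (simp add: r_def)
  have "\<exists>c. (\<Sum>p\<in>I. m p * (r p - c * m p)) = 0"
  proof (cases "(\<Sum>p\<in>I. m p * m p) = 0")
    case True
    have "(\<Sum>p\<in>I. m p * r p) = 0"
    proof (cases "finite I")
      case fin: True
      hence "\<forall>p\<in>I. m p * m p = 0" using True by (subst (asm) sum_nonneg_eq_0_iff) auto
      thus ?thesis by (intro sum.neutral) auto
    qed auto
    thus ?thesis by (intro exI[of _ 0]) simp
  next
    case False
    define c where "c = (\<Sum>p\<in>I. m p * r p) / (\<Sum>p\<in>I. m p * m p)"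
    have "(\<Sum>p\<in>I. m p * (r p - c * m p)) = (\<Sum>p\<in>I. m p * r p) - c * (\<Sum>p\<in>I. m p * m p)"
      by (simp add: right_diff_distrib sum_subtractf sum_distrib_left mult_ac)
    thus ?thesis using False by (intro exI[of _ c]) (simp add: c_def)
  qed
  then obtain c where c: "(\<Sum>p\<in>I. m p * (r p - c * m p)) = 0" by blast
  define x' where "x' = (\<lambda>i. x i - c * z i)(j0 := c)"
  have res: "y p - (\<Sum>i\<in>insert j0 J. M p i * x' i) = r p - c * m p" for p
  proof -
    have "(\<Sum>i\<in>J. M p i * x' i) = (\<Sum>i\<in>J. M p i * x i - c * (M p i * z i))"
      using insert.hyps by (intro sum.cong refl) (auto simp: x'_def algebra_simps)
    also have "\<dots> = (\<Sum>i\<in>J. M p i * x i) - c * (\<Sum>i\<in>J. M p i * z i)"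
      by (simp add: sum_subtractf sum_distrib_left)
    finally show ?thesis
      using insert.hyps by (simp add: r_def m_def x'_def algebra_simps)
  qed
  have orth: "(\<Sum>p\<in>I. M p j * (r p - c * m p)) = 0" if "j \<in> J" for j
  proof -
    have "(\<Sum>p\<in>I. M p j * (r p - c * m p)) = (\<Sum>p\<in>I. M p j * r p) - c * (\<Sum>p\<in>I. M p j * m p)"
      by (simp add: right_diff_distrib sum_subtractf sum_distrib_left mult_ac)
    thus ?thesis using m r that by simp
  qed
  have "(\<Sum>p\<in>I. M p j0 * (r p - c * m p)) =
     (\<Sum>p\<in>I. m p * (r p - c * m p)) + (\<Sum>p\<in>I. (\<Sum>i\<in>J. M p i * z i) * (r p - c * m p))"
    by (simp add: sum.distrib[symmetric] m_def algebra_simps)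
  also have "(\<Sum>p\<in>I. (\<Sum>i\<in>J. M p i * z i) * (r p - c * m p)) = (\<Sum>i\<in>J. z i * (\<Sum>p\<in>I. M p i * (r p - c * m p)))"
    unfolding sum_distrib_left sum_distrib_right by (subst sum.swap) (simp add: mult_ac)
  also have "\<dots> = 0" using orth by simp
  finally have "(\<Sum>p\<in>I. M p j0 * (r p - c * m p)) = 0" using c by simp
  thus ?case using orth by (intro exI[of _ x']) (simp only: res, auto)
qed auto

text \<open>The pairs \<open>(j, 1)\<close> alone give the recursion
  \<open>f (j + 1) = f j + f 1\<close>, so the kernel is no larger than the orbit direction.\<close>

lemma phase_diff_zero_imp:
  assumes "\<And>p. p \<in> index_pairs K \<Longrightarrow> phase_diff f p = 0" "j \<in> {1..K}"
  shows "f j = real j * f 1"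
  using assms(2)
proof (induction j)
  case (Suc j)
  show ?case
  proof (cases "j = 0")
    case False
    hence "(j, 1) \<in> index_pairs K" using Suc.prems by (auto simp: index_pairs_def)
    hence "f (Suc j) - f j - f 1 = 0" using assms(1) by (force simp: phase_diff_def)
    thus ?thesis using Suc False by (simp add: algebra_simps)
  qed auto
qed auto

lemma sum_phase_diff_mult:
  "(\<Sum>p\<in>index_pairs K. w p * phase_diff f p) = (\<Sum>j=1..K. f j * (\<Sum>p\<in>index_pairs K. w p * phase_mat p j))"
proof -
  have "(\<Sum>p\<in>index_pairs K. w p * phase_diff f p) = (\<Sum>p\<in>index_pairs K. \<Sum>j=1..K. f j * (w p * phase_mat p j))"
    by (intro sum.cong refl) (simp add: sum_phase_mat[symmetric] sum_distrib_left mult_ac)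
  also have "\<dots> = (\<Sum>j=1..K. f j * (\<Sum>p\<in>index_pairs K. w p * phase_mat p j))"
    by (subst sum.swap) (simp add: sum_distrib_left)
  finally show ?thesis .
qed

text \<open>The squared length of the kernel vector \<open>real\<close> on \<open>{1..K}\<close>; it
  normalises the projection onto the orbit direction.\<close>

definition sum_sq :: "nat \<Rightarrow> real" where
  "sum_sq K = (\<Sum>j=1..K. (real j)\<^sup>2)"

lemma sum_sq_ge: "real K ^ 3 / 3 \<le> sum_sq K"
  unfolding sum_sq_def by (induction K) (auto simp: power2_eq_square power3_eq_cube algebra_simps)

lemma sum_sq_pos: "K \<ge> 1 \<Longrightarrow> sum_sq K > 0"
  by (rule less_le_trans[OF _ sum_sq_ge]) auto

text \<open>Least squares is used twice. For the transposed matrix the residual of \<open>b\<close>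
  lies in the kernel, hence is a multiple of \<open>real\<close>; being also orthogonal to
  \<open>real\<close> it is zero, so \<open>b\<close> is M^T y for some \<open>y\<close>. Projecting
  \<open>y\<close> onto the range of M gives \<open>b\<close> as M^T M x, and a multiple of
  \<open>real\<close> is finally subtracted from \<open>x\<close>.\<close>

lemma phase_mat_range:
  assumes K: "K \<ge> 1" and b: "(\<Sum>j=1..K. real j * b j) = 0"
  obtains g where "\<And>j. j \<in> {1..K} \<Longrightarrow> (\<Sum>p\<in>index_pairs K. phase_diff g p * phase_mat p j) = b j"
    "(\<Sum>j=1..K. real j * g j) = 0"
proof -
  let ?I = "index_pairs K"
  obtain y where y: "\<forall>p\<in>?I. (\<Sum>j=1..K. phase_mat p j * (b j - (\<Sum>q\<in>?I. phase_mat q j * y q))) = 0"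
    using normal_equations_solvable[where J = ?I and I = "{1..K}" and M = "\<lambda>j p. phase_mat p j" and y = b] by auto
  define r where "r j = b j - (\<Sum>q\<in>?I. phase_mat q j * y q)" for j
  have "phase_diff r p = 0" if "p \<in> ?I" for p
  proof -
    have "(\<Sum>j=1..K. phase_mat p j * r j) = 0" using y that unfolding r_def by blast
    thus ?thesis by (simp only: sum_phase_mat[OF that])
  qed
  from phase_diff_zero_imp[OF this] have rj: "r j = real j * r 1" if "j \<in> {1..K}" for j using that by blast
  have "(\<Sum>j=1..K. real j * (\<Sum>q\<in>?I. y q * phase_mat q j)) = 0"
    by (subst sum_phase_diff_mult[symmetric]) simp
  hence "(\<Sum>j=1..K. real j * r j) = 0"
    using b by (simp add: r_def right_diff_distrib sum_subtractf mult.commute[of "phase_mat _ _"])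
  moreover have "(\<Sum>j=1..K. real j * r j) = sum_sq K * r 1"
    unfolding sum_sq_def sum_distrib_right
    by (intro sum.cong refl) (subst rj, auto simp: power2_eq_square)
  ultimately have "r 1 = 0" using sum_sq_pos[OF K] by simp
  hence r0: "b j = (\<Sum>q\<in>?I. phase_mat q j * y q)" if "j \<in> {1..K}" for j
    using rj[OF that] by (simp add: r_def)
  obtain x where x: "\<forall>j\<in>{1..K}. (\<Sum>p\<in>?I. phase_mat p j * (y p - (\<Sum>i\<in>{1..K}. phase_mat p i * x i))) = 0"
    using normal_equations_solvable[where J = "{1..K}" and I = ?I and M = phase_mat and y = y] by auto
  have x1: "(\<Sum>p\<in>?I. phase_diff x p * phase_mat p j) = b j" if "j \<in> {1..K}" for j
  proof -
    have "(\<Sum>p\<in>?I. phase_mat p j * (y p - (\<Sum>i\<in>{1..K}. phase_mat p i * x i)))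
        = (\<Sum>p\<in>?I. phase_mat p j * y p - phase_diff x p * phase_mat p j)"
      by (intro sum.cong refl) (simp only: sum_phase_mat, simp add: algebra_simps)
    also have "\<dots> = b j - (\<Sum>p\<in>?I. phase_diff x p * phase_mat p j)"
      using r0[OF that] by (simp add: sum_subtractf)
    finally show ?thesis using x that by auto
  qed
  define t where "t = (\<Sum>j=1..K. real j * x j) / sum_sq K"
  define g where "g j = x j - t * real j" for j
  have "phase_diff g p = phase_diff x p" for p
    by (simp add: g_def[abs_def] phase_diff_diff phase_diff_cmult)
  moreover have "(\<Sum>j=1..K. real j * g j) = (\<Sum>j=1..K. real j * x j) - t * sum_sq K"
    unfolding sum_sq_def sum_distrib_left sum_subtractf[symmetric]
    by (intro sum.cong refl) (simp add: g_def algebra_simps power2_eq_square)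
  ultimately show ?thesis using that[of g] x1 sum_sq_pos[OF K] by (simp add: t_def)
qed

text \<open>The symmetry equations give AP = AQ and PA = QA; then P = PAP = QAP = QAQ = Q.\<close>

lemma is_pinv_unique:
  assumes P: "is_pinv I J A P" and Q: "is_pinv I J A Q"
  shows "P = Q"
proof (intro ext)
  fix j0 i0
  note d = is_pinv_def mat_prod_def
  have assoc: "(\<Sum>i\<in>I. (\<Sum>j\<in>J. f j * g j i) * h i) = (\<Sum>j\<in>J. f j * (\<Sum>i\<in>I. g j i * h i))"
    for f h :: "_ \<Rightarrow> real" and g
    unfolding sum_distrib_left sum_distrib_right by (subst sum.swap) (simp add: mult_ac)
  have assoc': "(\<Sum>j\<in>J. (\<Sum>i\<in>I. f i * g i j) * h j) = (\<Sum>i\<in>I. f i * (\<Sum>j\<in>J. g i j * h j))"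
    for f h :: "_ \<Rightarrow> real" and g
    unfolding sum_distrib_left sum_distrib_right by (subst sum.swap) (simp add: mult_ac)
  have left: "(\<Sum>j\<in>J. A i j * P j i') = (\<Sum>j\<in>J. A i j * Q j i')" if ii: "i \<in> I" "i' \<in> I" for i i'
  proof -
    have aux: "(\<Sum>l\<in>I. (\<Sum>j\<in>J. A i j * Q j l) * (\<Sum>j\<in>J. A l j * R j i')) = (\<Sum>j\<in>J. A i j * R j i')"
      if "i \<in> I" "is_pinv I J A Q" for i i' Q R
    proof -
      have fact: "(\<Sum>l\<in>I. (\<Sum>j\<in>J. A i j * Q j l) * A l j') = A i j'" if "j' \<in> J" for j'
        using \<open>is_pinv I J A Q\<close> \<open>i \<in> I\<close> that unfolding d by blast
      have "(\<Sum>l\<in>I. (\<Sum>j\<in>J. A i j * Q j l) * (\<Sum>j\<in>J. A l j * R j i')) =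
         (\<Sum>j\<in>J. (\<Sum>l\<in>I. (\<Sum>j\<in>J. A i j * Q j l) * A l j) * R j i')"
        by (rule assoc'[symmetric])
      also have "\<dots> = (\<Sum>j\<in>J. A i j * R j i')"
        using fact by (intro sum.cong refl) (simp only:)
      finally show ?thesis .
    qed
    have "(\<Sum>j\<in>J. A i j * P j i') = (\<Sum>j\<in>J. A i' j * P j i)"
      using P ii unfolding d by simp
    also have "\<dots> = (\<Sum>l\<in>I. (\<Sum>j\<in>J. A i' j * Q j l) * (\<Sum>j\<in>J. A l j * P j i))"
      by (rule aux[symmetric, OF ii(2) Q])
    also have "\<dots> = (\<Sum>l\<in>I. (\<Sum>j\<in>J. A i j * P j l) * (\<Sum>j\<in>J. A l j * Q j i'))"
      using P Q ii unfolding d by (intro sum.cong refl) (simp add: mult.commute)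
    also have "\<dots> = (\<Sum>j\<in>J. A i j * Q j i')" by (rule aux[OF ii(1) P])
    finally show ?thesis .
  qed
  have right: "(\<Sum>i\<in>I. P j i * A i j') = (\<Sum>i\<in>I. Q j i * A i j')" if jj: "j \<in> J" "j' \<in> J" for j j'
  proof -
    have aux: "(\<Sum>l\<in>J. (\<Sum>i\<in>I. R j i * A i l) * (\<Sum>i\<in>I. Q l i * A i j')) = (\<Sum>i\<in>I. R j i * A i j')"
      if "j' \<in> J" "is_pinv I J A Q" for j j' Q R
    proof -
      have fact: "(\<Sum>l\<in>J. A i l * (\<Sum>i\<in>I. Q l i * A i j')) = A i j'" if "i \<in> I" for i
        using \<open>is_pinv I J A Q\<close> \<open>j' \<in> J\<close> that unfolding d assoc[symmetric] by blast
      have "(\<Sum>l\<in>J. (\<Sum>i\<in>I. R j i * A i l) * (\<Sum>i\<in>I. Q l i * A i j')) =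
         (\<Sum>i\<in>I. R j i * (\<Sum>l\<in>J. A i l * (\<Sum>i\<in>I. Q l i * A i j')))"
        by (rule assoc')
      also have "\<dots> = (\<Sum>i\<in>I. R j i * A i j')"
        using fact by (intro sum.cong refl) (simp only:)
      finally show ?thesis .
    qed
    have "(\<Sum>i\<in>I. P j i * A i j') = (\<Sum>i\<in>I. P j' i * A i j)"
      using P jj unfolding d by simp
    also have "\<dots> = (\<Sum>l\<in>J. (\<Sum>i\<in>I. P j' i * A i l) * (\<Sum>i\<in>I. Q l i * A i j))"
      by (rule aux[symmetric, OF jj(1) Q])
    also have "\<dots> = (\<Sum>l\<in>J. (\<Sum>i\<in>I. Q j i * A i l) * (\<Sum>i\<in>I. P l i * A i j'))"
      using P Q jj unfolding d by (intro sum.cong refl) (simp add: mult.commute)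
    also have "\<dots> = (\<Sum>i\<in>I. Q j i * A i j')" by (rule aux[OF jj(2) P])
    finally show ?thesis .
  qed
  show "P j0 i0 = Q j0 i0"
  proof (cases "j0 \<in> J \<and> i0 \<in> I")
    case True
    have penrose: "(\<Sum>j\<in>J. (\<Sum>i\<in>I. R j0 i * A i j) * R j i0) = R j0 i0" if "is_pinv I J A R" for R
      using that True unfolding d by blast
    have "P j0 i0 = (\<Sum>j\<in>J. (\<Sum>i\<in>I. P j0 i * A i j) * P j i0)"
      by (rule penrose[OF P, symmetric])
    also have "\<dots> = (\<Sum>j\<in>J. (\<Sum>i\<in>I. Q j0 i * A i j) * P j i0)"
      using True by (intro sum.cong refl) (simp add: right)
    also have "\<dots> = (\<Sum>i\<in>I. Q j0 i * (\<Sum>j\<in>J. A i j * P j i0))" by (rule assoc')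
    also have "\<dots> = (\<Sum>i\<in>I. Q j0 i * (\<Sum>j\<in>J. A i j * Q j i0))"
      using True by (intro sum.cong refl) (simp add: left)
    also have "\<dots> = (\<Sum>j\<in>J. (\<Sum>i\<in>I. Q j0 i * A i j) * Q j i0)" by (rule assoc'[symmetric])
    also have "\<dots> = Q j0 i0" by (rule penrose[OF Q])
    finally show ?thesis .
  next
    case False
    thus ?thesis using P Q unfolding is_pinv_def by (metis mem_Sigma_iff)
  qed
qed

lemma sum_delta_minus:
  assumes "k \<in> {1..K}"
  shows "(\<Sum>j=1..K. f j * (of_bool (j = k) - real k * real j / V)) = f k - real k / V * (\<Sum>j=1..K. real j * f j)"
proof -
  have "(\<Sum>j=1..K. f j * (of_bool (j = k) - real k * real j / V))
      = (\<Sum>j=1..K. (if j = k then f j else 0) - real k / V * (real j * f j))"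
    by (intro sum.cong refl) (auto simp: algebra_simps)
  also have "\<dots> = f k - real k / V * (\<Sum>j=1..K. real j * f j)"
    using assms by (simp add: sum_subtractf sum_distrib_left)
  finally show ?thesis .
qed

text \<open>The potentials \<open>G k\<close> are the rows of the pseudo-inverse of the normal
  matrix, and the pseudo-inverse of M is that matrix times M^T. Choosing each \<open>G k\<close>
  orthogonal to \<open>real\<close> makes \<open>G\<close> symmetric, from which the remaining
  Penrose equations follow.\<close>

lemma pinv_phase_mat:
  assumes K: "K \<ge> 1"
  obtains G where
    "\<And>k p. k \<in> {1..K} \<Longrightarrow> p \<in> index_pairs K \<Longrightarrow>
       pinv (index_pairs K) {1..K} phase_mat k p = phase_diff (G k) p"
    "\<And>k j. k \<in> {1..K} \<Longrightarrow> j \<in> {1..K} \<Longrightarrow>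
       (\<Sum>p\<in>index_pairs K. phase_diff (G k) p * phase_mat p j) = of_bool (j = k) - real k * real j / sum_sq K"
proof -
  let ?I = "index_pairs K"
  define V where "V = sum_sq K"
  have V: "V > 0" using sum_sq_pos[OF K] by (simp add: V_def)
  have "\<exists>g. (\<forall>j\<in>{1..K}. (\<Sum>p\<in>?I. phase_diff g p * phase_mat p j) = of_bool (j = k) - real k * real j / V)
     \<and> (\<Sum>j=1..K. real j * g j) = 0" if k: "k \<in> {1..K}" for k
  proof -
    have "(\<Sum>j=1..K. real j * (of_bool (j = k) - real k * real j / V)) = 0"
      unfolding sum_delta_minus[OF k] using V unfolding V_def sum_sq_def by (simp add: power2_eq_square)
    from phase_mat_range[OF K this] show ?thesis by metis
  qed
  then obtain G where G: "\<And>k j. k \<in> {1..K} \<Longrightarrow> j \<in> {1..K} \<Longrightarrow>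
       (\<Sum>p\<in>?I. phase_diff (G k) p * phase_mat p j) = of_bool (j = k) - real k * real j / V"
     and G0: "\<And>k. k \<in> {1..K} \<Longrightarrow> (\<Sum>j=1..K. real j * G k j) = 0"
    by metis
  have sym: "G k j = G j k" if "k \<in> {1..K}" "j \<in> {1..K}" for k j
  proof -
    have *: "(\<Sum>p\<in>?I. phase_diff (G k) p * phase_diff (G j) p) = G j k"
      if "k \<in> {1..K}" "j \<in> {1..K}" for k j
      unfolding sum_phase_diff_mult using G[OF that(1)] sum_delta_minus[OF that(1), of "G j" V] G0[OF that(2)]
      by simp
    show ?thesis using *[OF that] *[OF that(2,1)] by (simp add: mult.commute)
  qed
  define P where "P k p = (if k \<in> {1..K} \<and> p \<in> ?I then phase_diff (G k) p else 0)" for k p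
  have PM: "(\<Sum>p\<in>?I. P k p * phase_mat p j) = of_bool (j = k) - real k * real j / V"
    if "k \<in> {1..K}" "j \<in> {1..K}" for k j
  proof -
    have "(\<Sum>p\<in>?I. P k p * phase_mat p j) = (\<Sum>p\<in>?I. phase_diff (G k) p * phase_mat p j)"
      using that by (intro sum.cong refl) (auto simp: P_def)
    thus ?thesis using G[OF that] by simp
  qed
  have "is_pinv ?I {1..K} phase_mat P"
    unfolding is_pinv_def mat_prod_def
  proof (intro conjI ballI allI impI)
    fix p j assume p: "p \<in> ?I" and j: "j \<in> {1..K}"
    have "(\<Sum>q\<in>?I. (\<Sum>k\<in>{1..K}. phase_mat p k * P k q) * phase_mat q j)
       = (\<Sum>k\<in>{1..K}. phase_mat p k * (\<Sum>q\<in>?I. P k q * phase_mat q j))"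
      unfolding sum_distrib_left sum_distrib_right by (subst sum.swap) (simp add: mult_ac)
    also have "\<dots> = (\<Sum>k\<in>{1..K}. phase_mat p k * (of_bool (k = j) - real j * real k / V))"
      using j by (intro sum.cong refl) (subst PM, auto simp: mult_ac)
    also have "\<dots> = phase_mat p j - real j / V * (\<Sum>k=1..K. phase_mat p k * real k)"
      unfolding sum_delta_minus[OF j] by (simp add: mult.commute)
    also have "(\<Sum>k=1..K. phase_mat p k * real k) = 0" by (subst sum_phase_mat[OF p]) simp
    finally show "(\<Sum>q\<in>?I. (\<Sum>k\<in>{1..K}. phase_mat p k * P k q) * phase_mat q j) = phase_mat p j" by simp
  next
    fix k p assume k: "k \<in> {1..K}" and p: "p \<in> ?I"
    have "(\<Sum>j\<in>{1..K}. (\<Sum>q\<in>?I. P k q * phase_mat q j) * P j p) =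
       (\<Sum>j\<in>{1..K}. phase_diff (G j) p * (of_bool (j = k) - real k * real j / V))"
      using k p by (intro sum.cong refl) (subst PM, auto simp: P_def)
    also have "\<dots> = phase_diff (G k) p - real k / V * (\<Sum>j=1..K. real j * phase_diff (G j) p)"
      by (rule sum_delta_minus[OF k])
    also have "(\<Sum>j=1..K. real j * phase_diff (G j) p) = phase_diff (\<lambda>i. \<Sum>j=1..K. real j * G j i) p"
      by (simp add: phase_diff_sum phase_diff_cmult)
    also have "\<dots> = phase_diff (\<lambda>i. 0) p"
    proof -
      have "(\<Sum>j=1..K. real j * G j i) = 0" if i: "i \<in> {1..K}" for i
      proof -
        have "(\<Sum>j=1..K. real j * G j i) = (\<Sum>j=1..K. real j * G i j)"
          using sym[OF _ i] by (intro sum.cong refl) simp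
        thus ?thesis using G0[OF i] by simp
      qed
      thus ?thesis using p by (auto simp: phase_diff_def index_pairs_def)
    qed
    finally show "(\<Sum>j\<in>{1..K}. (\<Sum>q\<in>?I. P k q * phase_mat q j) * P j p) = P k p"
      using k p by (simp add: P_def phase_diff_def case_prod_unfold)
  next
    fix p q assume pq: "p \<in> ?I" "q \<in> ?I"
    have *: "(\<Sum>j\<in>{1..K}. phase_mat p j * P j q) =
        (\<Sum>j\<in>{1..K}. \<Sum>i\<in>{1..K}. phase_mat p j * phase_mat q i * G j i)" if "p \<in> ?I" "q \<in> ?I" for p q
      using that by (intro sum.cong refl) (simp add: P_def sum_phase_mat[symmetric] sum_distrib_left mult_ac)
    show "(\<Sum>j\<in>{1..K}. phase_mat p j * P j q) = (\<Sum>j\<in>{1..K}. phase_mat q j * P j p)"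
      unfolding *[OF pq] *[OF pq(2,1)]
      by (subst sum.swap) (intro sum.cong refl, subst sym, auto simp: mult_ac)
  next
    fix k j assume "k \<in> {1..K}" "j \<in> {1..K}"
    thus "(\<Sum>p\<in>?I. P k p * phase_mat p j) = (\<Sum>p\<in>?I. P j p * phase_mat p k)"
      by (subst (1 2) PM) (auto simp: mult_ac)
  qed (auto simp: P_def)
  hence "pinv ?I {1..K} phase_mat = P"
    unfolding pinv_def by (intro the_equality) (auto intro: is_pinv_unique)
  thus ?thesis using G by (intro that[of G]) (auto simp: P_def V_def)
qed

text \<open>The pseudo-inverse times M is the projection along the kernel. Least squares therefore
  recovers the phases up to a linear function of \<open>k\<close>, which is a rotation and costs
  nothing in the loss.\<close>

lemma pinv_phase_diff:
  assumes K: "K \<ge> 1" and k: "k \<in> {1..K}"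
  shows "(\<Sum>p\<in>index_pairs K. pinv (index_pairs K) {1..K} phase_mat k p * phase_diff f p)
     = f k - real k / sum_sq K * (\<Sum>j=1..K. real j * f j)"
proof -
  obtain G where G: "\<And>k p. k \<in> {1..K} \<Longrightarrow> p \<in> index_pairs K \<Longrightarrow>
       pinv (index_pairs K) {1..K} phase_mat k p = phase_diff (G k) p"
    "\<And>k j. k \<in> {1..K} \<Longrightarrow> j \<in> {1..K} \<Longrightarrow>
       (\<Sum>p\<in>index_pairs K. phase_diff (G k) p * phase_mat p j) = of_bool (j = k) - real k * real j / sum_sq K"
    using pinv_phase_mat[OF K] by blast
  have "(\<Sum>p\<in>index_pairs K. pinv (index_pairs K) {1..K} phase_mat k p * phase_diff f p) =
     (\<Sum>p\<in>index_pairs K. phase_diff (G k) p * phase_diff f p)"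
    using G(1) k by (intro sum.cong refl) simp
  also have "\<dots> = (\<Sum>j=1..K. f j * (of_bool (j = k) - real k * real j / sum_sq K))"
    unfolding sum_phase_diff_mult using G(2) k by (intro sum.cong refl) simp
  also have "\<dots> = f k - real k / sum_sq K * (\<Sum>j=1..K. real j * f j)"
    by (rule sum_delta_minus[OF k])
  finally show ?thesis .
qed

text \<open>Solving the diagonal part of the normal equations exactly leaves a right-hand side that is
  uniformly \<open>O(1/K)\<close>; the spectral gap then controls the remaining correction in \<open>l\<^sup>1\<close>.\<close>

lemma pinv_phase_mat_bound:
  assumes K: "K \<ge> 1" and k: "k \<in> {1..K}"
  obtains a where "\<And>j. j \<in> {1..K} \<Longrightarrow> 0 \<le> a j" "\<And>j. j \<in> {1..K} \<Longrightarrow> a j \<le> 652 / real K"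
    "(\<Sum>j=1..K. a j) \<le> 652 / real K"
    "\<And>i j. (i, j) \<in> index_pairs K \<Longrightarrow>
       \<bar>pinv (index_pairs K) {1..K} phase_mat k (i, j)\<bar> \<le> a (i + j) + a i + a j"
proof -
  let ?I = "index_pairs K"
  obtain G where G: "\<And>k p. k \<in> {1..K} \<Longrightarrow> p \<in> index_pairs K \<Longrightarrow>
       pinv (index_pairs K) {1..K} phase_mat k p = phase_diff (G k) p"
    "\<And>k j. k \<in> {1..K} \<Longrightarrow> j \<in> {1..K} \<Longrightarrow>
       (\<Sum>p\<in>index_pairs K. phase_diff (G k) p * phase_mat p j) = of_bool (j = k) - real k * real j / sum_sq K"
    using pinv_phase_mat[OF K] by blast
  define g where "g = G k"
  define N where "N f j = (\<Sum>i=1..K. of_bool (K < i + j) * f i)" for f :: "nat \<Rightarrow> real" and j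
  define D where "D j = 2 * real K + 1 - real j" for j
  define b where "b j = of_bool (j = k) - real k * real j / sum_sq K" for j
  define g0 where "g0 j = b j / D j" for j
  define h where "h j = g j - g0 j" for j
  define e where "e j = 2 * N g0 j" for j
  have DK: "D j \<ge> real K" "D j > 0" if "j \<in> {1..K}" for j using that by (auto simp: D_def)
  have K0: "real K > 0" using K by simp
  have nonneg: "\<bar>N f j\<bar> \<le> (\<Sum>i=1..K. \<bar>f i\<bar>)" for f j
    unfolding N_def by (rule order.trans[OF sum_abs]) (auto intro!: sum_mono simp: abs_mult of_bool_def)
  have Ndiff: "N (\<lambda>j. f j - f' j) j = N f j - N f' j" for f f' j
    by (simp only: N_def right_diff_distrib sum_subtractf)
  have Nscale: "N (\<lambda>j. c * f j) j = c * N f j" for f c j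
    by (simp only: N_def sum_distrib_left mult.left_commute)
  have gA: "D j * g j - 2 * N g j = b j" if "j \<in> {1..K}" for j
    using G(2)[OF k that] unfolding sum_phase_diff_phase_mat[OF that] g_def D_def N_def b_def .
  have hA: "D j * h j - 2 * N h j = e j" if "j \<in> {1..K}" for j
  proof -
    have "D j * h j - 2 * N h j = (D j * g j - 2 * N g j) - D j * g0 j + 2 * N g0 j"
      unfolding h_def[abs_def] Ndiff by (simp add: algebra_simps)
    also have "\<dots> = e j" using gA[OF that] DK[OF that] by (simp add: g0_def e_def)
    finally show ?thesis .
  qed
  have g0b: "\<bar>g0 j\<bar> \<le> of_bool (j = k) / real K + 3 / (real K)\<^sup>2" if j: "j \<in> {1..K}" for j
  proof -
    have "real k * real j / sum_sq K \<le> (real K * real K) / (real K ^ 3 / 3)"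
      using sum_sq_ge[of K] k j K by (intro frac_le mult_mono) auto
    also have "\<dots> = 3 / real K" using K by (simp add: power3_eq_cube)
    finally have kj: "real k * real j / sum_sq K \<le> 3 / real K" .
    have kj0: "0 \<le> real k * real j / sum_sq K" using sum_sq_pos[OF K] by simp
    have "\<bar>b j\<bar> \<le> \<bar>of_bool (j = k)\<bar> + \<bar>real k * real j / sum_sq K\<bar>" unfolding b_def by (rule abs_triangle_ineq4)
    hence "\<bar>b j\<bar> \<le> of_bool (j = k) + 3 / real K" using kj kj0 by simp
    hence "\<bar>b j\<bar> / D j \<le> (of_bool (j = k) + 3 / real K) / real K"
      using DK[OF j] K by (intro frac_le) auto
    thus ?thesis using DK[OF j] K by (simp add: g0_def add_divide_distrib power2_eq_square)
  qed
  have sum_delta: "(\<Sum>j=1..K. of_bool (j = k) / real K + c / (real K)\<^sup>2) = (1 + c) / real K" for c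
  proof -
    have "(\<Sum>j=1..K. of_bool (j = k) / real K) = (\<Sum>j=1..K. if j = k then 1 / real K else 0)"
      by (intro sum.cong) auto
    also have "\<dots> = 1 / real K" using k by simp
    finally show ?thesis unfolding sum.distrib using K by (simp add: power2_eq_square add_divide_distrib)
  qed
  have "(\<Sum>j=1..K. \<bar>g0 j\<bar>) \<le> (\<Sum>j=1..K. of_bool (j = k) / real K + 3 / (real K)\<^sup>2)"
    by (intro sum_mono g0b)
  also have "\<dots> = 4 / real K" by (subst sum_delta) simp
  finally have eb: "\<bar>e j\<bar> \<le> 8 / real K" for j using nonneg[of g0 j] by (simp add: e_def)
  obtain c where c: "real K * (\<Sum>j=1..K. (h j - c * real j)\<^sup>2) \<le> 40 * (\<Sum>p\<in>?I. (phase_diff h p)\<^sup>2)"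
    using phase_diff_gap[OF K] by blast
  define h' where "h' j = h j - c * real j" for j
  define S where "S = (\<Sum>j=1..K. \<bar>h' j\<bar>)"
  have S0: "S \<ge> 0" unfolding S_def by (intro sum_nonneg) auto
  have pd: "phase_diff h p = phase_diff h' p" for p
    unfolding h'_def[abs_def] by (simp add: phase_diff_diff phase_diff_cmult)
  have hA': "D j * h' j - 2 * N h' j = e j" if "j \<in> {1..K}" for j
  proof -
    have "D j * real j - 2 * N real j = 0"
      using sum_phase_diff_phase_mat[OF that, of real] unfolding D_def N_def by simp
    moreover have "D j * h' j - 2 * N h' j = (D j * h j - 2 * N h j) - c * (D j * real j - 2 * N real j)"
      unfolding h'_def[abs_def] Ndiff Nscale by (simp add: algebra_simps)
    ultimately show ?thesis using hA[OF that] by simp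
  qed
  \<comment> \<open>Cauchy--Schwarz and the spectral gap bound \<open>S\<^sup>2\<close> by the
    energy of \<open>h'\<close>. The normal equations turn this energy into the pairing of
    \<open>h'\<close> with \<open>e\<close>, which is linear in \<open>S\<close>, so one factor
    \<open>S\<close> cancels.\<close>
  have "S\<^sup>2 \<le> real K * (\<Sum>j=1..K. (h' j)\<^sup>2)"
    using sum_squared_le_sum_of_squares[of "\<lambda>j. \<bar>h' j\<bar>" "{1..K}"] by (simp add: S_def mult.commute)
  also have "\<dots> \<le> 40 * (\<Sum>p\<in>?I. (phase_diff h p)\<^sup>2)" using c by (simp add: h'_def)
  also have "(\<Sum>p\<in>?I. (phase_diff h p)\<^sup>2) = (\<Sum>p\<in>?I. phase_diff h' p * phase_diff h' p)"
    by (simp add: pd power2_eq_square)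
  also have "\<dots> = (\<Sum>j=1..K. h' j * e j)"
    unfolding sum_phase_diff_mult
    by (intro sum.cong refl) (simp only: sum_phase_diff_phase_mat D_def[symmetric] N_def[symmetric] hA')
  also have "\<dots> \<le> (\<Sum>j=1..K. \<bar>h' j\<bar> * (8 / real K))"
  proof (intro sum_mono)
    fix j
    have "h' j * e j \<le> \<bar>h' j\<bar> * \<bar>e j\<bar>" by (metis abs_ge_self abs_mult)
    also have "\<dots> \<le> \<bar>h' j\<bar> * (8 / real K)" using eb by (intro mult_left_mono) auto
    finally show "h' j * e j \<le> \<bar>h' j\<bar> * (8 / real K)" .
  qed
  also have "\<dots> = S * (8 / real K)" by (simp only: S_def sum_distrib_right)
  finally have "S * S \<le> S * (320 / real K)" by (simp add: power2_eq_square mult.commute)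
  hence Sb: "S \<le> 320 / real K" 
  proof (cases "S = 0")
    case False
    hence "0 < S" using S0 by simp
    thus ?thesis using \<open>S * S \<le> S * (320 / real K)\<close> by (simp only: mult_le_cancel_left_pos)
  qed simp
  \<comment> \<open>Reading the normal equation at \<open>j\<close> and dividing by
    \<open>D j \<ge> K\<close> converts the \<open>l^1\<close> bound of order \<open>1 / K\<close>
    into a pointwise bound of order \<open>1 / K^2\<close>.\<close>
  have h'b: "\<bar>h' j\<bar> \<le> 648 / (real K)\<^sup>2" if j: "j \<in> {1..K}" for j
  proof -
    have "D j * h' j = 2 * N h' j + e j" using hA'[OF j] by simp
    hence "\<bar>D j * h' j\<bar> \<le> 2 * \<bar>N h' j\<bar> + \<bar>e j\<bar>" by linarith
    also have "\<dots> \<le> 2 * (320 / real K) + 8 / real K"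
      using nonneg[of h' j] Sb eb[of j] unfolding S_def by (intro add_mono mult_left_mono) linarith+
    finally have "D j * \<bar>h' j\<bar> \<le> 648 / real K" using DK[OF j] by (simp add: abs_mult)
    moreover have "real K * \<bar>h' j\<bar> \<le> D j * \<bar>h' j\<bar>" using DK[OF j] by (intro mult_right_mono) auto
    ultimately have "real K * \<bar>h' j\<bar> \<le> 648 / real K" by linarith
    thus ?thesis using K0 by (simp add: field_simps power2_eq_square)
  qed
  \<comment> \<open>A spike at \<open>k\<close> on a flat background; 651 is 3 from
    \<open>g0b\<close> plus 648 from \<open>h'b\<close>.\<close>
  define a where "a j = of_bool (j = k) / real K + 651 / (real K)\<^sup>2" for j
  have ab: "\<bar>g0 j + h' j\<bar> \<le> a j" if "j \<in> {1..K}" for j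
  proof -
    have "\<bar>g0 j + h' j\<bar> \<le> (of_bool (j = k) / real K + 3 / (real K)\<^sup>2) + 648 / (real K)\<^sup>2"
      using g0b[OF that] h'b[OF that] abs_triangle_ineq[of "g0 j" "h' j"] by linarith
    thus ?thesis by (simp add: a_def)
  qed
  show ?thesis
  proof (rule that[of a])
    have "651 / (real K)\<^sup>2 \<le> 651 / real K" using K by (intro divide_left_mono) (auto simp: power2_eq_square)
    moreover have "of_bool (j = k) / real K \<le> 1 / real K" for j by (auto simp: of_bool_def)
    ultimately show "a j \<le> 652 / real K" for j using add_mono[of "of_bool (j = k) / real K" "1 / real K" "651 / (real K)\<^sup>2" "651 / real K"]
      unfolding a_def by (simp add: add_divide_distrib[symmetric])
    show "(\<Sum>j=1..K. a j) \<le> 652 / real K" unfolding a_def sum_delta by simp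
  next
    fix i j assume ij: "(i, j) \<in> ?I"
    have "pinv ?I {1..K} phase_mat k (i, j) = phase_diff g (i, j)" using G(1)[OF k ij] by (simp add: g_def)
    also have "g = (\<lambda>j. g0 j + h j)" by (simp add: h_def fun_eq_iff)
    also have "phase_diff (\<lambda>j. g0 j + h j) (i, j) = phase_diff (\<lambda>j. g0 j + h' j) (i, j)"
      by (simp only: phase_diff_add pd)
    also have "\<dots> = (g0 (i + j) + h' (i + j)) - (g0 i + h' i) - (g0 j + h' j)" by (simp add: phase_diff_def)
    finally show "\<bar>pinv ?I {1..K} phase_mat k (i, j)\<bar> \<le> a (i + j) + a i + a j"
      using ab[of "i + j"] ab[of i] ab[of j] ij by (auto simp: index_pairs_def)
  qed (auto simp: a_def)
qed

lemma pinv_phase_mat_max: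
  assumes K: "K \<ge> 1" and k: "k \<in> {1..K}" and p: "p \<in> index_pairs K"
  shows "\<bar>pinv (index_pairs K) {1..K} phase_mat k p\<bar> \<le> 2000 / real K"
proof -
  obtain i j where ij: "p = (i, j)" by force
  obtain a where a: "\<And>j. j \<in> {1..K} \<Longrightarrow> a j \<le> 652 / real K"
    "\<And>i j. (i, j) \<in> index_pairs K \<Longrightarrow>
       \<bar>pinv (index_pairs K) {1..K} phase_mat k (i, j)\<bar> \<le> a (i + j) + a i + a j"
    by (rule pinv_phase_mat_bound[OF K k]) blast
  have mem: "i + j \<in> {1..K}" "i \<in> {1..K}" "j \<in> {1..K}" using p by (auto simp: ij index_pairs_def)
  have "a (i + j) + a i + a j \<le> 652 / real K + 652 / real K + 652 / real K"
    by (intro add_mono a mem)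
  also have "\<dots> \<le> 2000 / real K" using K by (simp add: field_simps)
  finally show ?thesis using a(2)[of i j] p ij by simp
qed

text \<open>Each index occurs in at most \<open>K\<close> pairs as first component, as second
  component and as sum, so the total is at most \<open>3 * K\<close> times the sum of
  \<open>a\<close>.\<close>

lemma pinv_phase_mat_l1:
  assumes K: "K \<ge> 1" and k: "k \<in> {1..K}"
  shows "(\<Sum>p\<in>index_pairs K. \<bar>pinv (index_pairs K) {1..K} phase_mat k p\<bar>) \<le> 2000"
proof -
  let ?I = "index_pairs K"
  obtain a where a: "\<And>j. j \<in> {1..K} \<Longrightarrow> 0 \<le> a j" "(\<Sum>j=1..K. a j) \<le> 652 / real K"
    "\<And>i j. (i, j) \<in> index_pairs K \<Longrightarrow>
       \<bar>pinv (index_pairs K) {1..K} phase_mat k (i, j)\<bar> \<le> a (i + j) + a i + a j"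
    by (rule pinv_phase_mat_bound[OF K k]) blast
  have sw: "(\<Sum>(i, j)\<in>?I. a j) = (\<Sum>(i, j)\<in>?I. a i)" by (rule sum_index_pairs_swap)
  have "(\<Sum>p\<in>?I. \<bar>pinv ?I {1..K} phase_mat k p\<bar>) \<le> (\<Sum>(i, j)\<in>?I. a (i + j) + a i + a j)"
    using a(3) by (intro sum_mono) (auto simp: case_prod_unfold)
  also have "\<dots> = (\<Sum>(i, j)\<in>?I. a (i + j)) + (\<Sum>(i, j)\<in>?I. a i) + (\<Sum>(i, j)\<in>?I. a j)"
    by (simp add: case_prod_unfold sum.distrib)
  also have "\<dots> \<le> (\<Sum>j=1..K. real K * a j) + (\<Sum>j=1..K. real K * a j) + (\<Sum>j=1..K. real K * a j)"
    unfolding sw sum_index_pairs_fst sum_index_pairs_sum using a(1)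
    by (intro add_mono sum_mono mult_right_mono) auto
  also have "\<dots> = 3 * (real K * (\<Sum>j=1..K. a j))"
    unfolding sum_distrib_left[symmetric] by simp
  also have "\<dots> \<le> 3 * (real K * (652 / real K))" using a(2) by (intro mult_left_mono) auto
  also have "\<dots> \<le> 2000" using K by simp
  finally show ?thesis .
qed

subsection \<open>The complex Gaussian distribution\<close>

definition std_normal :: "real measure" where
  "std_normal = density lborel std_normal_density"

text \<open>Real and imaginary part each have variance 1, so the squared modulus has mean 2.\<close>

definition cgauss :: "complex measure" where
  "cgauss = distr (std_normal \<Otimes>\<^sub>M std_normal) borel (\<lambda>(x, y). Complex x y)"

lemma prob_space_std_normal: "prob_space std_normal"
  unfolding std_normal_def by (rule prob_space_normal_density) simp

lemma sets_std_normal [simp, measurable_cong]: "sets std_normal = sets borel"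
  and space_std_normal [simp]: "space std_normal = UNIV"
  by (simp_all add: std_normal_def)

interpretation std_normal: prob_space std_normal by (rule prob_space_std_normal)
interpretation std_normal_pair: pair_prob_space std_normal std_normal ..

lemma Complex_measurable [measurable]: "(\<lambda>(x, y). Complex x y) \<in> borel_measurable (borel \<Otimes>\<^sub>M borel)"
proof -
  have "(\<lambda>(x, y). Complex x y) = (\<lambda>p. complex_of_real (fst p) + \<i> * complex_of_real (snd p))"
    by (auto simp: Complex_eq)
  thus ?thesis by simp
qed

lemma borel_measurable_Complex [measurable (raw)]:
  assumes [measurable]: "f \<in> borel_measurable M" "g \<in> borel_measurable M"
  shows "(\<lambda>x. Complex (f x) (g x)) \<in> borel_measurable M"
  unfolding Complex_eq by measurable

lemma sets_cgauss [simp, measurable_cong]: "sets cgauss = sets borel"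
  and space_cgauss [simp]: "space cgauss = UNIV"
  by (simp_all add: cgauss_def)

lemma prob_space_cgauss: "prob_space cgauss"
  unfolding cgauss_def by (rule std_normal_pair.prob_space_distr) measurable

interpretation cgauss: prob_space cgauss by (rule prob_space_cgauss)

lemma nn_integral_cgauss_pair:
  assumes [measurable]: "f \<in> borel_measurable borel"
  shows "(\<integral>\<^sup>+z. f z \<partial>cgauss) = (\<integral>\<^sup>+x. \<integral>\<^sup>+y. f (Complex x y) \<partial>std_normal \<partial>std_normal)"
proof -
  have "(\<integral>\<^sup>+z. f z \<partial>cgauss) = (\<integral>\<^sup>+p. f (case p of (x, y) \<Rightarrow> Complex x y) \<partial>(std_normal \<Otimes>\<^sub>M std_normal))"
    unfolding cgauss_def by (rule nn_integral_distr) auto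
  also have "\<dots> = (\<integral>\<^sup>+x. \<integral>\<^sup>+y. f (Complex x y) \<partial>std_normal \<partial>std_normal)"
    by (subst std_normal.nn_integral_fst[symmetric]) auto
  finally show ?thesis .
qed

lemma nn_integral_cgauss:
  assumes [measurable]: "f \<in> borel_measurable borel"
  shows "(\<integral>\<^sup>+z. f z \<partial>cgauss) =
    (\<integral>\<^sup>+x. \<integral>\<^sup>+y. ennreal (exp (- (x\<^sup>2 + y\<^sup>2) / 2) / (2 * pi)) * f (Complex x y) \<partial>lborel \<partial>lborel)"
proof -
  have eq: "ennreal (std_normal_density x) * (ennreal (std_normal_density y) * f (Complex x y)) =
    ennreal (exp (- (x\<^sup>2 + y\<^sup>2) / 2) / (2 * pi)) * f (Complex x y)" for x y
  proof -
    have "std_normal_density x * std_normal_density y = exp (- (x\<^sup>2 + y\<^sup>2) / 2) / (2 * pi)"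
      by (simp add: std_normal_density_def exp_add[symmetric] field_simps)
    thus ?thesis by (simp add: mult.assoc[symmetric] ennreal_mult''[symmetric])
  qed
  have "(\<integral>\<^sup>+z. f z \<partial>cgauss) = (\<integral>\<^sup>+x. ennreal (std_normal_density x) *
      (\<integral>\<^sup>+y. ennreal (std_normal_density y) * f (Complex x y) \<partial>lborel) \<partial>lborel)"
    unfolding nn_integral_cgauss_pair[OF assms] unfolding std_normal_def
    by (subst nn_integral_density, measurable) (subst nn_integral_density, auto)
  also have "\<dots> = (\<integral>\<^sup>+x. \<integral>\<^sup>+y. ennreal (std_normal_density x) *
      (ennreal (std_normal_density y) * f (Complex x y)) \<partial>lborel \<partial>lborel)"
    by (intro nn_integral_cong nn_integral_cmult[symmetric]) auto
  finally show ?thesis unfolding eq .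
qed

text \<open>For \<open>c \<noteq> 0\<close> the rotation factors into two affine substitutions, one per coordinate.\<close>

lemma lborel_rotation:
  fixes H :: "real \<Rightarrow> real \<Rightarrow> ennreal"
  assumes H: "case_prod H \<in> borel_measurable (borel \<Otimes>\<^sub>M borel)" and cs: "c\<^sup>2 + s\<^sup>2 = 1"
  shows "(\<integral>\<^sup>+x. \<integral>\<^sup>+y. H (c * x - s * y) (s * x + c * y) \<partial>lborel \<partial>lborel) = (\<integral>\<^sup>+x. \<integral>\<^sup>+y. H x y \<partial>lborel \<partial>lborel)"
proof -
  have meas [measurable (raw)]: "(\<lambda>x. H (f x) (g x)) \<in> borel_measurable M"
    if [measurable]: "f \<in> borel_measurable M" "g \<in> borel_measurable M" for f g and M :: "'z measure"
    using measurable_compose[OF measurable_Pair[OF that] H] by simp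
  have swap: "(\<integral>\<^sup>+x. \<integral>\<^sup>+y. F x y \<partial>lborel \<partial>lborel) = (\<integral>\<^sup>+y. \<integral>\<^sup>+x. F x y \<partial>lborel \<partial>lborel)"
    if [measurable]: "case_prod F \<in> borel_measurable (borel \<Otimes>\<^sub>M borel)" for F :: "real \<Rightarrow> real \<Rightarrow> ennreal"
    by (rule lborel_pair.Fubini'[symmetric]) simp
  show ?thesis
  proof (cases "c = 0")
    case False
    have "(\<integral>\<^sup>+x. \<integral>\<^sup>+y. H (c * x - s * y) (s * x + c * y) \<partial>lborel \<partial>lborel)
        = (\<integral>\<^sup>+y. \<integral>\<^sup>+x. H (c * x - s * y) (s * x + c * y) \<partial>lborel \<partial>lborel)"
      by (rule swap) measurable
    also have "\<dots> = (\<integral>\<^sup>+y. ennreal \<bar>1/c\<bar> * (\<integral>\<^sup>+x. H x ((s/c) * x + (1/c) * y) \<partial>lborel) \<partial>lborel)"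
    proof (intro nn_integral_cong)
      fix y :: real
      have "(\<integral>\<^sup>+x. H (c * x - s * y) (s * x + c * y) \<partial>lborel) =
        ennreal \<bar>1/c\<bar> * (\<integral>\<^sup>+x. H (c * (s * y / c + 1 / c * x) - s * y) (s * (s * y / c + 1 / c * x) + c * y) \<partial>lborel)"
        by (rule nn_integral_real_affine, measurable) (simp add: False)
      also have "(\<lambda>x. H (c * (s * y / c + 1 / c * x) - s * y) (s * (s * y / c + 1 / c * x) + c * y)) = (\<lambda>x. H x ((s/c) * x + (1/c) * y))"
      proof
        fix x
        have "c * (s * y / c + 1 / c * x) - s * y = x" using False by (simp add: field_simps)
        moreover have "s * (s * y / c + 1 / c * x) + c * y = (s/c) * x + (c\<^sup>2 + s\<^sup>2) / c * y"
          using False by (simp add: field_simps power2_eq_square)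
        ultimately show "H (c * (s * y / c + 1 / c * x) - s * y) (s * (s * y / c + 1 / c * x) + c * y) = H x ((s/c) * x + (1/c) * y)"
          by (simp add: cs)
      qed
      finally show "(\<integral>\<^sup>+x. H (c * x - s * y) (s * x + c * y) \<partial>lborel) = ennreal \<bar>1/c\<bar> * (\<integral>\<^sup>+x. H x ((s/c) * x + (1/c) * y) \<partial>lborel)" .
    qed
    also have "\<dots> = ennreal \<bar>1/c\<bar> * (\<integral>\<^sup>+y. \<integral>\<^sup>+x. H x ((s/c) * x + (1/c) * y) \<partial>lborel \<partial>lborel)"
      by (rule nn_integral_cmult) measurable
    also have "(\<integral>\<^sup>+y. \<integral>\<^sup>+x. H x ((s/c) * x + (1/c) * y) \<partial>lborel \<partial>lborel)
      = (\<integral>\<^sup>+x. \<integral>\<^sup>+y. H x ((s/c) * x + (1/c) * y) \<partial>lborel \<partial>lborel)"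
      by (rule swap[symmetric]) measurable
    also have "ennreal \<bar>1/c\<bar> * \<dots> = (\<integral>\<^sup>+x. ennreal \<bar>1/c\<bar> * (\<integral>\<^sup>+y. H x ((s/c) * x + (1/c) * y) \<partial>lborel) \<partial>lborel)"
      by (rule nn_integral_cmult[symmetric]) measurable
    also have "\<dots> = (\<integral>\<^sup>+x. \<integral>\<^sup>+y. H x y \<partial>lborel \<partial>lborel)"
      using False by (intro nn_integral_cong nn_integral_real_affine[symmetric] meas) auto
    finally show ?thesis .
  next
    case True
    hence s1: "\<bar>s\<bar> = 1" "s \<noteq> 0" using cs by (auto simp: power2_eq_1_iff)
    have "(\<integral>\<^sup>+x. \<integral>\<^sup>+y. H (c * x - s * y) (s * x + c * y) \<partial>lborel \<partial>lborel)
      = (\<integral>\<^sup>+x. ennreal \<bar>- s\<bar> * (\<integral>\<^sup>+y. H (0 + (- s) * y) (s * x) \<partial>lborel) \<partial>lborel)"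
      using True s1 by simp
    also have "\<dots> = (\<integral>\<^sup>+x. \<integral>\<^sup>+y. H y (s * x) \<partial>lborel \<partial>lborel)"
      using s1 by (intro nn_integral_cong nn_integral_real_affine[symmetric] meas) auto
    also have "\<dots> = (\<integral>\<^sup>+y. \<integral>\<^sup>+x. H y (s * x) \<partial>lborel \<partial>lborel)" by (rule swap) measurable
    also have "\<dots> = (\<integral>\<^sup>+y. ennreal \<bar>s\<bar> * (\<integral>\<^sup>+x. H y (0 + s * x) \<partial>lborel) \<partial>lborel)" using s1 by simp
    also have "\<dots> = (\<integral>\<^sup>+y. \<integral>\<^sup>+x. H y x \<partial>lborel \<partial>lborel)"
      using s1 by (intro nn_integral_cong nn_integral_real_affine[symmetric] meas) auto
    finally show ?thesis .
  qed
qed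

lemma distr_cgauss_eqI:
  assumes [measurable]: "h \<in> borel_measurable borel"
    and "\<And>f. f \<in> borel_measurable borel \<Longrightarrow> (\<integral>\<^sup>+z. f (h z) \<partial>cgauss) = (\<integral>\<^sup>+z. f z \<partial>cgauss)"
  shows "distr cgauss borel h = cgauss"
proof (rule measure_eqI)
  fix A assume "A \<in> sets (distr cgauss borel h)"
  hence [measurable]: "A \<in> sets borel" by simp
  have "emeasure (distr cgauss borel h) A = (\<integral>\<^sup>+z. indicator A z \<partial>distr cgauss borel h)" by simp
  also have "\<dots> = (\<integral>\<^sup>+z. indicator A (h z) \<partial>cgauss)" by (rule nn_integral_distr) auto
  also have "\<dots> = (\<integral>\<^sup>+z. indicator A z \<partial>cgauss)" by (rule assms(2)) simp
  finally show "emeasure (distr cgauss borel h) A = emeasure cgauss A" by simp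
qed simp

text \<open>The density depends on the modulus only. This invariance removes the unknown rotations
  from the problem and is also the source of every orthogonality and centring argument for the
  monomials.\<close>

lemma distr_cgauss_mult:
  assumes "cmod u = 1"
  shows "distr cgauss borel (\<lambda>z. u * z) = cgauss"
proof (rule distr_cgauss_eqI)
  fix f :: "complex \<Rightarrow> ennreal" assume [measurable]: "f \<in> borel_measurable borel"
  have cs: "(Re u)\<^sup>2 + (Im u)\<^sup>2 = 1" using assms by (simp add: cmod_def)
  define H where "H x y = ennreal (exp (- (x\<^sup>2 + y\<^sup>2) / 2) / (2 * pi)) * f (Complex x y)" for x y
  have "(\<integral>\<^sup>+z. f (u * z) \<partial>cgauss) = (\<integral>\<^sup>+x. \<integral>\<^sup>+y. H (Re u * x - Im u * y) (Im u * x + Re u * y) \<partial>lborel \<partial>lborel)"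
  proof (subst nn_integral_cgauss, measurable, intro nn_integral_cong)
    fix x y :: real
    have "(Re u * x - Im u * y)\<^sup>2 + (Im u * x + Re u * y)\<^sup>2 = ((Re u)\<^sup>2 + (Im u)\<^sup>2) * (x\<^sup>2 + y\<^sup>2)"
      by (simp add: power2_eq_square algebra_simps)
    moreover have "u * Complex x y = Complex (Re u * x - Im u * y) (Im u * x + Re u * y)"
      by (auto simp: complex_eq_iff)
    ultimately show "ennreal (exp (- (x\<^sup>2 + y\<^sup>2) / 2) / (2 * pi)) * f (u * Complex x y) =
        H (Re u * x - Im u * y) (Im u * x + Re u * y)"
      by (simp add: H_def cs)
  qed
  also have "\<dots> = (\<integral>\<^sup>+x. \<integral>\<^sup>+y. H x y \<partial>lborel \<partial>lborel)"
    using cs by (intro lborel_rotation) (auto simp: H_def case_prod_unfold)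
  also have "\<dots> = (\<integral>\<^sup>+z. f z \<partial>cgauss)" by (subst nn_integral_cgauss) (auto simp: H_def[abs_def])
  finally show "(\<integral>\<^sup>+z. f (u * z) \<partial>cgauss) = (\<integral>\<^sup>+z. f z \<partial>cgauss)" .
qed simp

lemma borel_measurable_cnj [measurable]: "cnj \<in> borel_measurable borel"
  by (intro borel_measurable_continuous_onI continuous_intros)

lemma distr_cgauss_cnj: "distr cgauss borel cnj = cgauss"
proof (rule distr_cgauss_eqI)
  fix f :: "complex \<Rightarrow> ennreal" assume [measurable]: "f \<in> borel_measurable borel"
  define H where "H x y = ennreal (exp (- (x\<^sup>2 + y\<^sup>2) / 2) / (2 * pi)) * f (Complex x y)" for x y
  have "(\<integral>\<^sup>+z. f (cnj z) \<partial>cgauss) = (\<integral>\<^sup>+x. ennreal \<bar>-1\<bar> * (\<integral>\<^sup>+y. H x (0 + (-1) * y) \<partial>lborel) \<partial>lborel)"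
    by (subst nn_integral_cgauss) (auto simp: H_def[abs_def] complex_cnj)
  also have "\<dots> = (\<integral>\<^sup>+x. \<integral>\<^sup>+y. H x y \<partial>lborel \<partial>lborel)"
    by (intro nn_integral_cong nn_integral_real_affine[symmetric]) (auto simp: H_def[abs_def])
  also have "\<dots> = (\<integral>\<^sup>+z. f z \<partial>cgauss)" by (subst nn_integral_cgauss) (auto simp: H_def[abs_def])
  finally show "(\<integral>\<^sup>+z. f (cnj z) \<partial>cgauss) = (\<integral>\<^sup>+z. f z \<partial>cgauss)" .
qed simp

section \<open>Exponential and second moments\<close>

text \<open>The weight turns the standard density into \<open>sqrt 2\<close> times the density of
  variance 2. The resulting moment of \<open>exp ((cmod z)\<^sup>2 / 4)\<close> is the source of
  most later moment and tail bounds.\<close>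

lemma std_normal_exp_moment: "(\<integral>\<^sup>+x. ennreal (exp (x\<^sup>2 / 4)) \<partial>std_normal) = ennreal (sqrt 2)"
proof -
  have "(\<integral>\<^sup>+x. ennreal (exp (x\<^sup>2 / 4)) \<partial>std_normal) =
     (\<integral>\<^sup>+x. ennreal (std_normal_density x) * ennreal (exp (x\<^sup>2 / 4)) \<partial>lborel)"
    unfolding std_normal_def by (rule nn_integral_density) auto
  also have "\<dots> = (\<integral>\<^sup>+x. ennreal (sqrt 2) * ennreal (normal_density 0 (sqrt 2) x) \<partial>lborel)"
  proof (intro nn_integral_cong)
    fix x :: real
    have "std_normal_density x * exp (x\<^sup>2 / 4) = sqrt 2 * normal_density 0 (sqrt 2) x"
      by (simp add: normal_density_def exp_add[symmetric] real_sqrt_mult field_simps)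
    thus "ennreal (std_normal_density x) * ennreal (exp (x\<^sup>2 / 4)) = ennreal (sqrt 2) * ennreal (normal_density 0 (sqrt 2) x)"
      by (simp add: ennreal_mult''[symmetric])
  qed
  also have "\<dots> = ennreal (sqrt 2) * (\<integral>\<^sup>+x. ennreal (normal_density 0 (sqrt 2) x) \<partial>lborel)"
    by (rule nn_integral_cmult) auto
  also have "(\<integral>\<^sup>+x. ennreal (normal_density 0 (sqrt 2) x) \<partial>lborel) = 1"
    by (subst nn_integral_eq_integral) auto
  finally show ?thesis by simp
qed

lemma cgauss_exp_moment: "(\<integral>\<^sup>+z. ennreal (exp ((cmod z)\<^sup>2 / 4)) \<partial>cgauss) = 2"
proof -
  have "(\<integral>\<^sup>+z. ennreal (exp ((cmod z)\<^sup>2 / 4)) \<partial>cgauss) =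
     (\<integral>\<^sup>+x. \<integral>\<^sup>+y. ennreal (exp (x\<^sup>2 / 4)) * ennreal (exp (y\<^sup>2 / 4)) \<partial>std_normal \<partial>std_normal)"
    by (subst nn_integral_cgauss_pair)
       (auto simp: cmod_def ennreal_mult''[symmetric] exp_add[symmetric] add_divide_distrib intro!: nn_integral_cong)
  also have "\<dots> = ennreal (sqrt 2) * ennreal (sqrt 2)"
    by (simp add: nn_integral_cmult nn_integral_multc std_normal_exp_moment)
  also have "\<dots> = 2" by (simp add: ennreal_mult''[symmetric])
  finally show ?thesis .
qed

lemma std_normal_second_moment: "(\<integral>\<^sup>+x. ennreal (x\<^sup>2) \<partial>std_normal) = 1"
proof -
  have "(\<integral>\<^sup>+x. ennreal (x\<^sup>2) \<partial>std_normal) = (\<integral>\<^sup>+x. ennreal (std_normal_density x) * ennreal (x\<^sup>2) \<partial>lborel)"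
    unfolding std_normal_def by (rule nn_integral_density) auto
  also have "\<dots> = (\<integral>\<^sup>+x. ennreal (std_normal_density x * x\<^sup>2) \<partial>lborel)"
    by (simp add: ennreal_mult''[symmetric])
  also have "\<dots> = ennreal (\<integral>x. std_normal_density x * x\<^sup>2 \<partial>lborel)"
    using std_normal_moment_even[of 1] by (intro nn_integral_eq_integral) (auto simp: has_bochner_integral_iff)
  also have "(\<integral>x. std_normal_density x * x\<^sup>2 \<partial>lborel) = 1"
    using integral_std_normal_moment_even[of 1] by (simp add: fact_numeral)
  finally show ?thesis by simp
qed

lemma cgauss_second_moment: "(\<integral>\<^sup>+z. ennreal ((cmod z)\<^sup>2) \<partial>cgauss) = 2"
proof -
  have "(\<integral>\<^sup>+z. ennreal ((cmod z)\<^sup>2) \<partial>cgauss) =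
     (\<integral>\<^sup>+x. \<integral>\<^sup>+y. ennreal (x\<^sup>2) + ennreal (y\<^sup>2) \<partial>std_normal \<partial>std_normal)"
    by (subst nn_integral_cgauss_pair)
       (auto simp: cmod_def intro!: nn_integral_cong)
  also have "\<dots> = 2"
    by (simp add: nn_integral_add std_normal_second_moment std_normal.emeasure_space_1[simplified])
  finally show ?thesis .
qed

subsection \<open>The noise in the frame of the signal\<close>

lemma distr_PiM_map:
  assumes I: "finite I"
    and M: "\<And>i. prob_space (M i)" and M': "\<And>i. prob_space (M' i)"
    and h [measurable]: "\<And>i. i \<in> I \<Longrightarrow> h i \<in> M i \<rightarrow>\<^sub>M M' i"
    and d: "\<And>i. i \<in> I \<Longrightarrow> distr (M i) (M' i) (h i) = M' i"
  shows "distr (PiM I M) (PiM I M') (\<lambda>t. \<lambda>i\<in>I. h i (t i)) = PiM I M'"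
proof -
  interpret P: product_prob_space M by (simp add: M product_prob_spaceI)
  interpret P': product_prob_space M' by (simp add: M' product_prob_spaceI)
  have meas [measurable]: "(\<lambda>t. \<lambda>i\<in>I. h i (t i)) \<in> PiM I M \<rightarrow>\<^sub>M PiM I M'"
    by (intro measurable_restrict) (rule measurable_compose[OF measurable_component_singleton], assumption, rule h)
  show ?thesis
  proof (rule P'.PiM_eqI[OF I])
    fix A assume A: "\<And>i. i \<in> I \<Longrightarrow> A i \<in> sets (M' i)"
    have "emeasure (distr (PiM I M) (PiM I M') (\<lambda>t. \<lambda>i\<in>I. h i (t i))) (Pi\<^sub>E I A) =
        emeasure (PiM I M) ((\<lambda>t. \<lambda>i\<in>I. h i (t i)) -` (Pi\<^sub>E I A) \<inter> space (PiM I M))"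
      using A I by (intro emeasure_distr meas sets_PiM_I_finite) auto
    also have "(\<lambda>t. \<lambda>i\<in>I. h i (t i)) -` (Pi\<^sub>E I A) \<inter> space (PiM I M) = Pi\<^sub>E I (\<lambda>i. h i -` A i \<inter> space (M i))"
      by (auto simp: space_PiM PiE_iff)
    also have "emeasure (PiM I M) \<dots> = (\<Prod>i\<in>I. emeasure (M i) (h i -` A i \<inter> space (M i)))"
      using A I h by (intro P.emeasure_PiM) (auto intro: measurable_sets)
    also have "\<dots> = (\<Prod>i\<in>I. emeasure (distr (M i) (M' i) (h i)) (A i))"
      using A h by (intro prod.cong refl emeasure_distr[symmetric]) auto
    also have "\<dots> = (\<Prod>i\<in>I. emeasure (M' i) (A i))" by (intro prod.cong refl) (simp add: d)
    finally show "emeasure (distr (PiM I M) (PiM I M') (\<lambda>t. \<lambda>i\<in>I. h i (t i))) (Pi\<^sub>E I A) =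
      (\<Prod>i\<in>I. emeasure (M' i) (A i))" .
  qed simp
qed

definition gauss_vec :: "nat \<Rightarrow> (nat \<Rightarrow> complex) measure" where
  "gauss_vec K = PiM {1..K} (\<lambda>_. cgauss)"

definition gauss_sample :: "nat \<Rightarrow> nat \<Rightarrow> (nat \<Rightarrow> nat \<Rightarrow> complex) measure" where
  "gauss_sample K N = PiM {1..N} (\<lambda>_. gauss_vec K)"

lemma prob_space_gauss_vec: "prob_space (gauss_vec K)"
  unfolding gauss_vec_def by (intro prob_space_PiM prob_space_cgauss)

lemma prob_space_gauss_sample: "prob_space (gauss_sample K N)"
  unfolding gauss_sample_def by (intro prob_space_PiM prob_space_gauss_vec)

lemma gauss_vec_component: "k \<in> {1..K} \<Longrightarrow> (\<lambda>t. t k) \<in> gauss_vec K \<rightarrow>\<^sub>M borel"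
  unfolding gauss_vec_def
  by (rule measurable_compose[OF measurable_component_singleton[of k] measurable_ident_sets]) auto

lemma gauss_sample_component: "m \<in> {1..N} \<Longrightarrow> (\<lambda>x. x m) \<in> gauss_sample K N \<rightarrow>\<^sub>M gauss_vec K"
  unfolding gauss_sample_def by (rule measurable_component_singleton)

lemma gauss_sample_component2:
  "m \<in> {1..N} \<Longrightarrow> k \<in> {1..K} \<Longrightarrow> (\<lambda>x. x m k) \<in> gauss_sample K N \<rightarrow>\<^sub>M borel"
  by (rule measurable_compose[OF gauss_sample_component gauss_vec_component])

definition noise_space :: "nat \<Rightarrow> nat \<Rightarrow> (nat \<times> nat \<times> 2 \<Rightarrow> real) measure" where
  "noise_space K N = PiM ({1..N} \<times> {1..K} \<times> UNIV) (\<lambda>_. std_normal)"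

definition rotate_noise :: "nat \<Rightarrow> nat \<Rightarrow> (nat \<Rightarrow> nat \<Rightarrow> complex) \<Rightarrow> (nat \<times> nat \<times> 2 \<Rightarrow> real) \<Rightarrow> nat \<Rightarrow> nat \<Rightarrow> complex" where
  "rotate_noise K N u e = (\<lambda>m\<in>{1..N}. \<lambda>k\<in>{1..K}. u m k * Complex (e (m, k, 1)) (e (m, k, 2)))"

lemma noise_component:
  "i \<in> {1..N} \<times> {1..K} \<times> UNIV \<Longrightarrow> (\<lambda>e. e i) \<in> noise_space K N \<rightarrow>\<^sub>M borel"
  unfolding noise_space_def
  by (rule measurable_compose[OF measurable_component_singleton[of i] measurable_ident_sets]) auto

lemma measurable_rotate_noise [measurable]: "rotate_noise K N u \<in> noise_space K N \<rightarrow>\<^sub>M gauss_sample K N"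
proof -
  have [measurable]: "(\<lambda>e. u m k * Complex (e (m, k, 1)) (e (m, k, 2))) \<in> noise_space K N \<rightarrow>\<^sub>M cgauss"
    if "m \<in> {1..N}" "k \<in> {1..K}" for m k
  proof -
    have [measurable]: "(\<lambda>e. e (m, k, j)) \<in> noise_space K N \<rightarrow>\<^sub>M borel" for j
      using that by (intro noise_component) auto
    have "(\<lambda>e. u m k * Complex (e (m, k, 1)) (e (m, k, 2))) \<in> noise_space K N \<rightarrow>\<^sub>M borel"
      by measurable
    thus ?thesis by simp
  qed
  show ?thesis
    unfolding rotate_noise_def[abs_def] gauss_sample_def gauss_vec_def
    by (intro measurable_restrict) auto
qed

lemma measurable_noise_of_pairs:
  "(\<lambda>x. \<lambda>(m, k, j)\<in>{1..N} \<times> {1..K} \<times> UNIV. if j = 1 then fst (x m k) else snd (x m k))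
     \<in> PiM {1..N} (\<lambda>_. PiM {1..K} (\<lambda>_. std_normal \<Otimes>\<^sub>M std_normal)) \<rightarrow>\<^sub>M noise_space K N"
    (is "?V \<in> ?X \<rightarrow>\<^sub>M _")
  unfolding noise_space_def
proof (intro measurable_restrict)
  fix i :: "nat \<times> nat \<times> 2" assume i: "i \<in> {1..N} \<times> {1..K} \<times> UNIV"
  obtain m k j where mkj: "i = (m, k, j)" by (cases i) auto
  hence mk: "m \<in> {1..N}" "k \<in> {1..K}" using i by auto
  have c: "(\<lambda>x. x m k) \<in> ?X \<rightarrow>\<^sub>M std_normal \<Otimes>\<^sub>M std_normal"
    by (rule measurable_compose[OF measurable_component_singleton[OF mk(1)] measurable_component_singleton[OF mk(2)]])
  have "(\<lambda>x. fst (x m k)) \<in> ?X \<rightarrow>\<^sub>M std_normal" "(\<lambda>x. snd (x m k)) \<in> ?X \<rightarrow>\<^sub>M std_normal"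
    using c by (auto intro: measurable_compose[OF c])
  thus "(\<lambda>x. case i of (m, k, j) \<Rightarrow> if j = 1 then fst (x m k) else snd (x m k)) \<in> ?X \<rightarrow>\<^sub>M std_normal"
    by (cases "j = 1") (auto simp: mkj)
qed

text \<open>The model lists the noise by flat triples, while the analysis needs samples of blocks of
  pairs. Both measures are products of the same factors and agree on boxes.\<close>

lemma noise_space_nested:
  "noise_space K N = distr (PiM {1..N} (\<lambda>_. PiM {1..K} (\<lambda>_. std_normal \<Otimes>\<^sub>M std_normal))) (noise_space K N)
     (\<lambda>x. \<lambda>(m, k, j)\<in>{1..N} \<times> {1..K} \<times> UNIV. if j = 1 then fst (x m k) else snd (x m k))"
    (is "_ = distr ?X _ ?V")
proof -
  let ?P2 = "std_normal \<Otimes>\<^sub>M std_normal"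
  interpret A: product_prob_space "\<lambda>_::nat\<times>nat\<times>2. std_normal" "{}" by (simp add: prob_space_std_normal product_prob_spaceI)
  have p2: "prob_space ?P2" by (rule std_normal_pair.prob_space_axioms)
  interpret B: product_prob_space "\<lambda>_::nat. ?P2" "{}" by (simp add: p2 product_prob_spaceI)
  interpret C: product_prob_space "\<lambda>_::nat. PiM {1..K} (\<lambda>_::nat. ?P2)" "{}"
    by (intro product_prob_spaceI prob_space_PiM p2)
  note V = measurable_noise_of_pairs[of N K]
  show ?thesis unfolding noise_space_def
  proof (rule sym, rule A.PiM_eqI)
    fix A :: "nat \<times> nat \<times> 2 \<Rightarrow> real set"
    let ?I = "{1..N} \<times> {1..K} \<times> (UNIV :: 2 set)"
    assume A: "\<And>i. i \<in> ?I \<Longrightarrow> A i \<in> sets std_normal"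
    have A': "A (m, k, j) \<in> sets std_normal" if "m \<in> {1..N}" "k \<in> {1..K}" for m k j using A that by auto
    have "emeasure (distr ?X (PiM ?I (\<lambda>_. std_normal)) ?V) (Pi\<^sub>E ?I A) = emeasure ?X (?V -` (Pi\<^sub>E ?I A) \<inter> space ?X)"
      using V A unfolding noise_space_def by (intro emeasure_distr sets_PiM_I_finite) auto
    also have "?V -` (Pi\<^sub>E ?I A) \<inter> space ?X = Pi\<^sub>E {1..N} (\<lambda>m. Pi\<^sub>E {1..K} (\<lambda>k. A (m, k, 1) \<times> A (m, k, 2)))" (is "?L = ?R")
    proof (intro equalityI subsetI)
      fix x assume x: "x \<in> ?L"
      hence ext: "x \<in> extensional {1..N}" "\<And>m. m \<in> {1..N} \<Longrightarrow> x m \<in> extensional {1..K}"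
        by (auto simp: space_PiM PiE_iff)
      have "?V x \<in> Pi\<^sub>E ?I A" using x by simp
      hence *: "\<And>m k j. m \<in> {1..N} \<Longrightarrow> k \<in> {1..K} \<Longrightarrow> ?V x (m, k, j) \<in> A (m, k, j)" by blast
      have "fst (x m k) \<in> A (m, k, 1)" "snd (x m k) \<in> A (m, k, 2)" if "m \<in> {1..N}" "k \<in> {1..K}" for m k
        using *[OF that, of 1] *[OF that, of 2] that by auto
      thus "x \<in> ?R" using ext by (auto simp: PiE_iff mem_Times_iff)
    next
      fix x assume x: "x \<in> ?R"
      have "(if j = 1 then fst (x m k) else snd (x m k)) \<in> A (m, k, j)"
        if "m \<in> {1..N}" "k \<in> {1..K}" for m k and j :: 2
        using x that exhaust_2[of j] by (auto simp: PiE_iff mem_Times_iff)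
      hence "?V x \<in> Pi\<^sub>E ?I A" by (auto simp: PiE_iff)
      moreover have "x \<in> space ?X" using x by (auto simp: space_PiM PiE_iff space_pair_measure)
      ultimately show "x \<in> ?L" by simp
    qed
    also have "emeasure ?X \<dots> = (\<Prod>m\<in>{1..N}. emeasure (PiM {1..K} (\<lambda>_. ?P2)) (Pi\<^sub>E {1..K} (\<lambda>k. A (m, k, 1) \<times> A (m, k, 2))))"
      using A' by (intro C.emeasure_PiM sets_PiM_I_finite) auto
    also have "\<dots> = (\<Prod>m\<in>{1..N}. \<Prod>k\<in>{1..K}. emeasure ?P2 (A (m, k, 1) \<times> A (m, k, 2)))"
      using A' by (intro prod.cong refl B.emeasure_PiM) auto
    also have "\<dots> = (\<Prod>m\<in>{1..N}. \<Prod>k\<in>{1..K}. \<Prod>j\<in>UNIV. emeasure std_normal (A (m, k, j)))"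
      using A' by (intro prod.cong refl) (subst std_normal.emeasure_pair_measure_Times, auto simp: UNIV_2)
    also have "\<dots> = (\<Prod>i\<in>?I. emeasure std_normal (A i))"
      by (simp add: prod.cartesian_product)
    finally show "emeasure (distr ?X (PiM ?I (\<lambda>_. std_normal)) ?V) (Pi\<^sub>E ?I A) = (\<Prod>i\<in>?I. emeasure std_normal (A i))" .
  qed (auto simp: noise_space_def)
qed

text \<open>For deterministic unit numbers \<open>u\<close> every pair of coordinates becomes a
  rotated complex Gaussian, which is again one. Random angles are treated later by fixing them
  first.\<close>

lemma distr_rotate_noise:
  assumes u: "\<And>m k. cmod (u m k) = 1"
  shows "distr (noise_space K N) (gauss_sample K N) (rotate_noise K N u) = gauss_sample K N"
proof -
  let ?P2 = "std_normal \<Otimes>\<^sub>M std_normal"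
  let ?X = "PiM {1..N} (\<lambda>_. PiM {1..K} (\<lambda>_. ?P2))"
  let ?V = "\<lambda>x. \<lambda>(m, k, j)\<in>{1..N} \<times> {1..K} \<times> (UNIV :: 2 set). if j = 1 then fst (x m k) else snd (x m k)"
  have p2: "prob_space ?P2" by (rule std_normal_pair.prob_space_axioms)
  have C: "(\<lambda>p. u m k * (case p of (x, y) \<Rightarrow> Complex x y)) \<in> ?P2 \<rightarrow>\<^sub>M cgauss" for m k
  proof -
    have "(\<lambda>p. u m k * (case p of (x, y) \<Rightarrow> Complex x y)) \<in> ?P2 \<rightarrow>\<^sub>M borel" by measurable
    thus ?thesis by simp
  qed
  have d1: "distr ?P2 cgauss (\<lambda>p. u m k * (case p of (x, y) \<Rightarrow> Complex x y)) = cgauss" for m k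
  proof -
    have "distr cgauss borel (\<lambda>z. u m k * z) = distr ?P2 borel ((\<lambda>z. u m k * z) \<circ> (\<lambda>(x, y). Complex x y))"
      unfolding cgauss_def by (intro distr_distr) auto
    hence "distr ?P2 borel ((\<lambda>z. u m k * z) \<circ> (\<lambda>(x, y). Complex x y)) = cgauss"
      using distr_cgauss_mult[OF u] by simp
    moreover have "distr ?P2 cgauss ((\<lambda>z. u m k * z) \<circ> (\<lambda>(x, y). Complex x y)) = distr ?P2 borel ((\<lambda>z. u m k * z) \<circ> (\<lambda>(x, y). Complex x y))"
      by (intro distr_cong) auto
    ultimately show ?thesis by (simp add: comp_def case_prod_unfold)
  qed
  define h where "h m t = (\<lambda>k\<in>{1..K}. u m k * (case t k of (x, y) \<Rightarrow> Complex x y))" for m and t :: "nat \<Rightarrow> real \<times> real"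
  have hm: "h m \<in> PiM {1..K} (\<lambda>_. ?P2) \<rightarrow>\<^sub>M gauss_vec K" for m
    unfolding h_def[abs_def] gauss_vec_def
    by (intro measurable_restrict) (rule measurable_compose[OF measurable_component_singleton], assumption, rule C)
  have hd: "distr (PiM {1..K} (\<lambda>_. ?P2)) (gauss_vec K) (h m) = gauss_vec K" for m
    unfolding h_def[abs_def] gauss_vec_def
    by (rule distr_PiM_map[OF _ p2 prob_space_cgauss C d1]) auto
  have "distr ?X (gauss_sample K N) (\<lambda>x. \<lambda>m\<in>{1..N}. h m (x m)) = gauss_sample K N"
    unfolding gauss_sample_def
    by (rule distr_PiM_map[OF _ prob_space_PiM prob_space_gauss_vec hm hd]) (auto intro: p2)
  moreover have "distr ?X (gauss_sample K N) (\<lambda>x. \<lambda>m\<in>{1..N}. h m (x m)) =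
      distr ?X (gauss_sample K N) (rotate_noise K N u \<circ> ?V)"
    by (intro distr_cong refl) (auto simp: rotate_noise_def h_def fun_eq_iff case_prod_unfold)
  moreover have "\<dots> = distr (distr ?X (noise_space K N) ?V) (gauss_sample K N) (rotate_noise K N u)"
    by (rule distr_distr[symmetric, OF measurable_rotate_noise measurable_noise_of_pairs])
  ultimately show ?thesis using noise_space_nested[of K N] by simp
qed

subsection \<open>The Efron--Stein inequality\<close>

lemma gauss_vec_map:
  assumes "\<And>k. k \<in> {1..K} \<Longrightarrow> h k \<in> borel_measurable borel" "\<And>k. k \<in> {1..K} \<Longrightarrow> distr cgauss borel (h k) = cgauss"
  shows "(\<lambda>t. \<lambda>k\<in>{1..K}. h k (t k)) \<in> gauss_vec K \<rightarrow>\<^sub>M gauss_vec K"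
    and "distr (gauss_vec K) (gauss_vec K) (\<lambda>t. \<lambda>k\<in>{1..K}. h k (t k)) = gauss_vec K"
proof -
  have h: "h k \<in> cgauss \<rightarrow>\<^sub>M cgauss" if "k \<in> {1..K}" for k using assms(1)[OF that] by simp
  have d: "distr cgauss cgauss (h k) = cgauss" if "k \<in> {1..K}" for k
    using assms(2)[OF that] distr_cong[of cgauss cgauss cgauss borel "h k" "h k"] by simp
  show "(\<lambda>t. \<lambda>k\<in>{1..K}. h k (t k)) \<in> gauss_vec K \<rightarrow>\<^sub>M gauss_vec K"
    unfolding gauss_vec_def
    by (intro measurable_restrict) (rule measurable_compose[OF measurable_component_singleton], assumption, rule h)
  show "distr (gauss_vec K) (gauss_vec K) (\<lambda>t. \<lambda>k\<in>{1..K}. h k (t k)) = gauss_vec K"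
    unfolding gauss_vec_def by (rule distr_PiM_map[OF _ prob_space_cgauss prob_space_cgauss h d]) auto
qed

lemma integral_gauss_vec_map:
  fixes f :: "(nat \<Rightarrow> complex) \<Rightarrow> 'b::{banach, second_countable_topology}"
  assumes "\<And>k. k \<in> {1..K} \<Longrightarrow> h k \<in> borel_measurable borel" "\<And>k. k \<in> {1..K} \<Longrightarrow> distr cgauss borel (h k) = cgauss"
    and f: "f \<in> borel_measurable (gauss_vec K)"
  shows "(\<integral>t. f (\<lambda>k\<in>{1..K}. h k (t k)) \<partial>gauss_vec K) = (\<integral>t. f t \<partial>gauss_vec K)"
proof -
  note m = gauss_vec_map[of K h, OF assms(1,2)]
  have "(\<integral>t. f t \<partial>distr (gauss_vec K) (gauss_vec K) (\<lambda>t. \<lambda>k\<in>{1..K}. h k (t k))) = (\<integral>t. f (\<lambda>k\<in>{1..K}. h k (t k)) \<partial>gauss_vec K)"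
    by (rule integral_distr[OF m(1) f]) auto
  thus ?thesis by (simp only: m(2))
qed

text \<open>Coordinate \<open>i\<close> is frozen at a fixed point \<open>a\<close> instead of being
  resampled. That is legitimate because the variance is at most the mean squared deviation from any
  constant, and it makes the increments explicit. The induction integrates out one coordinate at a
  time.\<close>

lemma efron_stein:
  fixes F :: "('i \<Rightarrow> 'a) \<Rightarrow> real"
  assumes I: "finite I" and M: "prob_space M" and a: "a \<in> space M"
    and F: "F \<in> borel_measurable (PiM I (\<lambda>_. M))" and B: "\<And>x. \<bar>F x\<bar> \<le> B"
  shows "(\<integral>x. (F x)\<^sup>2 \<partial>PiM I (\<lambda>_. M)) - (\<integral>x. F x \<partial>PiM I (\<lambda>_. M))\<^sup>2
     \<le> (\<Sum>i\<in>I. \<integral>x. (F x - F (x(i := a)))\<^sup>2 \<partial>PiM I (\<lambda>_. M))"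
  using I F B
proof (induction I arbitrary: F rule: finite_induct)
  case empty
  have "prob_space (PiM {} (\<lambda>_::'i. M))" by (intro prob_space_PiM M)
  then interpret E: prob_space "PiM {} (\<lambda>_::'i. M)" .
  have "(\<integral>x. g x \<partial>PiM {} (\<lambda>_::'i. M)) = g (\<lambda>_. undefined)" for g :: "_ \<Rightarrow> real"
    unfolding PiM_empty by (subst lebesgue_integral_count_space_finite) auto
  thus ?case by simp
next
  case (insert j I)
  interpret M: prob_space M by (rule M)
  interpret product_prob_space "\<lambda>_::'i. M" I by (simp add: M product_prob_spaceI)
  interpret P: prob_space "PiM I (\<lambda>_. M)" by (intro prob_space_PiM M)
  interpret P': prob_space "PiM (insert j I) (\<lambda>_. M)" by (intro prob_space_PiM M)
  interpret PM: pair_prob_space "PiM I (\<lambda>_. M)" M ..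
  let ?P = "PiM I (\<lambda>_. M)" and ?P' = "PiM (insert j I) (\<lambda>_. M)"
  note F [measurable] = insert.prems(1)
  note B = insert.prems(2)
  have B0: "B \<ge> 0" using B[of undefined] by linarith
  have sqB: "(F x)\<^sup>2 \<le> B\<^sup>2" for x using B[of x] by (simp add: abs_le_square_iff[symmetric] B0)
  have dB: "(F x - F y)\<^sup>2 \<le> (2 * B)\<^sup>2" for x y
    using B[of x] B[of y] B0 by (subst abs_le_square_iff[symmetric]) simp
  have upd: "(\<lambda>(x, y). x(j := y)) \<in> ?P \<Otimes>\<^sub>M M \<rightarrow>\<^sub>M ?P'"
    by (rule measurable_add_dim)
  have Fxy [measurable]: "(\<lambda>p. F ((fst p)(j := snd p))) \<in> borel_measurable (?P \<Otimes>\<^sub>M M)"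
    using measurable_compose[OF upd F] by (simp add: case_prod_unfold)
  have Fy [measurable]: "(\<lambda>y. F (x(j := y))) \<in> borel_measurable M" if "x \<in> space ?P" for x
    using measurable_compose[OF measurable_Pair1'[OF that] Fxy] by simp
  have inty: "integrable M (\<lambda>y. F (x(j := y)))" if "x \<in> space ?P" for x
    using Fy[OF that] B by (intro M.integrable_const_bound[of _ B]) auto
  have Fupd: "(\<lambda>x. F (x(i := a))) \<in> borel_measurable ?P'" if "i \<in> insert j I" for i
    using that a by (intro measurable_compose[OF measurable_fun_upd[where J = "insert j I"] F]) auto
  have bint: "integrable ?P' g" if "g \<in> borel_measurable ?P'" "\<And>x. \<bar>g x\<bar> \<le> c" for g :: "_ \<Rightarrow> real" and c
    using that by (intro P'.integrable_const_bound[of _ c]) auto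
  have intF2: "integrable ?P' (\<lambda>x. (F x)\<^sup>2)" using sqB by (intro bint[of _ "B\<^sup>2"]) auto
  have intD: "integrable ?P' (\<lambda>x. (F x - F (x(i := a)))\<^sup>2)" if "i \<in> insert j I" for i
    using Fupd[OF that] dB by (intro bint[of _ "(2 * B)\<^sup>2"]) auto
  define H where "H x = (\<integral>y. F (x(j := y)) \<partial>M)" for x
  have H [measurable]: "H \<in> borel_measurable ?P"
    unfolding H_def[abs_def] using M.borel_measurable_lebesgue_integral[of "\<lambda>x y. F (x(j := y))" ?P] Fxy
    by (simp add: case_prod_unfold)
  have HB: "\<bar>H x\<bar> \<le> B" for x
  proof (cases "integrable M (\<lambda>y. F (x(j := y)))")
    case True
    have "\<bar>H x\<bar> \<le> (\<integral>y. \<bar>F (x(j := y))\<bar> \<partial>M)" unfolding H_def by (rule integral_abs_bound)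
    also have "\<dots> \<le> (\<integral>y. B \<partial>M)" using True B by (intro integral_mono) auto
    finally show ?thesis by (simp add: M.prob_space)
  next
    case False
    thus ?thesis using B0 by (simp add: H_def not_integrable_integral_eq)
  qed
  have Hsq: "(H x)\<^sup>2 \<le> B\<^sup>2" for x using HB[of x] B0 by (subst abs_le_square_iff[symmetric]) simp
  have intH2: "integrable ?P (\<lambda>x. (H x)\<^sup>2)" using Hsq by (intro P.integrable_const_bound[of _ "B\<^sup>2"]) auto
  have jensen: "(\<integral>y. g y \<partial>M)\<^sup>2 \<le> (\<integral>y. (g y)\<^sup>2 \<partial>M)"
    if g: "g \<in> borel_measurable M" "\<And>y. \<bar>g y\<bar> \<le> c" for g :: "'a \<Rightarrow> real" and c
  proof -
    have "integrable M g" using g by (intro M.integrable_const_bound[of _ c]) auto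
    moreover have "(g y)\<^sup>2 \<le> c\<^sup>2" for y using power_mono[OF g(2)[of y], of 2] by simp
    hence "integrable M (\<lambda>y. (g y)\<^sup>2)" using g by (intro M.integrable_const_bound[of _ "c\<^sup>2"]) auto
    ultimately have "M.variance g = (\<integral>y. (g y)\<^sup>2 \<partial>M) - (\<integral>y. g y \<partial>M)\<^sup>2" by (rule M.variance_eq)
    thus ?thesis using M.variance_positive[of g] by linarith
  qed
  have split: "(\<integral>x. g x \<partial>?P') = (\<integral>x. (\<integral>y. g (x(j := y)) \<partial>M) \<partial>?P)" if "integrable ?P' g" for g :: "_ \<Rightarrow> real"
    using product_integral_insert[OF insert.hyps that] .
  have gint: "integrable ?P (\<lambda>x. \<integral>y. g (x(j := y)) \<partial>M)" if g [measurable]: "g \<in> borel_measurable ?P'"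
    and c: "\<And>x. \<bar>g x\<bar> \<le> c" for g :: "_ \<Rightarrow> real" and c
  proof (rule P.integrable_const_bound[of _ "\<bar>c\<bar>"])
    have g2: "(\<lambda>p. g ((fst p)(j := snd p))) \<in> borel_measurable (?P \<Otimes>\<^sub>M M)"
      using measurable_compose[OF upd g] by (simp add: case_prod_unfold)
    show "(\<lambda>x. \<integral>y. g (x(j := y)) \<partial>M) \<in> borel_measurable ?P"
      using M.borel_measurable_lebesgue_integral[of "\<lambda>x y. g (x(j := y))" ?P] g2
      by (simp add: case_prod_unfold)
    have "\<bar>\<integral>y. g (x(j := y)) \<partial>M\<bar> \<le> \<bar>c\<bar>" for x
    proof (cases "integrable M (\<lambda>y. g (x(j := y)))")
      case True
      have "\<bar>\<integral>y. g (x(j := y)) \<partial>M\<bar> \<le> (\<integral>y. \<bar>g (x(j := y))\<bar> \<partial>M)" by (rule integral_abs_bound)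
      also have "\<dots> \<le> (\<integral>y. \<bar>c\<bar> \<partial>M)" using True c
        by (intro integral_mono) (auto intro: order.trans[OF c])
      finally show ?thesis by (simp add: M.prob_space)
    qed (simp add: not_integrable_integral_eq)
    thus "AE x in ?P. norm (\<integral>y. g (x(j := y)) \<partial>M) \<le> \<bar>c\<bar>" by simp
  qed
  \<comment> \<open>For fixed other coordinates, the variance in coordinate \<open>j\<close> is at
    most the mean squared deviation from the value \<open>c\<close> of \<open>F\<close> at
    \<open>a\<close>.\<close>
  have step1: "(\<integral>x. (F x)\<^sup>2 \<partial>?P') \<le> (\<integral>x. (H x)\<^sup>2 \<partial>?P) + (\<integral>x. (F x - F (x(j := a)))\<^sup>2 \<partial>?P')"
  proof -
    have "(\<integral>x. (F x)\<^sup>2 \<partial>?P') = (\<integral>x. (\<integral>y. (F (x(j := y)))\<^sup>2 \<partial>M) \<partial>?P)" by (rule split[OF intF2])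
    also have "\<dots> \<le> (\<integral>x. (H x)\<^sup>2 + (\<integral>y. (F (x(j := y)) - F ((x(j := y))(j := a)))\<^sup>2 \<partial>M) \<partial>?P)"
    proof (rule integral_mono)
      show "integrable ?P (\<lambda>x. \<integral>y. (F (x(j := y)))\<^sup>2 \<partial>M)" using sqB by (intro gint[of _ "B\<^sup>2"]) auto
      show "integrable ?P (\<lambda>x. (H x)\<^sup>2 + (\<integral>y. (F (x(j := y)) - F ((x(j := y))(j := a)))\<^sup>2 \<partial>M))"
        using dB by (intro Bochner_Integration.integrable_add intH2 gint[of "\<lambda>x. (F x - F (x(j := a)))\<^sup>2" "(2 * B)\<^sup>2"])
          (auto intro!: borel_measurable_power borel_measurable_diff F Fupd)
      fix x assume x: "x \<in> space ?P"
      define c where "c = F (x(j := a))"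
      have i2: "integrable M (\<lambda>y. (F (x(j := y)))\<^sup>2)"
        using Fy[OF x] sqB by (intro M.integrable_const_bound[of _ "B\<^sup>2"]) auto
      have "(\<integral>y. (F (x(j := y)) - c)\<^sup>2 \<partial>M) = (\<integral>y. (F (x(j := y)))\<^sup>2 - 2 * c * F (x(j := y)) + c\<^sup>2 \<partial>M)"
        by (intro Bochner_Integration.integral_cong) (auto simp: power2_eq_square algebra_simps)
      also have "\<dots> = (\<integral>y. (F (x(j := y)))\<^sup>2 \<partial>M) - 2 * c * H x + c\<^sup>2"
        using i2 inty[OF x] by (simp add: H_def M.prob_space)
      finally have "(\<integral>y. (F (x(j := y)))\<^sup>2 \<partial>M) \<le> (H x)\<^sup>2 + (\<integral>y. (F (x(j := y)) - c)\<^sup>2 \<partial>M)"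
        using zero_le_power2[of "H x - c"] by (simp add: power2_eq_square algebra_simps)
      thus "(\<integral>y. (F (x(j := y)))\<^sup>2 \<partial>M) \<le> (H x)\<^sup>2 + (\<integral>y. (F (x(j := y)) - F ((x(j := y))(j := a)))\<^sup>2 \<partial>M)"
        by (simp add: c_def)
    qed
    also have "\<dots> = (\<integral>x. (H x)\<^sup>2 \<partial>?P) + (\<integral>x. (\<integral>y. (F (x(j := y)) - F ((x(j := y))(j := a)))\<^sup>2 \<partial>M) \<partial>?P)"
      using dB by (intro Bochner_Integration.integral_add intH2 gint[of "\<lambda>x. (F x - F (x(j := a)))\<^sup>2" "(2 * B)\<^sup>2"])
          (auto intro!: borel_measurable_power borel_measurable_diff F Fupd)
    also have "(\<integral>x. (\<integral>y. (F (x(j := y)) - F ((x(j := y))(j := a)))\<^sup>2 \<partial>M) \<partial>?P) = (\<integral>x. (F x - F (x(j := a)))\<^sup>2 \<partial>?P')"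
      by (rule split[OF intD, symmetric]) simp
    finally show ?thesis .
  qed
  \<comment> \<open>Freezing coordinate \<open>i\<close> commutes with averaging over coordinate
    \<open>j\<close>; Jensen's inequality then moves the square inside.\<close>
  have step2: "(\<integral>x. (H x - H (x(i := a)))\<^sup>2 \<partial>?P) \<le> (\<integral>x. (F x - F (x(i := a)))\<^sup>2 \<partial>?P')" if i: "i \<in> I" for i
  proof -
    have ij: "i \<noteq> j" using insert.hyps i by auto
    have Fd: "(\<lambda>x. F x - F (x(i := a))) \<in> borel_measurable ?P'"
      using Fupd[of i] i by (intro borel_measurable_diff F) auto
    have upda: "(\<lambda>x. x(i := a)) \<in> ?P \<rightarrow>\<^sub>M ?P" using i a by (intro measurable_fun_upd) auto
    have "(\<integral>x. (H x - H (x(i := a)))\<^sup>2 \<partial>?P) \<le> (\<integral>x. (\<integral>y. (F (x(j := y)) - F ((x(j := y))(i := a)))\<^sup>2 \<partial>M) \<partial>?P)"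
    proof (rule integral_mono)
      show "integrable ?P (\<lambda>x. \<integral>y. (F (x(j := y)) - F ((x(j := y))(i := a)))\<^sup>2 \<partial>M)"
        using dB Fd by (intro gint[of "\<lambda>x. (F x - F (x(i := a)))\<^sup>2" "(2 * B)\<^sup>2"]) auto
      have "(H x - H (x(i := a)))\<^sup>2 \<le> (2 * B)\<^sup>2" for x
        using HB[of x] HB[of "x(i := a)"] B0 by (subst abs_le_square_iff[symmetric]) simp
      moreover have "(\<lambda>x. H (x(i := a))) \<in> borel_measurable ?P" by (rule measurable_compose[OF upda H])
      ultimately show "integrable ?P (\<lambda>x. (H x - H (x(i := a)))\<^sup>2)"
        by (intro P.integrable_const_bound[of _ "(2 * B)\<^sup>2"]) auto
      fix x assume x: "x \<in> space ?P"
      hence xa: "x(i := a) \<in> space ?P" using measurable_space[OF upda] by blast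
      have eq: "(x(i := a))(j := y) = (x(j := y))(i := a)" for y using ij by (rule fun_upd_twist)
      have "H x - H (x(i := a)) = (\<integral>y. F (x(j := y)) - F ((x(i := a))(j := y)) \<partial>M)"
        unfolding H_def by (rule Bochner_Integration.integral_diff[symmetric, OF inty[OF x] inty[OF xa]])
      also have "\<dots>\<^sup>2 \<le> (\<integral>y. (F (x(j := y)) - F ((x(i := a))(j := y)))\<^sup>2 \<partial>M)"
      proof (rule jensen[of _ "2 * B"])
        show "(\<lambda>y. F (x(j := y)) - F ((x(i := a))(j := y))) \<in> borel_measurable M"
          using Fy[OF x] Fy[OF xa] by (intro borel_measurable_diff)
        show "\<bar>F (x(j := y)) - F ((x(i := a))(j := y))\<bar> \<le> 2 * B" for y
          using B[of "x(j := y)"] B[of "(x(i := a))(j := y)"] by linarith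
      qed
      finally show "(H x - H (x(i := a)))\<^sup>2 \<le> (\<integral>y. (F (x(j := y)) - F ((x(j := y))(i := a)))\<^sup>2 \<partial>M)"
        unfolding eq .
    qed
    also have "\<dots> = (\<integral>x. (F x - F (x(i := a)))\<^sup>2 \<partial>?P')"
      using i by (intro split[OF intD, symmetric]) simp
    finally show ?thesis .
  qed
  have "(\<integral>x. F x \<partial>?P') = (\<integral>x. H x \<partial>?P)" unfolding H_def using B by (intro split bint[of _ B]) auto
  hence s1: "(\<integral>x. (F x)\<^sup>2 \<partial>?P') - (\<integral>x. F x \<partial>?P')\<^sup>2 \<le>
      (\<integral>x. (F x - F (x(j := a)))\<^sup>2 \<partial>?P') + ((\<integral>x. (H x)\<^sup>2 \<partial>?P) - (\<integral>x. H x \<partial>?P)\<^sup>2)"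
    using step1 by simp
  have "(\<integral>x. (H x)\<^sup>2 \<partial>?P) - (\<integral>x. H x \<partial>?P)\<^sup>2 \<le> (\<Sum>i\<in>I. \<integral>x. (H x - H (x(i := a)))\<^sup>2 \<partial>?P)"
    by (rule insert.IH[OF H HB])
  also have "\<dots> \<le> (\<Sum>i\<in>I. \<integral>x. (F x - F (x(i := a)))\<^sup>2 \<partial>?P')" by (intro sum_mono step2)
  finally have s2: "(\<integral>x. (H x)\<^sup>2 \<partial>?P) - (\<integral>x. H x \<partial>?P)\<^sup>2 \<le> (\<Sum>i\<in>I. \<integral>x. (F x - F (x(i := a)))\<^sup>2 \<partial>?P')" .
  show ?case unfolding sum.insert[OF insert.hyps(1,2)] by (rule order.trans[OF s1 add_left_mono[OF s2]])
qed

subsection \<open>Moments of triple products\<close>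

lemma power_le_fact_exp:
  fixes x :: real
  assumes "x \<ge> 0"
  shows "x ^ n \<le> fact n * exp x"
proof -
  have "(\<Sum>k\<in>{n}. x ^ k /\<^sub>R fact k) \<le> (\<Sum>k. x ^ k /\<^sub>R fact k)"
    using assms by (intro sum_le_suminf summable_exp_generic) auto
  hence "x ^ n / fact n \<le> exp x" by (simp add: exp_def divide_inverse mult.commute)
  thus ?thesis by (simp add: field_simps)
qed

text \<open>An integrable majorant for polynomials in the three coordinates of a pair. It is a sum
  rather than a product because \<open>k = l\<close> is allowed: the product would then contain
  \<open>exp ((cmod (t k))\<^sup>2 / 2)\<close>, which has infinite mean.\<close>

definition gexp :: "nat \<times> nat \<Rightarrow> (nat \<Rightarrow> complex) \<Rightarrow> real" where
  "gexp = (\<lambda>(k, l) t. exp ((cmod (t (k + l)))\<^sup>2 / 4) + exp ((cmod (t k))\<^sup>2 / 4) + exp ((cmod (t l))\<^sup>2 / 4))"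

lemma gexp_nonneg: "gexp p t \<ge> 0"
  by (auto simp: gexp_def case_prod_unfold intro!: add_nonneg_nonneg)

lemma integral_cgauss_exp:
  "integrable cgauss (\<lambda>z. exp ((cmod z)\<^sup>2 / 4))" "(\<integral>z. exp ((cmod z)\<^sup>2 / 4) \<partial>cgauss) = 2"
proof -
  have m: "(\<lambda>z. exp ((cmod z)\<^sup>2 / 4)) \<in> borel_measurable cgauss" by measurable
  show "integrable cgauss (\<lambda>z. exp ((cmod z)\<^sup>2 / 4))"
    by (rule integrableI_nonneg[OF m]) (auto simp: cgauss_exp_moment)
  show "(\<integral>z. exp ((cmod z)\<^sup>2 / 4) \<partial>cgauss) = 2"
    by (subst integral_eq_nn_integral[OF m]) (auto simp: cgauss_exp_moment)
qed

lemma distr_gauss_vec_component: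
  assumes "k \<in> {1..K}" shows "distr (gauss_vec K) cgauss (\<lambda>t. t k) = cgauss"
  unfolding gauss_vec_def by (rule distr_PiM_component[OF prob_space_cgauss assms])

lemma gauss_vec_component':
  assumes "k \<in> {1..K}" shows "(\<lambda>t. t k) \<in> gauss_vec K \<rightarrow>\<^sub>M cgauss"
  unfolding gauss_vec_def by (rule measurable_component_singleton) (rule assms)

lemma integral_gauss_vec_component:
  fixes f :: "complex \<Rightarrow> 'b::{banach, second_countable_topology}"
  assumes k: "k \<in> {1..K}" and f: "f \<in> borel_measurable borel"
  shows "integrable (gauss_vec K) (\<lambda>t. f (t k)) \<longleftrightarrow> integrable cgauss f"
    and "(\<integral>t. f (t k) \<partial>gauss_vec K) = (\<integral>z. f z \<partial>cgauss)"
proof -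
  have f': "f \<in> borel_measurable cgauss" using f by (subst measurable_cong_sets[OF sets_cgauss refl])
  show "integrable (gauss_vec K) (\<lambda>t. f (t k)) \<longleftrightarrow> integrable cgauss f"
    using integrable_distr_eq[OF gauss_vec_component'[OF k] f'] unfolding distr_gauss_vec_component[OF k] by simp
  show "(\<integral>t. f (t k) \<partial>gauss_vec K) = (\<integral>z. f z \<partial>cgauss)"
    using integral_distr[OF gauss_vec_component'[OF k] f'] unfolding distr_gauss_vec_component[OF k] by simp
qed

lemma integral_gexp:
  assumes "p \<in> index_pairs K"
  shows "integrable (gauss_vec K) (gexp p)" "(\<integral>t. gexp p t \<partial>gauss_vec K) = 6"
proof -
  obtain k l where p: "p = (k, l)" by force
  have mem: "k + l \<in> {1..K}" "k \<in> {1..K}" "l \<in> {1..K}" using assms by (auto simp: p index_pairs_def)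
  have i: "integrable (gauss_vec K) (\<lambda>t. exp ((cmod (t j))\<^sup>2 / 4))" "(\<integral>t. exp ((cmod (t j))\<^sup>2 / 4) \<partial>gauss_vec K) = 2"
    if "j \<in> {1..K}" for j
    using integral_gauss_vec_component[OF that, of "\<lambda>z. exp ((cmod z)\<^sup>2 / 4)"] integral_cgauss_exp by auto
  have e: "gexp p = (\<lambda>t. exp ((cmod (t (k + l)))\<^sup>2 / 4) + exp ((cmod (t k))\<^sup>2 / 4) + exp ((cmod (t l))\<^sup>2 / 4))"
    by (simp add: gexp_def p)
  show "integrable (gauss_vec K) (gexp p)" unfolding e by (intro Bochner_Integration.integrable_add i mem)
  show "(\<integral>t. gexp p t \<partial>gauss_vec K) = 6" unfolding e
    using i[OF mem(1)] i[OF mem(2)] i[OF mem(3)] by simp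
qed

lemma gexp_max:
  obtains z where "z \<ge> 0" "cmod (t (k + l)) \<le> z" "cmod (t k) \<le> z" "cmod (t l) \<le> z" "exp (z\<^sup>2 / 4) \<le> gexp (k, l) t"
    "z \<in> {cmod (t (k + l)), cmod (t k), cmod (t l)}"
proof -
  define z where "z = max (cmod (t (k + l))) (max (cmod (t k)) (cmod (t l)))"
  have z: "z \<in> {cmod (t (k + l)), cmod (t k), cmod (t l)}" unfolding z_def by (auto simp: max_def)
  have pos: "exp x + exp y + exp w \<ge> exp x" "exp x + exp y + exp w \<ge> exp y" "exp x + exp y + exp w \<ge> exp w" for x y w :: real
    using exp_ge_zero[of x] exp_ge_zero[of y] exp_ge_zero[of w] by linarith+
  have "exp (z\<^sup>2 / 4) \<le> gexp (k, l) t" using z unfolding gexp_def prod.case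
    by (elim insertE emptyE) (simp_all only: pos)
  moreover have "z \<ge> 0" using z by auto
  ultimately show ?thesis using z that[of z] by (simp add: z_def)
qed

text \<open>The three flags say which factors occur; expanding \<open>triple\<close> gives the seven
  patterns with at least one flag set.\<close>

definition tri_mono :: "bool \<Rightarrow> bool \<Rightarrow> bool \<Rightarrow> nat \<times> nat \<Rightarrow> (nat \<Rightarrow> complex) \<Rightarrow> complex" where
  "tri_mono a b c = (\<lambda>(k, l) t. (if a then t (k + l) else 1) * (if b then cnj (t k) else 1) * (if c then cnj (t l) else 1))"

text \<open>With \<open>s k = \<sigma> / r k\<close>, the factor \<open>1 + triple s (k, l) t\<close> is the relative error of one summand of
  \<open>B_hat\<close> at \<open>(k, l)\<close>, once the noise \<open>t\<close> is rotated into the frame of the signal.\<close>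

definition triple :: "(nat \<Rightarrow> real) \<Rightarrow> nat \<times> nat \<Rightarrow> (nat \<Rightarrow> complex) \<Rightarrow> complex" where
  "triple s = (\<lambda>(k, l) t. (1 + s (k + l) * t (k + l)) * (1 + s k * cnj (t k)) * (1 + s l * cnj (t l)) - 1)"

lemma measurable_tri_mono [measurable]:
  assumes "p \<in> index_pairs K" shows "tri_mono a b c p \<in> borel_measurable (gauss_vec K)"
proof -
  obtain k l where p: "p = (k, l)" by force
  have [measurable]: "k + l \<in> {1..K}" "k \<in> {1..K}" "l \<in> {1..K}" using assms by (auto simp: p index_pairs_def)
  note [measurable] = gauss_vec_component[of "k + l" K] gauss_vec_component[of k K] gauss_vec_component[of l K]
  show ?thesis unfolding tri_mono_def p prod.case by measurable
qed

lemma measurable_triple [measurable]: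
  assumes "p \<in> index_pairs K" shows "triple s p \<in> borel_measurable (gauss_vec K)"
proof -
  obtain k l where p: "p = (k, l)" by force
  have [measurable]: "k + l \<in> {1..K}" "k \<in> {1..K}" "l \<in> {1..K}" using assms by (auto simp: p index_pairs_def)
  note [measurable] = gauss_vec_component[of "k + l" K] gauss_vec_component[of k K] gauss_vec_component[of l K]
  show ?thesis unfolding triple_def p prod.case by measurable
qed

lemma tri_mono_sq_le: "(cmod (tri_mono a b c p t))\<^sup>2 \<le> 385 * gexp p t"
proof -
  obtain k l where p: "p = (k, l)" by force
  obtain z where z: "z \<ge> 0" "cmod (t (k + l)) \<le> z" "cmod (t k) \<le> z" "cmod (t l) \<le> z" "exp (z\<^sup>2 / 4) \<le> gexp (k, l) t"
    by (rule gexp_max)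
  define y where "y = max 1 z"
  have y: "1 \<le> y" "z \<le> y" unfolding y_def by auto
  have "cmod (tri_mono a b c p t) \<le> y * y * y"
    unfolding tri_mono_def p prod.case norm_mult using z y
    by (intro mult_mono) (auto intro: order.trans[OF _ y(2)] mult_nonneg_nonneg)
  hence "(cmod (tri_mono a b c p t))\<^sup>2 \<le> (y * y * y)\<^sup>2" by (intro power_mono) auto
  also have "(y * y * y)\<^sup>2 = y ^ 6" by (simp add: power2_eq_square power_numeral_reduce)
  also have "\<dots> \<le> 1 + z ^ 6" using z(1) by (cases "z \<le> 1") (auto simp: y_def max_def)
  \<comment> \<open>The constant is \<open>4 ^ 3 * 3!\<close>, from the cubic term of the
    exponential series at \<open>z\<^sup>2 / 4\<close>.\<close>
  also have "z ^ 6 \<le> 384 * exp (z\<^sup>2 / 4)"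
    using power_le_fact_exp[of "z\<^sup>2 / 4" 3] by (simp add: power_divide fact_numeral power_mult[symmetric])
  also have "1 + 384 * exp (z\<^sup>2 / 4) \<le> 385 * exp (z\<^sup>2 / 4)" by simp
  also have "\<dots> \<le> 385 * gexp p t" using z(5) p by simp
  finally show ?thesis by simp
qed

lemma tri_mono_integrable_sq:
  assumes "p \<in> index_pairs K"
  shows "integrable (gauss_vec K) (\<lambda>t. (cmod (tri_mono a b c p t))\<^sup>2)"
    and "(\<integral>t. (cmod (tri_mono a b c p t))\<^sup>2 \<partial>gauss_vec K) \<le> 2310"
proof -
  note [measurable] = assms
  have g: "integrable (gauss_vec K) (\<lambda>t. 385 * gexp p t)" using integral_gexp(1)[OF assms] by simp
  show i: "integrable (gauss_vec K) (\<lambda>t. (cmod (tri_mono a b c p t))\<^sup>2)"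
    by (rule Bochner_Integration.integrable_bound[OF g])
       (auto intro!: AE_I2 tri_mono_sq_le simp: gexp_nonneg)
  have "(\<integral>t. (cmod (tri_mono a b c p t))\<^sup>2 \<partial>gauss_vec K) \<le> (\<integral>t. 385 * gexp p t \<partial>gauss_vec K)"
    by (intro integral_mono i g tri_mono_sq_le)
  thus "(\<integral>t. (cmod (tri_mono a b c p t))\<^sup>2 \<partial>gauss_vec K) \<le> 2310" using integral_gexp(2)[OF assms] by simp
qed

section \<open>Orthogonality of the monomials and second moments of their combinations\<close>

lemma integrable_mult_cnj:
  fixes f g :: "'a \<Rightarrow> complex"
  assumes [measurable]: "f \<in> borel_measurable M" "g \<in> borel_measurable M"
    and "integrable M (\<lambda>x. (cmod (f x))\<^sup>2)" "integrable M (\<lambda>x. (cmod (g x))\<^sup>2)"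
  shows "integrable M (\<lambda>x. f x * cnj (g x))"
proof (rule Bochner_Integration.integrable_bound)
  show "integrable M (\<lambda>x. (cmod (f x))\<^sup>2 + (cmod (g x))\<^sup>2)" using assms by simp
  have "cmod (f x) * cmod (g x) \<le> (cmod (f x))\<^sup>2 + (cmod (g x))\<^sup>2" for x
    using sum_squares_bound[of "cmod (f x)" "cmod (g x)"] mult_nonneg_nonneg[OF norm_ge_zero norm_ge_zero, of "f x" "g x"]
    by linarith
  thus "AE x in M. norm (f x * cnj (g x)) \<le> norm ((cmod (f x))\<^sup>2 + (cmod (g x))\<^sup>2)"
    by (auto simp: norm_mult intro!: AE_I2)
qed measurable

lemma integral_orthogonal_sum_le:
  fixes f :: "'i \<Rightarrow> 'a \<Rightarrow> complex"
  assumes A: "finite A" and meas: "\<And>p. p \<in> A \<Longrightarrow> f p \<in> borel_measurable M"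
    and int: "\<And>p. p \<in> A \<Longrightarrow> integrable M (\<lambda>x. (cmod (f p x))\<^sup>2)"
    and B: "\<And>p. p \<in> A \<Longrightarrow> (\<integral>x. (cmod (f p x))\<^sup>2 \<partial>M) \<le> B"
    and orth: "\<And>p q. p \<in> A \<Longrightarrow> q \<in> A \<Longrightarrow> p \<noteq> q \<Longrightarrow> (\<integral>x. f p x * cnj (f q x) \<partial>M) = 0"
  shows "integrable M (\<lambda>x. (cmod (\<Sum>p\<in>A. c p * f p x))\<^sup>2)"
    and "(\<integral>x. (cmod (\<Sum>p\<in>A. c p * f p x))\<^sup>2 \<partial>M) \<le> B * (\<Sum>p\<in>A. (cmod (c p))\<^sup>2)"
proof -
  have i: "integrable M (\<lambda>x. f p x * cnj (f q x))" if "p \<in> A" "q \<in> A" for p q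
    using that by (intro integrable_mult_cnj meas int)
  have eq: "complex_of_real ((cmod (\<Sum>p\<in>A. c p * f p x))\<^sup>2) = (\<Sum>p\<in>A. \<Sum>q\<in>A. c p * cnj (c q) * (f p x * cnj (f q x)))" for x
    unfolding complex_norm_square cnj_sum sum_product by (simp add: mult_ac)
  have ii: "integrable M (\<lambda>x. \<Sum>p\<in>A. \<Sum>q\<in>A. c p * cnj (c q) * (f p x * cnj (f q x)))"
    by (intro Bochner_Integration.integrable_sum integrable_mult_right i)
  have re: "(cmod (\<Sum>p\<in>A. c p * f p x))\<^sup>2 = Re (\<Sum>p\<in>A. \<Sum>q\<in>A. c p * cnj (c q) * (f p x * cnj (f q x)))" for x
    unfolding eq[symmetric] by simp
  show "integrable M (\<lambda>x. (cmod (\<Sum>p\<in>A. c p * f p x))\<^sup>2)" unfolding re by (rule integrable_Re[OF ii])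
  have "(\<integral>x. (cmod (\<Sum>p\<in>A. c p * f p x))\<^sup>2 \<partial>M) = Re (\<integral>x. (\<Sum>p\<in>A. \<Sum>q\<in>A. c p * cnj (c q) * (f p x * cnj (f q x))) \<partial>M)"
    unfolding re by (rule integral_Re[OF ii])
  also have "(\<integral>x. (\<Sum>p\<in>A. \<Sum>q\<in>A. c p * cnj (c q) * (f p x * cnj (f q x))) \<partial>M) =
     (\<Sum>p\<in>A. \<Sum>q\<in>A. c p * cnj (c q) * (\<integral>x. f p x * cnj (f q x) \<partial>M))"
    using i by (simp add: Bochner_Integration.integral_sum)
  also have "\<dots> = (\<Sum>p\<in>A. \<Sum>q\<in>A. if q = p then c p * cnj (c q) * (\<integral>x. f p x * cnj (f q x) \<partial>M) else 0)"
    using orth by (intro sum.cong refl) auto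
  also have "\<dots> = (\<Sum>p\<in>A. complex_of_real ((cmod (c p))\<^sup>2 * (\<integral>x. (cmod (f p x))\<^sup>2 \<partial>M)))"
    using A by (intro sum.cong refl) (simp add: complex_norm_square[symmetric] del: of_real_power)
  also have "Re \<dots> = (\<Sum>p\<in>A. (cmod (c p))\<^sup>2 * (\<integral>x. (cmod (f p x))\<^sup>2 \<partial>M))" by simp
  also have "\<dots> \<le> (\<Sum>p\<in>A. (cmod (c p))\<^sup>2 * B)" by (intro sum_mono mult_left_mono B) auto
  finally show "(\<integral>x. (cmod (\<Sum>p\<in>A. c p * f p x))\<^sup>2 \<partial>M) \<le> B * (\<Sum>p\<in>A. (cmod (c p))\<^sup>2)"
    by (simp add: sum_distrib_left mult.commute)
qed

text \<open>Rotating a single coordinate by \<open>\<i>\<close> preserves the measure and multiplies monomials by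
  powers of \<open>\<i>\<close>; monomials with different degrees in that coordinate are therefore orthogonal.\<close>

lemma tri_mono_orthogonal:
  assumes p: "p \<in> index_pairs K" and q: "q \<in> index_pairs K"
    and j: "\<And>r. r \<in> {p, q} \<Longrightarrow> w r = (if a \<and> fst r + snd r = j then \<i> else 1) *
         (if b \<and> fst r = j then - \<i> else 1) * (if c \<and> snd r = j then - \<i> else 1)"
    and w: "w p * cnj (w q) \<noteq> 1"
  shows "(\<integral>t. tri_mono a b c p t * cnj (tri_mono a b c q t) \<partial>gauss_vec K) = 0"
proof -
  note [measurable] = p q
  define h where "h k = (if k = j then (\<lambda>z. \<i> * z) else (\<lambda>z. z))" for k
  define R where "R t = (\<lambda>k\<in>{1..K}. h k (t k))" for t
  have m: "h k \<in> borel_measurable borel" for k unfolding h_def by simp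
  have d: "distr cgauss borel (h k) = cgauss" for k
    using distr_cgauss_mult[of \<i>] distr_cgauss_mult[of 1] by (simp add: h_def)
  have rot: "tri_mono a b c r (R t) = w r * tri_mono a b c r t" if "r \<in> {p, q}" for r t
  proof -
    obtain k l where r: "r = (k, l)" by force
    have mem: "k + l \<in> {1..K}" "k \<in> {1..K}" "l \<in> {1..K}" using that p q by (auto simp: r index_pairs_def)
    have R: "R t i = (if i = j then \<i> else 1) * t i" if "i \<in> {1..K}" for i
      using that by (auto simp: R_def h_def)
    show ?thesis unfolding j[OF that] unfolding r tri_mono_def prod.case fst_conv snd_conv R[OF mem(1)] R[OF mem(2)] R[OF mem(3)]
      by auto
  qed
  let ?I = "\<integral>t. tri_mono a b c p t * cnj (tri_mono a b c q t) \<partial>gauss_vec K"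
  have "?I = (\<integral>t. tri_mono a b c p (R t) * cnj (tri_mono a b c q (R t)) \<partial>gauss_vec K)"
    unfolding R_def by (rule integral_gauss_vec_map[symmetric, OF m d]) measurable
  also have "\<dots> = (\<integral>t. (w p * cnj (w q)) * (tri_mono a b c p t * cnj (tri_mono a b c q t)) \<partial>gauss_vec K)"
    by (intro Bochner_Integration.integral_cong refl) (simp add: rot)
  also have "\<dots> = (w p * cnj (w q)) * ?I" by simp
  finally have "(1 - w p * cnj (w q)) * ?I = 0" by (simp add: left_diff_distrib)
  thus ?thesis using w by auto
qed

text \<open>It suffices to find a coordinate in which the two monomials have different degrees
  modulo 4, where conjugate factors count negatively. Swapped pairs are excluded because they can
  carry the same monomial, and degree one is excluded because many pairs share an index.\<close>

lemma tri_mono_orthogonal_cases: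
  assumes p: "p \<in> index_pairs K" and q: "q \<in> index_pairs K" and pq: "p \<noteq> q" "p \<noteq> prod.swap q"
    and deg: "(a \<and> b) \<or> (a \<and> c) \<or> (b \<and> c)"
  shows "(\<integral>t. tri_mono a b c p t * cnj (tri_mono a b c q t) \<partial>gauss_vec K) = 0"
proof -
  define w where "w j r = (if a \<and> fst r + snd r = j then \<i> else 1) *
         (if b \<and> fst r = j then - \<i> else 1) * (if c \<and> snd r = j then - \<i> else 1)" for j and r :: "nat \<times> nat"
  obtain k l k' l' where kl: "p = (k, l)" "q = (k', l')" by (metis surj_pair)
  have pos: "k > 0" "l > 0" "k' > 0" "l' > 0" using p q by (auto simp: kl index_pairs_def)
  have ne: "\<not> (k = k' \<and> l = l')" "\<not> (k = l' \<and> l = k')" using pq by (auto simp: kl)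
  have "\<exists>j. w j p * cnj (w j q) \<noteq> 1"
  proof (cases a)
    case True
    note a = this
    show ?thesis
    proof (cases "k + l = k' + l'")
      case eq: True
      \<comment> \<open>With equal sums, one common component would force the pairs to coincide or
        to be swapped.\<close>
      hence d: "k \<noteq> k'" "k \<noteq> l'" "l \<noteq> l'" "l \<noteq> k'" using ne by auto
      show ?thesis
      proof (cases b)
        case True
        have "w k p * cnj (w k q) \<noteq> 1" using pos d a True eq by (auto simp: w_def kl complex_eq_iff)
        thus ?thesis by blast
      next
        case False
        hence c using deg by auto
        have "w l p * cnj (w l q) \<noteq> 1" using pos d a False \<open>c\<close> eq by (auto simp: w_def kl complex_eq_iff)
        thus ?thesis by blast
      qed
    next
      case False
      \<comment> \<open>The larger of the two sums exceeds every other index involved, so only one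
        of the monomials contains it.\<close>
      define j where "j = max (k + l) (k' + l')"
      have "w j p * cnj (w j q) \<noteq> 1" using False pos a by (auto simp: w_def kl j_def max_def complex_eq_iff)
      thus ?thesis by blast
    qed
  next
    case False
    hence bc: b c using deg by auto
    consider "k \<noteq> k' \<and> k \<noteq> l'" | "l \<noteq> k' \<and> l \<noteq> l'" | "k' \<noteq> k \<and> k' \<noteq> l" | "l' \<noteq> k \<and> l' \<noteq> l"
      using ne by metis
    thus ?thesis
    proof cases
      case 1
      hence "w k p * cnj (w k q) \<noteq> 1" using False bc by (auto simp: w_def kl complex_eq_iff)
      thus ?thesis by blast
    next
      case 2
      hence "w l p * cnj (w l q) \<noteq> 1" using False bc by (auto simp: w_def kl complex_eq_iff)
      thus ?thesis by blast
    next
      case 3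
      hence "w k' p * cnj (w k' q) \<noteq> 1" using False bc by (auto simp: w_def kl complex_eq_iff)
      thus ?thesis by blast
    next
      case 4
      hence "w l' p * cnj (w l' q) \<noteq> 1" using False bc by (auto simp: w_def kl complex_eq_iff)
      thus ?thesis by blast
    qed
  qed
  then obtain j where "w j p * cnj (w j q) \<noteq> 1" by blast
  thus ?thesis by (intro tri_mono_orthogonal[OF p q, where w = "w j" and j = j]) (simp_all add: w_def)
qed

lemma norm_sum_sq_le:
  fixes c f :: "'i \<Rightarrow> complex"
  shows "(cmod (\<Sum>p\<in>A. c p * f p))\<^sup>2 \<le> (\<Sum>p\<in>A. cmod (c p)) * (\<Sum>p\<in>A. cmod (c p) * (cmod (f p))\<^sup>2)"
proof -
  have "cmod (\<Sum>p\<in>A. c p * f p) \<le> (\<Sum>p\<in>A. cmod (c p) * cmod (f p))"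
    by (rule order.trans[OF norm_sum]) (simp add: norm_mult)
  also have "\<dots> = (\<Sum>p\<in>A. sqrt (cmod (c p)) * (sqrt (cmod (c p)) * cmod (f p)))"
    by (simp add: mult.assoc[symmetric])
  finally have "(cmod (\<Sum>p\<in>A. c p * f p))\<^sup>2 \<le> (\<Sum>p\<in>A. sqrt (cmod (c p)) * (sqrt (cmod (c p)) * cmod (f p)))\<^sup>2"
    by (intro power_mono) auto
  also have "\<dots> \<le> (\<Sum>p\<in>A. (sqrt (cmod (c p)))\<^sup>2) * (\<Sum>p\<in>A. (sqrt (cmod (c p)) * cmod (f p))\<^sup>2)"
    by (rule Cauchy_Schwarz_ineq_sum)
  finally show ?thesis by (simp add: power_mult_distrib)
qed

text \<open>Weighted Cauchy--Schwarz without orthogonality. It provides the bound for degree one,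
  where pairs with a common index share the same monomial, and integrability in all degrees.\<close>

lemma tri_mono_sum_deg1:
  "integrable (gauss_vec K) (\<lambda>t. (cmod (\<Sum>p\<in>index_pairs K. d p * tri_mono a b c p t))\<^sup>2)"
  "(\<integral>t. (cmod (\<Sum>p\<in>index_pairs K. d p * tri_mono a b c p t))\<^sup>2 \<partial>gauss_vec K)
     \<le> 2310 * (\<Sum>p\<in>index_pairs K. cmod (d p))\<^sup>2"
proof -
  let ?I = "index_pairs K"
  define D where "D = (\<Sum>p\<in>?I. cmod (d p))"
  have D0: "D \<ge> 0" unfolding D_def by (intro sum_nonneg) auto
  have meas [measurable]: "(\<lambda>t. \<Sum>p\<in>?I. d p * tri_mono a b c p t) \<in> borel_measurable (gauss_vec K)"
    by (intro borel_measurable_sum borel_measurable_times borel_measurable_const measurable_tri_mono)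
  have i: "integrable (gauss_vec K) (\<lambda>t. D * (\<Sum>p\<in>?I. cmod (d p) * (cmod (tri_mono a b c p t))\<^sup>2))"
    by (intro integrable_mult_right Bochner_Integration.integrable_sum tri_mono_integrable_sq)
  have le: "(cmod (\<Sum>p\<in>?I. d p * tri_mono a b c p t))\<^sup>2 \<le> D * (\<Sum>p\<in>?I. cmod (d p) * (cmod (tri_mono a b c p t))\<^sup>2)" for t
    unfolding D_def by (rule norm_sum_sq_le)
  show int: "integrable (gauss_vec K) (\<lambda>t. (cmod (\<Sum>p\<in>?I. d p * tri_mono a b c p t))\<^sup>2)"
    by (rule Bochner_Integration.integrable_bound[OF i]) (auto intro!: AE_I2 order.trans[OF le])
  have "(\<integral>t. (cmod (\<Sum>p\<in>?I. d p * tri_mono a b c p t))\<^sup>2 \<partial>gauss_vec K)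
     \<le> (\<integral>t. D * (\<Sum>p\<in>?I. cmod (d p) * (cmod (tri_mono a b c p t))\<^sup>2) \<partial>gauss_vec K)"
    by (intro integral_mono int i le)
  also have "\<dots> = D * (\<Sum>p\<in>?I. cmod (d p) * (\<integral>t. (cmod (tri_mono a b c p t))\<^sup>2 \<partial>gauss_vec K))"
    by (simp add: Bochner_Integration.integral_sum tri_mono_integrable_sq)
  also have "\<dots> \<le> D * (\<Sum>p\<in>?I. cmod (d p) * 2310)"
    by (intro mult_left_mono D0 sum_mono tri_mono_integrable_sq(2)) auto
  also have "\<dots> = 2310 * D\<^sup>2" by (simp add: D_def sum_distrib_right[symmetric] power2_eq_square)
  finally show "(\<integral>t. (cmod (\<Sum>p\<in>?I. d p * tri_mono a b c p t))\<^sup>2 \<partial>gauss_vec K) \<le> 2310 * (\<Sum>p\<in>?I. cmod (d p))\<^sup>2"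
    unfolding D_def .
qed

text \<open>Within each of the halves \<open>fst p \<le> snd p\<close> and
  \<open>snd p < fst p\<close> no two distinct pairs are swaps of one another, so the monomials are
  orthogonal there. Recombining the halves doubles the constant 2310.\<close>

lemma tri_mono_sum_deg2:
  assumes deg: "(a \<and> b) \<or> (a \<and> c) \<or> (b \<and> c)"
  shows "(\<integral>t. (cmod (\<Sum>p\<in>index_pairs K. d p * tri_mono a b c p t))\<^sup>2 \<partial>gauss_vec K)
     \<le> 4620 * (\<Sum>p\<in>index_pairs K. (cmod (d p))\<^sup>2)"
proof -
  let ?I = "index_pairs K"
  define A where "A = {p\<in>?I. fst p \<le> snd p}"
  define B where "B = {p\<in>?I. snd p < fst p}"
  have fin: "finite A" "finite B"
    by (auto simp: A_def B_def intro!: finite_subset[OF _ finite_index_pairs[of K]])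
  have AB: "?I = A \<union> B" "A \<inter> B = {}" "finite A" "finite B" "A \<subseteq> ?I" "B \<subseteq> ?I"
    using fin unfolding A_def B_def by auto
  have part: "integrable (gauss_vec K) (\<lambda>t. (cmod (\<Sum>p\<in>E. d p * tri_mono a b c p t))\<^sup>2) \<and>
     (\<integral>t. (cmod (\<Sum>p\<in>E. d p * tri_mono a b c p t))\<^sup>2 \<partial>gauss_vec K) \<le> 2310 * (\<Sum>p\<in>E. (cmod (d p))\<^sup>2)"
    if E: "E \<in> {A, B}" for E
  proof -
    have sub: "E \<subseteq> ?I" "finite E" using E AB by auto
    have sw: "p \<noteq> prod.swap q" if "p \<in> E" "q \<in> E" "p \<noteq> q" for p q
      using E that by (cases p; cases q) (auto simp: A_def B_def)
    have orth: "(\<integral>t. tri_mono a b c p t * cnj (tri_mono a b c q t) \<partial>gauss_vec K) = 0"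
      if "p \<in> E" "q \<in> E" "p \<noteq> q" for p q
      using that sub by (intro tri_mono_orthogonal_cases sw deg) auto
    show ?thesis using sub
      by (intro conjI integral_orthogonal_sum_le[where B = 2310] orth tri_mono_integrable_sq measurable_tri_mono) auto
  qed
  have le: "(cmod (\<Sum>p\<in>?I. d p * tri_mono a b c p t))\<^sup>2 \<le>
      2 * (cmod (\<Sum>p\<in>A. d p * tri_mono a b c p t))\<^sup>2 + 2 * (cmod (\<Sum>p\<in>B. d p * tri_mono a b c p t))\<^sup>2" for t
  proof -
    let ?x = "\<Sum>p\<in>A. d p * tri_mono a b c p t" and ?y = "\<Sum>p\<in>B. d p * tri_mono a b c p t"
    have "(\<Sum>p\<in>?I. d p * tri_mono a b c p t) = ?x + ?y"
      using AB by (simp add: sum.union_disjoint)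
    hence "(cmod (\<Sum>p\<in>?I. d p * tri_mono a b c p t))\<^sup>2 \<le> (cmod ?x + cmod ?y)\<^sup>2"
      by (simp add: norm_triangle_ineq power_mono)
    also have "\<dots> \<le> 2 * (cmod ?x)\<^sup>2 + 2 * (cmod ?y)\<^sup>2"
      using sum_squares_bound[of "cmod ?x" "cmod ?y"] by (simp add: power2_sum)
    finally show ?thesis .
  qed
  have "(\<integral>t. (cmod (\<Sum>p\<in>?I. d p * tri_mono a b c p t))\<^sup>2 \<partial>gauss_vec K) \<le>
      (\<integral>t. 2 * (cmod (\<Sum>p\<in>A. d p * tri_mono a b c p t))\<^sup>2 + 2 * (cmod (\<Sum>p\<in>B. d p * tri_mono a b c p t))\<^sup>2 \<partial>gauss_vec K)"
    using part by (intro integral_mono tri_mono_sum_deg1 le Bochner_Integration.integrable_add integrable_mult_right) auto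
  also have "\<dots> = 2 * (\<integral>t. (cmod (\<Sum>p\<in>A. d p * tri_mono a b c p t))\<^sup>2 \<partial>gauss_vec K) +
      2 * (\<integral>t. (cmod (\<Sum>p\<in>B. d p * tri_mono a b c p t))\<^sup>2 \<partial>gauss_vec K)"
    using part by simp
  also have "\<dots> \<le> 2 * (2310 * (\<Sum>p\<in>A. (cmod (d p))\<^sup>2)) + 2 * (2310 * (\<Sum>p\<in>B. (cmod (d p))\<^sup>2))"
    using part by (intro add_mono mult_left_mono) auto
  also have "\<dots> = 4620 * (\<Sum>p\<in>?I. (cmod (d p))\<^sup>2)"
    using AB by (simp add: sum.union_disjoint)
  finally show ?thesis .
qed

lemma pow4_le: "S \<ge> 0 \<Longrightarrow> S ^ 4 \<le> S\<^sup>2 + (S::real) ^ 6"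
proof -
  assume S: "S \<ge> 0"
  have "2 * S * S ^ 3 \<le> S\<^sup>2 + (S ^ 3)\<^sup>2" by (rule sum_squares_bound)
  moreover have "S * S ^ 3 = S ^ 4" "(S ^ 3)\<^sup>2 = S ^ 6" by (simp_all add: power2_eq_square power_numeral_reduce)
  moreover have "S ^ 4 \<ge> 0" using S by simp
  ultimately show ?thesis unfolding mult.assoc by linarith
qed

text \<open>Degree one only admits the \<open>l^1\<close> bound and gives \<open>S\<^sup>2\<close>.
  Degrees two and three are orthogonal, and the sum of the squared weights is at most
  \<open>W\<^sup>2 / K\<close>; this is where the factor \<open>1 / K\<close> arises. The degree-two
  contribution \<open>S ^ 4 / K\<close> is absorbed by the two others. The constant is
  \<open>7 * 7 * 4620\<close>, for seven monomials.\<close>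

lemma triple_sum_second_moment:
  assumes K: "K \<ge> 1" and s: "\<And>j. j \<in> {1..K} \<Longrightarrow> 0 \<le> s j \<and> s j \<le> S"
    and cw: "\<And>p. p \<in> index_pairs K \<Longrightarrow> cmod (c p) \<le> w p"
    and W: "(\<Sum>p\<in>index_pairs K. w p) \<le> W" and wK: "\<And>p. p \<in> index_pairs K \<Longrightarrow> w p \<le> W / real K"
  shows "integrable (gauss_vec K) (\<lambda>t. (cmod (\<Sum>p\<in>index_pairs K. c p * triple s p t))\<^sup>2)" (is ?int)
    and "(\<integral>t. (cmod (\<Sum>p\<in>index_pairs K. c p * triple s p t))\<^sup>2 \<partial>gauss_vec K)
       \<le> 226380 * W\<^sup>2 * (S\<^sup>2 + S ^ 6 / real K)" (is ?le)
proof -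
  let ?I = "index_pairs K"
  have S0: "S \<ge> 0" using s[of 1] K by auto
  have w0: "w p \<ge> 0" if "p \<in> ?I" for p using cw[OF that] norm_ge_zero[of "c p"] by linarith
  have W0: "W \<ge> 0" using W sum_nonneg[of ?I w] w0 by force
  define E where "E = {(True, False, False), (False, True, False), (False, False, True), (True, True, False),
      (True, False, True), (False, True, True), (True, True, True)}"
  define g where "g e p = (case e of (x, y, z) \<Rightarrow> (if x then s (fst p + snd p) else 1) *
      (if y then s (fst p) else 1) * (if z then s (snd p) else 1))" for e and p :: "nat \<times> nat"
  define T where "T e t = (case e of (x, y, z) \<Rightarrow> \<Sum>p\<in>?I. (c p * complex_of_real (g e p)) * tri_mono x y z p t)" for e t
  have cE: "card E = 7" "finite E" unfolding E_def by auto
  have expand: "triple s p t = (\<Sum>e\<in>E. case e of (x, y, z) \<Rightarrow> complex_of_real (g e p) * tri_mono x y z p t)" for p t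
    unfolding E_def by (cases p) (simp add: triple_def tri_mono_def g_def algebra_simps)
  have tot: "(\<Sum>p\<in>?I. c p * triple s p t) = (\<Sum>e\<in>E. T e t)" for t
    unfolding expand sum_distrib_left T_def
    by (subst sum.swap) (auto intro!: sum.cong simp: case_prod_unfold sum_distrib_left mult.assoc)
  have sq: "(cmod (\<Sum>p\<in>?I. c p * triple s p t))\<^sup>2 \<le> 7 * (\<Sum>e\<in>E. (cmod (T e t))\<^sup>2)" for t
  proof -
    have "(cmod (\<Sum>e\<in>E. T e t))\<^sup>2 \<le> (\<Sum>e\<in>E. cmod (T e t))\<^sup>2" by (intro power_mono norm_sum) auto
    also have "\<dots> \<le> (\<Sum>e\<in>E. (cmod (T e t))\<^sup>2) * real (card E)" by (rule sum_squared_le_sum_of_squares)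
    finally show ?thesis by (simp add: tot cE mult.commute)
  qed
  have intT: "integrable (gauss_vec K) (\<lambda>t. (cmod (T e t))\<^sup>2)" for e
    by (cases e) (simp only: T_def prod.case tri_mono_sum_deg1)
  have gS: "0 \<le> g e p \<and> g e p \<le> S ^ (of_bool (fst e) + of_bool (fst (snd e)) + of_bool (snd (snd e)))" if p: "p \<in> ?I" for e p
  proof -
    obtain x y z where e: "e = (x, y, z)" by (metis surj_pair)
    have mem: "fst p + snd p \<in> {1..K}" "fst p \<in> {1..K}" "snd p \<in> {1..K}" using p by (auto simp: index_pairs_def)
    show ?thesis unfolding g_def e prod.case power_add fst_conv snd_conv
      using s[OF mem(1)] s[OF mem(2)] s[OF mem(3)] S0
      by (intro conjI mult_nonneg_nonneg mult_mono) auto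
  qed
  have boundT: "(\<integral>t. (cmod (T e t))\<^sup>2 \<partial>gauss_vec K) \<le> 4620 * W\<^sup>2 * (S\<^sup>2 + S ^ 6 / real K)" if e: "e \<in> E" for e
  proof -
    obtain x y z where xyz: "e = (x, y, z)" by (metis surj_pair)
    define n :: nat where "n = of_bool x + of_bool y + of_bool z"
    have d: "cmod (c p * complex_of_real (g e p)) \<le> w p * S ^ n" if "p \<in> ?I" for p
    proof -
      have "g e p \<le> S ^ n" "0 \<le> g e p" using gS[OF that, of e] by (simp_all add: xyz n_def)
      thus ?thesis using mult_mono[OF cw[OF that] \<open>g e p \<le> S ^ n\<close>] w0[OF that] by (simp add: norm_mult)
    qed
    show ?thesis
    proof (cases "(x \<and> y) \<or> (x \<and> z) \<or> (y \<and> z)")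
      case False
      hence n: "n = 1" using e by (auto simp: E_def xyz n_def)
      have "(\<Sum>p\<in>?I. cmod (c p * complex_of_real (g e p))) \<le> (\<Sum>p\<in>?I. w p * S)"
        using d n by (intro sum_mono) auto
      also have "\<dots> \<le> W * S" unfolding sum_distrib_right[symmetric] by (intro mult_right_mono W S0)
      finally have "(\<Sum>p\<in>?I. cmod (c p * complex_of_real (g e p)))\<^sup>2 \<le> (W * S)\<^sup>2"
        by (intro power_mono sum_nonneg) auto
      hence "(\<integral>t. (cmod (T e t))\<^sup>2 \<partial>gauss_vec K) \<le> 2310 * (W * S)\<^sup>2"
        using tri_mono_sum_deg1(2)[of K "\<lambda>p. c p * complex_of_real (g e p)" x y z]
        unfolding T_def xyz prod.case by linarith
      also have "\<dots> \<le> 4620 * W\<^sup>2 * S\<^sup>2" by (simp add: power_mult_distrib)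
      also have "\<dots> \<le> 4620 * W\<^sup>2 * (S\<^sup>2 + S ^ 6 / real K)" using S0 by (intro mult_left_mono) auto
      finally show ?thesis .
    next
      case True
      hence n: "n = 2 \<or> n = 3" by (auto simp: n_def)
      have "(\<Sum>p\<in>?I. (cmod (c p * complex_of_real (g e p)))\<^sup>2) \<le> (\<Sum>p\<in>?I. (W / real K) * w p * (S ^ n)\<^sup>2)"
      proof (intro sum_mono)
        fix p assume p: "p \<in> ?I"
        have "(cmod (c p * complex_of_real (g e p)))\<^sup>2 \<le> (w p * S ^ n)\<^sup>2" using d[OF p] by (intro power_mono) auto
        also have "\<dots> = w p * w p * (S ^ n)\<^sup>2" by (simp add: power2_eq_square)
        also have "\<dots> \<le> (W / real K) * w p * (S ^ n)\<^sup>2" using wK[OF p] w0[OF p] by (intro mult_right_mono) auto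
        finally show "(cmod (c p * complex_of_real (g e p)))\<^sup>2 \<le> (W / real K) * w p * (S ^ n)\<^sup>2" .
      qed
      also have "\<dots> = (W / real K) * (\<Sum>p\<in>?I. w p) * (S ^ n)\<^sup>2" by (simp only: sum_distrib_left sum_distrib_right)
      also have "\<dots> \<le> (W / real K) * W * (S ^ n)\<^sup>2" using W0 W by (intro mult_right_mono mult_left_mono) auto
      also have "(S ^ n)\<^sup>2 \<le> S\<^sup>2 + S ^ 6"
        using n pow4_le[OF S0] by (auto simp: power_mult[symmetric])
      finally have "(\<Sum>p\<in>?I. (cmod (c p * complex_of_real (g e p)))\<^sup>2) \<le> (W / real K) * W * (S\<^sup>2 + S ^ 6)"
        using W0 by (simp add: mult_left_mono divide_right_mono)
      also have "\<dots> = W\<^sup>2 * (S\<^sup>2 / real K + S ^ 6 / real K)" by (simp add: power2_eq_square add_divide_distrib algebra_simps)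
      also have "\<dots> \<le> W\<^sup>2 * (S\<^sup>2 + S ^ 6 / real K)"
        using K S0 by (intro mult_left_mono add_mono) (auto simp: divide_le_eq mult_le_cancel_left1)
      finally show ?thesis
        using tri_mono_sum_deg2[OF True, where K = K and d = "\<lambda>p. c p * complex_of_real (g e p)"]
        unfolding T_def xyz prod.case by linarith
    qed
  qed
  have i7: "integrable (gauss_vec K) (\<lambda>t. 7 * (\<Sum>e\<in>E. (cmod (T e t))\<^sup>2))"
    by (intro integrable_mult_right Bochner_Integration.integrable_sum intT)
  have meas: "(\<lambda>t. \<Sum>p\<in>?I. c p * triple s p t) \<in> borel_measurable (gauss_vec K)"
    by (intro borel_measurable_sum borel_measurable_times borel_measurable_const measurable_triple)
  show ?int
    by (rule Bochner_Integration.integrable_bound[OF i7]) (use meas in \<open>auto intro!: AE_I2 order.trans[OF sq]\<close>)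
  hence "(\<integral>t. (cmod (\<Sum>p\<in>?I. c p * triple s p t))\<^sup>2 \<partial>gauss_vec K) \<le> (\<integral>t. 7 * (\<Sum>e\<in>E. (cmod (T e t))\<^sup>2) \<partial>gauss_vec K)"
    by (intro integral_mono i7 sq)
  also have "\<dots> = 7 * (\<Sum>e\<in>E. \<integral>t. (cmod (T e t))\<^sup>2 \<partial>gauss_vec K)"
    by (simp add: Bochner_Integration.integral_sum intT)
  also have "\<dots> \<le> 7 * (\<Sum>e\<in>E. 4620 * W\<^sup>2 * (S\<^sup>2 + S ^ 6 / real K))" by (intro mult_left_mono sum_mono boundT) auto
  also have "\<dots> = 226380 * W\<^sup>2 * (S\<^sup>2 + S ^ 6 / real K)" by (simp add: cE)
  finally show ?le .
qed

section \<open>Fourth moments of the triple products\<close>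

text \<open>Expanding gives three terms of degree one, three of degree two and one of degree three
  in \<open>S * z\<close>; the middle degree is absorbed by the outer ones.\<close>

lemma triple_norm_le:
  assumes s: "\<And>j. j \<in> {k + l, k, l} \<Longrightarrow> 0 \<le> s j \<and> s j \<le> S"
    and z: "cmod (t (k + l)) \<le> z" "cmod (t k) \<le> z" "cmod (t l) \<le> z"
  shows "cmod (triple s (k, l) t) \<le> 5 * (S * z + (S * z) ^ 3)"
proof -
  have b: "cmod (complex_of_real (s j) * x) \<le> S * z" if "j \<in> {k + l, k, l}" "cmod x \<le> z" for j x
    using s[OF that(1)] that(2) by (auto simp: norm_mult intro!: mult_mono)
  define x y w where "x = s (k + l) * t (k + l)" and "y = s k * cnj (t k)" and "w = s l * cnj (t l)"
  define v where "v = S * z"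
  have n: "cmod x \<le> v" "cmod y \<le> v" "cmod w \<le> v" unfolding x_def y_def w_def v_def using z by (auto intro!: b)
  have v0: "v \<ge> 0" using n(1) norm_ge_zero[of x] by linarith
  have "triple s (k, l) t = x + y + w + x * y + x * w + y * w + x * y * w"
    by (simp add: triple_def x_def y_def w_def algebra_simps)
  also have "cmod \<dots> \<le> v + v + v + v * v + v * v + v * v + v * v * v"
    using v0 by (intro norm_triangle_mono n) (auto simp: norm_mult intro!: mult_mono n)
  also have "\<dots> \<le> 5 * (v + v ^ 3)"
  proof -
    have "0 \<le> v * (2 - 3 * v + 4 * v\<^sup>2)"
    proof (intro mult_nonneg_nonneg v0)
      have "0 \<le> (2 * v - 3 / 4)\<^sup>2" by simp
      thus "0 \<le> 2 - 3 * v + 4 * v\<^sup>2" by (simp add: power2_eq_square algebra_simps)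
    qed
    thus ?thesis by (simp add: power2_eq_square power3_eq_cube algebra_simps)
  qed
  finally show ?thesis by (simp add: v_def)
qed

lemma triple_fourth_moment:
  assumes p: "p \<in> index_pairs K" and s: "\<And>j. j \<in> {1..K} \<Longrightarrow> 0 \<le> s j \<and> s j \<le> S"
  shows "integrable (gauss_vec K) (\<lambda>t. (cmod (triple s p t)) ^ 4)"
    and "(\<integral>t. (cmod (triple s p t)) ^ 4 \<partial>gauss_vec K) \<le> 10 ^ 11 * (S\<^sup>2 + S ^ 6)\<^sup>2"
proof -
  obtain k l where kl: "p = (k, l)" by force
  have sub: "{k + l, k, l} \<subseteq> {1..K}" using p by (auto simp: kl index_pairs_def)
  have S0: "S \<ge> 0" using s[of k] sub by auto
  note [measurable] = p
  \<comment> \<open>\<open>5000 = 5 ^ 4 * 8\<close>, where 8 comes from the fourth power of a sum of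
    two terms, and \<open>2949120 = 4 ^ 6 * 6!\<close> bounds \<open>z ^ 12\<close> by an
    exponential.\<close>
  define C where "C = 5000 * 2949120 * (S ^ 4 + S ^ 12)"
  have le: "(cmod (triple s p t)) ^ 4 \<le> C * gexp p t" for t
  proof -
    obtain z where z: "z \<ge> 0" "cmod (t (k + l)) \<le> z" "cmod (t k) \<le> z" "cmod (t l) \<le> z" "exp (z\<^sup>2 / 4) \<le> gexp (k, l) t"
      by (rule gexp_max)
    define e where "e = exp (z\<^sup>2 / 4)"
    have e0: "e > 0" by (simp add: e_def)
    have "cmod (triple s p t) \<le> 5 * (S * z + (S * z) ^ 3)"
      unfolding kl using s sub z by (intro triple_norm_le) auto
    hence "(cmod (triple s p t)) ^ 4 \<le> (5 * (S * z + (S * z) ^ 3)) ^ 4" by (intro power_mono) auto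
    also have "\<dots> = 625 * (S * z + (S * z) ^ 3) ^ 4" unfolding power_mult_distrib[of 5] by simp
    also have "(S * z + (S * z) ^ 3) ^ 4 \<le> 8 * ((S * z) ^ 4 + ((S * z) ^ 3) ^ 4)"
    proof -
      have ab: "(x + y) ^ 4 \<le> 8 * (x ^ 4 + y ^ 4)" for x y :: real
      proof -
        have sq: "(u + v)\<^sup>2 \<le> 2 * (u\<^sup>2 + v\<^sup>2)" for u v :: real
          using sum_squares_bound[of u v] by (simp add: power2_sum)
        have "(x + y) ^ 4 = ((x + y)\<^sup>2)\<^sup>2" by simp
        also have "\<dots> \<le> (2 * (x\<^sup>2 + y\<^sup>2))\<^sup>2" by (intro power_mono sq) auto
        also have "\<dots> = 4 * (x\<^sup>2 + y\<^sup>2)\<^sup>2" unfolding power_mult_distrib[of 2] by simp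
        also have "\<dots> \<le> 4 * (2 * ((x\<^sup>2)\<^sup>2 + (y\<^sup>2)\<^sup>2))" by (intro mult_left_mono sq) auto
        finally show ?thesis by simp
      qed
      show ?thesis by (rule ab)
    qed
    also have "(S * z) ^ 4 + ((S * z) ^ 3) ^ 4 = S ^ 4 * z ^ 4 + S ^ 12 * z ^ 12"
      by (simp add: power_mult_distrib power_mult[symmetric])
    also have "\<dots> \<le> S ^ 4 * (2949120 * e) + S ^ 12 * (2949120 * e)"
    proof (intro add_mono mult_left_mono)
      have "z ^ 4 \<le> 32 * e" unfolding e_def
        using power_le_fact_exp[of "z\<^sup>2 / 4" 2] by (simp add: power_divide fact_numeral power_mult[symmetric])
      thus "z ^ 4 \<le> 2949120 * e" using e0 by linarith
      show "z ^ 12 \<le> 2949120 * e" unfolding e_def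
        using power_le_fact_exp[of "z\<^sup>2 / 4" 6] by (simp add: power_divide fact_numeral power_mult[symmetric])
    qed (use S0 in auto)
    also have "625 * (8 * (S ^ 4 * (2949120 * e) + S ^ 12 * (2949120 * e))) = C * e"
      by (simp add: C_def algebra_simps)
    also have "\<dots> \<le> C * gexp p t" using z(5) S0 by (intro mult_left_mono) (auto simp: e_def kl C_def)
    finally show ?thesis by simp
  qed
  have i: "integrable (gauss_vec K) (\<lambda>t. C * gexp p t)" using integral_gexp(1)[OF p] by simp
  show int: "integrable (gauss_vec K) (\<lambda>t. (cmod (triple s p t)) ^ 4)"
    by (rule Bochner_Integration.integrable_bound[OF i]) (auto intro!: AE_I2 order.trans[OF le])
  have "(\<integral>t. (cmod (triple s p t)) ^ 4 \<partial>gauss_vec K) \<le> (\<integral>t. C * gexp p t \<partial>gauss_vec K)"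
    by (intro integral_mono int i le)
  also have "\<dots> = 6 * C" using integral_gexp(2)[OF p] by simp
  also have "\<dots> \<le> 10 ^ 11 * (S ^ 4 + S ^ 12)" unfolding C_def using S0 by (simp add: mult_right_mono flip: mult.assoc)
  also have "\<dots> \<le> 10 ^ 11 * (S\<^sup>2 + S ^ 6)\<^sup>2"
    using S0 by (intro mult_left_mono) (auto simp: power2_sum power_mult[symmetric])
  finally show "(\<integral>t. (cmod (triple s p t)) ^ 4 \<partial>gauss_vec K) \<le> 10 ^ 11 * (S\<^sup>2 + S ^ 6)\<^sup>2" .
qed

subsection \<open>A smooth extension of the argument\<close>

text \<open>On the disc \<open>cmod z \<le> 1/2\<close> the function \<open>psi\<close> below is the argument of \<open>1 + z\<close>. Continuing the real
  part \<open>1 + x\<close> by \<open>eta\<close>, which is bounded away from \<open>0\<close> and has a Lipschitz derivative, extends it to a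
  bounded function on the plane with bounded Lipschitz gradient.\<close>

definition eta :: "real \<Rightarrow> real" where
  "eta x = (if x \<in> {-1/2..} then 1 + x else 1/4 + exp (4 * x + 2) / 4)"

definition eta' :: "real \<Rightarrow> real" where
  "eta' x = (if x \<in> {-1/2..} then 1 else exp (4 * x + 2))"

definition psi :: "complex \<Rightarrow> real" where
  "psi z = arctan (Im z / eta (Re z))"

text \<open>The modified \<open>1 + z\<close>. It stays in the half-plane of real part at least 1/4,
  and \<open>psi\<close> is its argument.\<close>

definition zeta :: "complex \<Rightarrow> complex" where
  "zeta z = Complex (eta (Re z)) (Im z)"

text \<open>The differential of \<open>psi\<close> at \<open>z\<close> is \<open>h \<mapsto> Re (psi_grad z * h)\<close>.\<close>

definition psi_grad :: "complex \<Rightarrow> complex" where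
  "psi_grad z = Complex (eta' (Re z) * Im (inverse (zeta z))) (- Re (inverse (zeta z)))"

lemma eta_ge: "eta x \<ge> 1/4"
  by (auto simp: eta_def)

text \<open>Both branches have value 1/2 and slope 1 at -1/2, so they fit together to first
  order.\<close>

lemma eta_deriv: "(eta has_real_derivative eta' x) (at x)"
proof -
  have cl: "closure {..<(-1/2::real)} = {..-1/2}" by simp
  have "((\<lambda>x. if x \<in> {-1/2..} then 1 + x else 1/4 + exp (4 * x + 2) / 4) has_vector_derivative
     (if x \<in> {-1/2..} then 1 else exp (4 * x + 2))) (at x within UNIV)"
  proof (rule has_vector_derivative_If_within_closures[where T = "{..<-1/2}"])
    show "((\<lambda>x. 1 + x) has_vector_derivative 1) (at x within {-1/2..} \<union> (closure {-1/2..} \<inter> closure {..<-1/2}))"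
      unfolding has_real_derivative_iff_has_vector_derivative[symmetric] by (auto intro!: derivative_eq_intros)
    show "((\<lambda>x. 1/4 + exp (4 * x + 2) / 4) has_vector_derivative exp (4 * x + 2))
        (at x within {..<-1/2} \<union> (closure {-1/2..} \<inter> closure {..<-1/2}))"
      unfolding has_real_derivative_iff_has_vector_derivative[symmetric] by (auto intro!: derivative_eq_intros)
  qed (auto simp: cl)
  thus ?thesis unfolding eta_def[abs_def] eta'_def has_real_derivative_iff_has_vector_derivative by simp
qed

lemma eta'_bounds: "0 \<le> eta' x" "eta' x \<le> 1"
  by (auto simp: eta'_def)

lemma eta_lipschitz: "\<bar>eta x - eta y\<bar> \<le> \<bar>x - y\<bar>"
proof -
  have "norm (eta x - eta y) \<le> 1 * norm (x - y)"
  proof (rule field_differentiable_bound[of UNIV])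
    show "(eta has_field_derivative eta' z) (at z within UNIV)" for z using eta_deriv by simp
    show "norm (eta' z) \<le> 1" for z using eta'_bounds[of z] by simp
  qed auto
  thus ?thesis by simp
qed

lemma eta'_lipschitz: "\<bar>eta' x - eta' y\<bar> \<le> 4 * \<bar>x - y\<bar>"
proof -
  have e1: "1 - exp v \<le> - v" for v :: real using exp_ge_add_one_self[of v] by linarith
  have e2: "\<bar>exp u - exp v\<bar> \<le> \<bar>u - v\<bar>" if "u \<le> 0" "v \<le> 0" for u v :: real
  proof -
    have *: "exp u - exp v \<le> u - v" if "v \<le> u" "u \<le> 0" for u v :: real
    proof -
      have "exp u - exp v = exp u * (1 - exp (v - u))" by (simp add: exp_diff right_diff_distrib)
      also have "\<dots> \<le> 1 * (u - v)" using that e1[of "v - u"] by (intro mult_mono) auto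
      finally show ?thesis by simp
    qed
    show ?thesis using *[of u v] *[of v u] that by (cases "u \<le> v") (auto simp: abs_if)
  qed
  show ?thesis
  proof (cases "x \<ge> -1/2"; cases "y \<ge> -1/2")
    assume "x \<ge> -1/2" "\<not> y \<ge> -1/2"
    thus ?thesis using e1[of "4 * y + 2"] by (simp add: eta'_def)
  next
    assume "\<not> x \<ge> -1/2" "y \<ge> -1/2"
    thus ?thesis using e1[of "4 * x + 2"] by (simp add: eta'_def abs_if)
  next
    assume "\<not> x \<ge> -1/2" "\<not> y \<ge> -1/2"
    moreover have "\<bar>(4 * x + 2) - (4 * y + 2)\<bar> = 4 * \<bar>x - y\<bar>" by (simp add: abs_if)
    ultimately show ?thesis using e2[of "4 * x + 2" "4 * y + 2"] by (simp add: eta'_def)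
  qed (auto simp: eta'_def)
qed

lemma zeta_norm_ge: "cmod (zeta z) \<ge> 1/4"
  using eta_ge[of "Re z"] complex_Re_le_cmod[of "zeta z"] by (simp add: zeta_def)

lemma zeta_nonzero: "zeta z \<noteq> 0"
  using zeta_norm_ge[of z] by auto

lemma zeta_inverse_bound: "cmod (inverse (zeta z)) \<le> 4"
  using le_imp_inverse_le[OF zeta_norm_ge[of z]] by (simp add: norm_inverse)

lemma zeta_inverse_lipschitz: "cmod (inverse (zeta a) - inverse (zeta b)) \<le> 32 * cmod (a - b)"
proof -
  have "inverse (zeta a) - inverse (zeta b) = inverse (zeta a) * (zeta b - zeta a) * inverse (zeta b)"
    using zeta_nonzero by (simp add: field_simps)
  hence eq: "cmod (inverse (zeta a) - inverse (zeta b)) = cmod (inverse (zeta a)) * cmod (zeta b - zeta a) * cmod (inverse (zeta b))"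
    by (simp add: norm_mult)
  have "cmod (zeta b - zeta a) \<le> \<bar>eta (Re b) - eta (Re a)\<bar> + \<bar>Im b - Im a\<bar>"
    using cmod_le[of "zeta b - zeta a"] by (simp add: zeta_def)
  also have "\<dots> \<le> cmod (b - a) + cmod (b - a)"
    using eta_lipschitz[of "Re b" "Re a"] abs_Re_le_cmod[of "b - a"] abs_Im_le_cmod[of "b - a"] by simp
  finally have "cmod (inverse (zeta a) - inverse (zeta b)) \<le> cmod (inverse (zeta a)) * (cmod (b - a) + cmod (b - a)) * cmod (inverse (zeta b))"
    unfolding eq by (intro mult_left_mono mult_right_mono) auto
  also have "\<dots> \<le> 4 * (cmod (b - a) + cmod (b - a)) * 4"
    by (intro mult_mono zeta_inverse_bound) auto
  finally show ?thesis by (simp add: norm_minus_commute)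
qed

lemma psi_grad_bound: "cmod (psi_grad z) \<le> 8"
proof -
  have "cmod (psi_grad z) \<le> \<bar>eta' (Re z) * Im (inverse (zeta z))\<bar> + \<bar>Re (inverse (zeta z))\<bar>"
    using cmod_le[of "psi_grad z"] by (simp add: psi_grad_def)
  also have "\<dots> \<le> 1 * 4 + 4"
    unfolding abs_mult using eta'_bounds[of "Re z"] zeta_inverse_bound[of z]
    by (intro add_mono mult_mono order.trans[OF abs_Im_le_cmod] order.trans[OF abs_Re_le_cmod]) auto
  finally show ?thesis by simp
qed

lemma psi_grad_lipschitz: "cmod (psi_grad a - psi_grad b) \<le> 80 * cmod (a - b)"
proof -
  define u v where "u = inverse (zeta a)" and "v = inverse (zeta b)"
  have "cmod (psi_grad a - psi_grad b) \<le> \<bar>eta' (Re a) * Im u - eta' (Re b) * Im v\<bar> + \<bar>Re u - Re v\<bar>"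
    using cmod_le[of "psi_grad a - psi_grad b"] by (simp add: psi_grad_def u_def v_def)
  also have "\<bar>Re u - Re v\<bar> \<le> 32 * cmod (a - b)"
    using abs_Re_le_cmod[of "u - v"] zeta_inverse_lipschitz[of a b] by (simp only: u_def v_def minus_complex.sel)
  also have "eta' (Re a) * Im u - eta' (Re b) * Im v = eta' (Re a) * (Im (u - v)) + (eta' (Re a) - eta' (Re b)) * Im v"
    by (simp add: algebra_simps)
  also have "\<bar>\<dots>\<bar> \<le> \<bar>eta' (Re a)\<bar> * \<bar>Im (u - v)\<bar> + \<bar>eta' (Re a) - eta' (Re b)\<bar> * \<bar>Im v\<bar>"
    unfolding abs_mult[symmetric] by (rule abs_triangle_ineq)
  also have "\<dots> \<le> 1 * (32 * cmod (a - b)) + (4 * cmod (a - b)) * 4"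
  proof (intro add_mono mult_mono)
    show "\<bar>Im (u - v)\<bar> \<le> 32 * cmod (a - b)" unfolding u_def v_def by (rule order.trans[OF abs_Im_le_cmod zeta_inverse_lipschitz])
    show "\<bar>Im v\<bar> \<le> 4" unfolding v_def by (rule order.trans[OF abs_Im_le_cmod zeta_inverse_bound])
    show "\<bar>eta' (Re a) - eta' (Re b)\<bar> \<le> 4 * cmod (a - b)"
      using eta'_lipschitz[of "Re a" "Re b"] abs_Re_le_cmod[of "a - b"] by simp
  qed (use eta'_bounds[of "Re a"] in auto)
  finally show ?thesis by simp
qed

text \<open>Differentiating along lines is enough: \<open>psi_taylor\<close> follows from the
  one-dimensional mean value theorem and the Lipschitz bound for \<open>psi_grad\<close>.\<close>

lemma psi_deriv_line:
  "((\<lambda>t. psi (a + of_real t * h)) has_real_derivative Re (psi_grad (a + of_real t * h) * h)) (at t)"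
proof -
  define e where "e = eta (Re a + t * Re h)"
  define y where "y = Im a + t * Im h"
  have e0: "e > 0" using eta_ge[of "Re a + t * Re h"] by (simp add: e_def)
  have de: "((\<lambda>t. eta (Re a + t * Re h)) has_real_derivative eta' (Re a + t * Re h) * Re h) (at t)"
    by (rule DERIV_chain2[OF eta_deriv]) (auto intro!: derivative_eq_intros)
  have dy: "((\<lambda>t. Im a + t * Im h) has_real_derivative Im h) (at t)" by (auto intro!: derivative_eq_intros)
  have q: "((\<lambda>t. arctan ((Im a + t * Im h) / eta (Re a + t * Re h))) has_real_derivative
      inverse (1 + (y / e)\<^sup>2) * ((Im h * e - y * (eta' (Re a + t * Re h) * Re h)) / (e * e))) (at t)"
    unfolding e_def y_def
    by (rule DERIV_chain2[OF DERIV_arctan DERIV_divide[OF dy de]]) (use e0 in \<open>simp add: e_def\<close>)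
  have z: "zeta (a + of_real t * h) = Complex e y" by (simp add: zeta_def e_def y_def)
  have "Re (psi_grad (a + of_real t * h) * h) = (Im h * e - y * (eta' (Re a + t * Re h) * Re h)) / (e * e + y * y)"
    unfolding psi_grad_def z by (simp add: power2_eq_square diff_divide_distrib algebra_simps)
  also have "\<dots> = inverse (1 + (y / e)\<^sup>2) * ((Im h * e - y * (eta' (Re a + t * Re h) * Re h)) / (e * e))"
  proof -
    have "1 + (y / e)\<^sup>2 = (e * e + y * y) / (e * e)" using e0 by (simp add: field_simps power2_eq_square)
    thus ?thesis using e0 by simp
  qed
  finally show ?thesis using q by (simp add: psi_def)
qed

lemma psi_taylor: "\<bar>psi (a + h) - psi a - Re (psi_grad a * h)\<bar> \<le> 80 * (cmod h)\<^sup>2"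
proof -
  have "\<exists>z. 0 < z \<and> z < 1 \<and> psi (a + of_real 1 * h) - psi (a + of_real 0 * h) = (1 - 0) * Re (psi_grad (a + of_real z * h) * h)"
    by (rule MVT2[OF zero_less_one psi_deriv_line])
  then obtain z where z: "0 < z" "z < 1" "psi (a + h) - psi a = Re (psi_grad (a + of_real z * h) * h)" by auto
  have "\<bar>psi (a + h) - psi a - Re (psi_grad a * h)\<bar> = \<bar>Re ((psi_grad (a + of_real z * h) - psi_grad a) * h)\<bar>"
    unfolding z(3) by (simp add: algebra_simps)
  also have "\<dots> \<le> cmod (psi_grad (a + of_real z * h) - psi_grad a) * cmod h"
    unfolding norm_mult[symmetric] by (rule abs_Re_le_cmod)
  also have "\<dots> \<le> (80 * cmod (a + of_real z * h - a)) * cmod h"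
    by (intro mult_right_mono psi_grad_lipschitz) auto
  also have "\<dots> = 80 * z * (cmod h)\<^sup>2" using z by (simp add: norm_mult power2_eq_square)
  also have "\<dots> \<le> 80 * (cmod h)\<^sup>2" using z by (intro mult_right_mono) auto
  finally show ?thesis .
qed

lemma psi_bound: "\<bar>psi z\<bar> \<le> 2"
  using arctan_bounded[of "Im z / eta (Re z)"] pi_less_4 unfolding psi_def by linarith

lemma psi_cnj: "psi (cnj z) = - psi z"
  by (simp add: psi_def arctan_minus)

lemma borel_measurable_psi [measurable]: "psi \<in> borel_measurable borel"
proof -
  have "continuous_on UNIV eta"
    by (rule continuous_at_imp_continuous_on) (auto intro: DERIV_isCont[OF eta_deriv])
  hence [measurable]: "eta \<in> borel_measurable borel" by (rule borel_measurable_continuous_onI)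
  show ?thesis unfolding psi_def[abs_def] by measurable
qed

text \<open>Seen from the origin, the disc of radius 1/2 about 1 has half opening angle
  \<open>arcsin (1/2) = pi / 6\<close>.\<close>

lemma psi_eq_Arg:
  assumes "cmod z \<le> 1/2"
  shows "psi z = Arg (1 + z)" "\<bar>psi z\<bar> \<le> pi / 6"
proof -
  have re: "Re z \<ge> -1/2" using assms abs_Re_le_cmod[of z] by linarith
  show "psi z = Arg (1 + z)" using re by (simp add: psi_def eta_def arg_conv_arctan)
  have s: "(Re z)\<^sup>2 + (Im z)\<^sup>2 \<le> 1/4" using power_mono[OF assms norm_ge_zero, of 2] by (simp add: cmod_def power_divide)
  have "3 * (Im z)\<^sup>2 \<le> (1 + Re z)\<^sup>2"
  proof -
    have "0 \<le> (2 * Re z + 1 / 2)\<^sup>2" by simp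
    thus ?thesis using s by (simp add: power2_eq_square algebra_simps)
  qed
  hence "sqrt (3 * (Im z)\<^sup>2) \<le> sqrt ((1 + Re z)\<^sup>2)" by (rule real_sqrt_le_mono)
  hence "sqrt 3 * \<bar>Im z\<bar> \<le> 1 + Re z" using re by (simp add: real_sqrt_mult)
  hence "\<bar>Im z / eta (Re z)\<bar> \<le> 1 / sqrt 3" using re by (simp add: eta_def field_simps)
  hence "Im z / eta (Re z) \<le> 1 / sqrt 3" "- (1 / sqrt 3) \<le> Im z / eta (Re z)" by linarith+
  hence "psi z \<le> arctan (1 / sqrt 3)" "arctan (- (1 / sqrt 3)) \<le> psi z"
    unfolding psi_def by (simp_all only: arctan_le_iff)
  moreover have "arctan (1 / sqrt 3) = pi / 6" using arctan_tan[of "pi / 6"] by (simp add: tan_30)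
  ultimately show "\<bar>psi z\<bar> \<le> pi / 6" by (simp add: arctan_minus)
qed

subsection \<open>Second moment of the phase error\<close>

text \<open>The relative error X of \<open>B_hat\<close> at \<open>p\<close> from the overview, as a
  function of the noise in the frame of the signal.\<close>

definition triple_mean :: "(nat \<Rightarrow> real) \<Rightarrow> nat \<Rightarrow> nat \<times> nat \<Rightarrow> (nat \<Rightarrow> nat \<Rightarrow> complex) \<Rightarrow> complex" where
  "triple_mean s N p x = (\<Sum>m=1..N. triple s p (x m)) / of_nat N"

lemma measurable_triple_mean [measurable]:
  assumes "p \<in> index_pairs K"
  shows "triple_mean s N p \<in> borel_measurable (gauss_sample K N)"
  unfolding triple_mean_def[abs_def]
  by (intro borel_measurable_divide borel_measurable_sum borel_measurable_const
        measurable_compose[OF gauss_sample_component measurable_triple[OF assms]])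

lemma triple_cnj:
  assumes "p \<in> index_pairs K"
  shows "triple s p (\<lambda>k\<in>{1..K}. cnj (t k)) = cnj (triple s p t)"
  using assms by (cases p) (auto simp: triple_def index_pairs_def)

lemma triple_zero:
  assumes "p \<in> index_pairs K"
  shows "triple s p (\<lambda>k\<in>{1..K}. 0) = 0"
  using assms by (cases p) (auto simp: triple_def index_pairs_def)

text \<open>Conjugating all noise coordinates preserves their law and conjugates every triple mean,
  since the coefficients \<open>s\<close> are real.\<close>

lemma integral_triple_mean_odd:
  fixes f :: "(nat \<times> nat \<Rightarrow> complex) \<Rightarrow> real"
  assumes meas: "(\<lambda>x. f (\<lambda>p\<in>index_pairs K. triple_mean s N p x)) \<in> borel_measurable (gauss_sample K N)"
    and odd: "\<And>v. f (\<lambda>p\<in>index_pairs K. cnj (v p)) = - f (\<lambda>p\<in>index_pairs K. v p)"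
  shows "(\<integral>x. f (\<lambda>p\<in>index_pairs K. triple_mean s N p x) \<partial>gauss_sample K N) = 0"
proof -
  define h where "h t = (\<lambda>k\<in>{1..K}. cnj (t k))" for t :: "nat \<Rightarrow> complex"
  note hm = gauss_vec_map[of K "\<lambda>_. cnj", OF borel_measurable_cnj distr_cgauss_cnj]
  have h: "h \<in> gauss_vec K \<rightarrow>\<^sub>M gauss_vec K" "distr (gauss_vec K) (gauss_vec K) h = gauss_vec K"
    using hm unfolding h_def[abs_def] by auto
  let ?H = "\<lambda>x. \<lambda>m\<in>{1..N}. h (x m)"
  have H: "?H \<in> gauss_sample K N \<rightarrow>\<^sub>M gauss_sample K N"
    unfolding gauss_sample_def
    by (intro measurable_restrict) (rule measurable_compose[OF measurable_component_singleton], assumption, rule h)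
  have d: "distr (gauss_sample K N) (gauss_sample K N) ?H = gauss_sample K N"
    unfolding gauss_sample_def by (rule distr_PiM_map[OF _ prob_space_gauss_vec prob_space_gauss_vec h]) auto
  have c: "triple_mean s N p (?H x) = cnj (triple_mean s N p x)" if "p \<in> index_pairs K" for p x
    using triple_cnj[OF that, of s] by (simp add: triple_mean_def h_def cnj_sum)
  have e: "(\<lambda>p\<in>index_pairs K. triple_mean s N p (?H x)) = (\<lambda>p\<in>index_pairs K. cnj (triple_mean s N p x))" for x
    by (intro restrict_ext c)
  let ?f = "\<lambda>x. f (\<lambda>p\<in>index_pairs K. triple_mean s N p x)"
  have "(\<integral>x. ?f x \<partial>distr (gauss_sample K N) (gauss_sample K N) ?H) = (\<integral>x. ?f (?H x) \<partial>gauss_sample K N)"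
    by (rule integral_distr[OF H meas])
  hence "(\<integral>x. ?f x \<partial>gauss_sample K N) = (\<integral>x. ?f (?H x) \<partial>gauss_sample K N)" unfolding d .
  also have "\<dots> = (\<integral>x. - ?f x \<partial>gauss_sample K N)" unfolding e odd ..
  finally show ?thesis by simp
qed

text \<open>The increment of a sample is linear in that sample up to a quadratic error, so the Efron--Stein
  bound reduces to the second moment of a linear combination of the products \<open>triple\<close>.\<close>

lemma phase_noise_increment:
  assumes K: "K \<ge> 1" and N: "N \<ge> 1" and s: "\<And>j. j \<in> {1..K} \<Longrightarrow> 0 \<le> s j \<and> s j \<le> S"
    and W: "(\<Sum>p\<in>index_pairs K. \<bar>w p\<bar>) \<le> W" and wK: "\<And>p. p \<in> index_pairs K \<Longrightarrow> \<bar>w p\<bar> \<le> W / real K"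
  shows "(\<integral>y. (\<Sum>p\<in>index_pairs K. w p * (psi (A p + triple s p y / of_nat N) - psi (A p)))\<^sup>2 \<partial>gauss_vec K)
     \<le> W\<^sup>2 * (3 * 10 ^ 7 * (S\<^sup>2 + S ^ 6 / real K) / (real N)\<^sup>2 + 2 * 10 ^ 15 * (S\<^sup>2 + S ^ 6)\<^sup>2 / real N ^ 4)"
proof -
  let ?I = "index_pairs K"
  have W0: "W \<ge> 0" by (rule order.trans[OF sum_nonneg W]) auto
  have S0: "S \<ge> 0" using s[of 1] K by auto
  have N0: "real N > 0" using N by simp
  define c where "c p = of_real (w p) * psi_grad (A p)" for p
  define L where "L y = (cmod (\<Sum>p\<in>?I. c p * triple s p y))\<^sup>2" for y
  define Q where "Q y = (\<Sum>p\<in>?I. \<bar>w p\<bar> * (cmod (triple s p y)) ^ 4)" for y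
  define G where "G y = (\<Sum>p\<in>?I. w p * (psi (A p + triple s p y / of_nat N) - psi (A p)))" for y
  have cw: "cmod (c p) \<le> 8 * \<bar>w p\<bar>" for p
    using psi_grad_bound[of "A p"] by (auto simp: c_def norm_mult mult.commute[of 8] intro!: mult_left_mono)
  have W8: "(\<Sum>p\<in>?I. 8 * \<bar>w p\<bar>) \<le> 8 * W" using W by (simp add: sum_distrib_left[symmetric])
  have w8: "8 * \<bar>w p\<bar> \<le> 8 * W / real K" if "p \<in> ?I" for p using wK[OF that] by simp
  have L: "integrable (gauss_vec K) L" "(\<integral>y. L y \<partial>gauss_vec K) \<le> 226380 * (8 * W)\<^sup>2 * (S\<^sup>2 + S ^ 6 / real K)"
    unfolding L_def[abs_def] by (rule triple_sum_second_moment[OF K s cw W8 w8]; assumption)+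
  have fm: "integrable (gauss_vec K) (\<lambda>y. (cmod (triple s p y)) ^ 4)" if "p \<in> ?I" for p
    by (rule triple_fourth_moment(1)[OF that s])
  have Q: "integrable (gauss_vec K) Q"
    unfolding Q_def[abs_def] by (intro Bochner_Integration.integrable_sum integrable_mult_right fm)
  have Qb: "(\<integral>y. Q y \<partial>gauss_vec K) \<le> W * (10 ^ 11 * (S\<^sup>2 + S ^ 6)\<^sup>2)"
  proof -
    have "(\<integral>y. Q y \<partial>gauss_vec K) = (\<Sum>p\<in>?I. \<bar>w p\<bar> * (\<integral>y. (cmod (triple s p y)) ^ 4 \<partial>gauss_vec K))"
      unfolding Q_def by (subst Bochner_Integration.integral_sum) (simp_all add: fm)
    also have "\<dots> \<le> (\<Sum>p\<in>?I. \<bar>w p\<bar> * (10 ^ 11 * (S\<^sup>2 + S ^ 6)\<^sup>2))"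
      by (intro sum_mono mult_left_mono triple_fourth_moment(2)[where S = S] s) auto
    also have "\<dots> \<le> W * (10 ^ 11 * (S\<^sup>2 + S ^ 6)\<^sup>2)"
      unfolding sum_distrib_right[symmetric] by (intro mult_right_mono W) auto
    finally show ?thesis .
  qed
  \<comment> \<open>The pointwise majorant of the squared increment. \<open>L\<close> comes from the
    linear part, and 12800 is twice the square of the Taylor constant 80; the square of the
    quadratic remainder is reduced to \<open>W * Q y\<close> by weighted Cauchy--Schwarz.\<close>
  define U where "U y = 2 / (real N)\<^sup>2 * L y + 12800 * W / real N ^ 4 * Q y" for y
  have U: "integrable (gauss_vec K) U" unfolding U_def[abs_def] by (intro Bochner_Integration.integrable_add integrable_mult_right L Q)
  have le: "(G y)\<^sup>2 \<le> U y" for y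
  proof -
    define h where "h p = triple s p y / of_nat N" for p
    define q where "q = (\<Sum>p\<in>?I. \<bar>w p\<bar> * (cmod (triple s p y))\<^sup>2)"
    have "G y = (\<Sum>p\<in>?I. Re (c p * h p)) + (\<Sum>p\<in>?I. w p * (psi (A p + h p) - psi (A p) - Re (psi_grad (A p) * h p)))"
      unfolding G_def sum.distrib[symmetric] by (intro sum.cong refl) (simp add: c_def h_def algebra_simps)
    also have "(\<Sum>p\<in>?I. Re (c p * h p)) = Re (\<Sum>p\<in>?I. c p * triple s p y) / real N"
      by (simp add: h_def sum_divide_distrib diff_divide_distrib)
    finally have "\<bar>G y\<bar> \<le> \<bar>Re (\<Sum>p\<in>?I. c p * triple s p y) / real N\<bar> +
        \<bar>\<Sum>p\<in>?I. w p * (psi (A p + h p) - psi (A p) - Re (psi_grad (A p) * h p))\<bar>" by (simp only: abs_triangle_ineq)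
    also have "\<bar>Re (\<Sum>p\<in>?I. c p * triple s p y) / real N\<bar> \<le> cmod (\<Sum>p\<in>?I. c p * triple s p y) / real N"
      unfolding abs_divide abs_of_nat by (intro divide_right_mono abs_Re_le_cmod) simp
    also have "\<bar>\<Sum>p\<in>?I. w p * (psi (A p + h p) - psi (A p) - Re (psi_grad (A p) * h p))\<bar> \<le> (\<Sum>p\<in>?I. \<bar>w p\<bar> * (80 * (cmod (h p))\<^sup>2))"
      by (rule order.trans[OF sum_abs], intro sum_mono, subst abs_mult, intro mult_left_mono psi_taylor) simp
    also have "\<dots> = 80 / (real N)\<^sup>2 * q"
      unfolding q_def sum_distrib_left by (intro sum.cong refl) (simp add: h_def norm_divide power_divide)
    finally have "\<bar>G y\<bar>\<^sup>2 \<le> (cmod (\<Sum>p\<in>?I. c p * triple s p y) / real N + 80 / (real N)\<^sup>2 * q)\<^sup>2"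
      by (intro power_mono) auto
    also have "\<dots> \<le> 2 * (cmod (\<Sum>p\<in>?I. c p * triple s p y) / real N)\<^sup>2 + 2 * (80 / (real N)\<^sup>2 * q)\<^sup>2"
      using sum_squares_bound[of "cmod (\<Sum>p\<in>?I. c p * triple s p y) / real N" "80 / (real N)\<^sup>2 * q"]
      unfolding power2_sum by linarith
    also have "\<dots> = 2 / (real N)\<^sup>2 * L y + 12800 / real N ^ 4 * q\<^sup>2"
      unfolding L_def by (simp add: power_divide power_mult_distrib power_mult[symmetric])
    also have "q\<^sup>2 \<le> W * Q y"
    proof -
      have "q\<^sup>2 = (cmod (\<Sum>p\<in>?I. complex_of_real \<bar>w p\<bar> * complex_of_real ((cmod (triple s p y))\<^sup>2)))\<^sup>2"
        unfolding q_def of_real_mult[symmetric] of_real_sum[symmetric] by (simp only: norm_of_real power2_abs)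
      also have "\<dots> \<le> (\<Sum>p\<in>?I. cmod (complex_of_real \<bar>w p\<bar>)) *
          (\<Sum>p\<in>?I. cmod (complex_of_real \<bar>w p\<bar>) * (cmod (complex_of_real ((cmod (triple s p y))\<^sup>2)))\<^sup>2)"
        by (rule norm_sum_sq_le)
      also have "\<dots> = (\<Sum>p\<in>?I. \<bar>w p\<bar>) * Q y"
        unfolding Q_def by (simp only: norm_of_real abs_abs power2_abs power_mult[symmetric] abs_power2) simp
      also have "\<dots> \<le> W * Q y" using W by (intro mult_right_mono) (auto simp: Q_def intro!: sum_nonneg)
      finally show ?thesis .
    qed
    finally show ?thesis using N0 by (simp add: U_def mult_left_mono divide_right_mono mult_ac)
  qed
  have alg: "2 / n * (226380 * (8 * W)\<^sup>2 * X) + 12800 * W / n' * (W * (10 ^ 11 * Y)) =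
      W\<^sup>2 * (28976640 * X / n + 1280000000000000 * Y / n')" for X Y n n' :: real
    by (simp add: power2_eq_square algebra_simps)
  have U0: "U y \<ge> 0" for y using order.trans[OF zero_le_power2 le] .
  have "(\<integral>y. (G y)\<^sup>2 \<partial>gauss_vec K) \<le> (\<integral>y. U y \<partial>gauss_vec K)"
    using U le U0 by (intro integral_mono') auto
  also have "\<dots> = 2 / (real N)\<^sup>2 * (\<integral>y. L y \<partial>gauss_vec K) + 12800 * W / real N ^ 4 * (\<integral>y. Q y \<partial>gauss_vec K)"
    unfolding U_def using L(1) Q by simp
  also have "\<dots> \<le> 2 / (real N)\<^sup>2 * (226380 * (8 * W)\<^sup>2 * (S\<^sup>2 + S ^ 6 / real K)) +
     12800 * W / real N ^ 4 * (W * (10 ^ 11 * (S\<^sup>2 + S ^ 6)\<^sup>2))"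
    using W0 by (intro add_mono mult_left_mono L(2) Qb) auto
  also have "\<dots> = W\<^sup>2 * (28976640 * (S\<^sup>2 + S ^ 6 / real K) / (real N)\<^sup>2 + 1280000000000000 * (S\<^sup>2 + S ^ 6)\<^sup>2 / real N ^ 4)"
    by (rule alg)
  also have "\<dots> \<le> W\<^sup>2 * (3 * 10 ^ 7 * (S\<^sup>2 + S ^ 6 / real K) / (real N)\<^sup>2 + 2 * 10 ^ 15 * (S\<^sup>2 + S ^ 6)\<^sup>2 / real N ^ 4)"
    using S0 by (intro mult_left_mono add_mono divide_right_mono mult_right_mono) auto
  finally show ?thesis unfolding G_def .
qed

text \<open>With a row of the pseudo-inverse as \<open>w\<close>, this is the phase error of one
  block on the good event, up to multiples of \<open>2 * pi\<close> and the orbit shift.\<close>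

definition phase_noise :: "(nat \<times> nat \<Rightarrow> real) \<Rightarrow> (nat \<Rightarrow> real) \<Rightarrow> nat \<Rightarrow> nat \<Rightarrow> (nat \<Rightarrow> nat \<Rightarrow> complex) \<Rightarrow> real" where
  "phase_noise w s K N x = (\<Sum>p\<in>index_pairs K. w p * psi (triple_mean s N p x))"

lemma measurable_phase_noise [measurable]: "phase_noise w s K N \<in> borel_measurable (gauss_sample K N)"
  unfolding phase_noise_def[abs_def]
  by (intro borel_measurable_sum borel_measurable_times borel_measurable_const
        measurable_compose[OF measurable_triple_mean borel_measurable_psi])

text \<open>The mean is zero because \<open>psi\<close> is odd under conjugation, so the second
  moment is the variance and Efron--Stein applies. Each of the \<open>N\<close> increments
  contributes at most \<open>D\<close>.\<close>

lemma phase_noise_second_moment: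
  assumes K: "K \<ge> 1" and N: "N \<ge> 1" and s: "\<And>j. j \<in> {1..K} \<Longrightarrow> 0 \<le> s j \<and> s j \<le> S"
    and W: "(\<Sum>p\<in>index_pairs K. \<bar>w p\<bar>) \<le> W" and wK: "\<And>p. p \<in> index_pairs K \<Longrightarrow> \<bar>w p\<bar> \<le> W / real K"
    and SN: "S ^ 6 \<le> real N"
  shows "(\<integral>x. (phase_noise w s K N x)\<^sup>2 \<partial>gauss_sample K N) \<le> 10 ^ 16 * W\<^sup>2 * (S\<^sup>2 / real N + S ^ 6 / (real N * real K))"
proof -
  let ?I = "index_pairs K" and ?O = "gauss_sample K N"
  define F where "F = phase_noise w s K N"
  \<comment> \<open>The noiseless sample. \<open>triple\<close> vanishes there, so replacing sample
    \<open>m\<close> by \<open>a\<close> just deletes its contribution.\<close>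
  define a :: "nat \<Rightarrow> complex" where "a = (\<lambda>k\<in>{1..K}. 0)"
  have S0: "S \<ge> 0" using s[of 1] K by auto
  have N0: "real N \<ge> 1" using N by simp
  have a: "a \<in> space (gauss_vec K)" unfolding a_def gauss_vec_def by (auto simp: space_PiM)
  have FB: "\<bar>F x\<bar> \<le> 2 * W" for x
  proof -
    have "\<bar>F x\<bar> \<le> (\<Sum>p\<in>?I. \<bar>w p\<bar> * 2)"
      unfolding F_def phase_noise_def
      by (rule order.trans[OF sum_abs]) (auto intro!: sum_mono mult_left_mono psi_bound simp: abs_mult)
    thus ?thesis using W by (simp add: sum_distrib_right[symmetric])
  qed
  have zero: "(\<integral>x. F x \<partial>?O) = 0"
  proof -
    define f where "f v = (\<Sum>p\<in>?I. w p * psi (v p))" for v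
    have e: "F x = f (\<lambda>p\<in>?I. triple_mean s N p x)" for x
      unfolding F_def f_def phase_noise_def by (intro sum.cong) auto
    have "(\<integral>x. f (\<lambda>p\<in>?I. triple_mean s N p x) \<partial>?O) = 0"
    proof (rule integral_triple_mean_odd)
      show "(\<lambda>x. f (\<lambda>p\<in>?I. triple_mean s N p x)) \<in> borel_measurable ?O"
        unfolding e[symmetric] F_def by (rule measurable_phase_noise)
      show "f (\<lambda>p\<in>?I. cnj (v p)) = - f (\<lambda>p\<in>?I. v p)" for v
        unfolding f_def by (simp add: psi_cnj sum_negf)
    qed
    thus ?thesis unfolding e .
  qed
  define D where "D = W\<^sup>2 * (3 * 10 ^ 7 * (S\<^sup>2 + S ^ 6 / real K) / (real N)\<^sup>2 + 2 * 10 ^ 15 * (S\<^sup>2 + S ^ 6)\<^sup>2 / real N ^ 4)"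
  have D0: "D \<ge> 0" unfolding D_def using S0 by simp
  have inc: "(\<integral>x. (F x - F (x(m := a)))\<^sup>2 \<partial>?O) \<le> D" if m: "m \<in> {1..N}" for m
  proof -
    define J where "J = {1..N} - {m}"
    have J: "finite J" "m \<notin> J" "insert m J = {1..N}" using m by (auto simp: J_def)
    interpret product_prob_space "\<lambda>_::nat. gauss_vec K" J by (simp add: prob_space_gauss_vec product_prob_spaceI)
    interpret O: prob_space ?O by (rule prob_space_gauss_sample)
    have pj: "measure (PiM J (\<lambda>_. gauss_vec K)) (space (PiM J (\<lambda>_. gauss_vec K))) = 1"
      by (intro prob_space.prob_space prob_space_PiM prob_space_gauss_vec)
    let ?g = "\<lambda>x. (F x - F (x(m := a)))\<^sup>2"
    have upd: "(\<lambda>x. x(m := a)) \<in> ?O \<rightarrow>\<^sub>M ?O"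
      unfolding gauss_sample_def using m a by (intro measurable_fun_upd[where J = "{1..N}"]) auto
    have Fm: "F \<in> borel_measurable ?O" unfolding F_def by (rule measurable_phase_noise)
    have Fu: "(\<lambda>x. F (x(m := a))) \<in> borel_measurable ?O" by (rule measurable_compose[OF upd Fm])
    have gb: "?g x \<le> (4 * W)\<^sup>2" for x
      using FB[of x] FB[of "x(m := a)"] by (subst abs_le_square_iff[symmetric]) linarith
    have gi: "integrable ?O ?g"
      using gb Fm Fu by (intro O.integrable_const_bound[of _ "(4 * W)\<^sup>2"]) auto
    have split: "(\<integral>x. ?g x \<partial>?O) = (\<integral>x. (\<integral>y. ?g (x(m := y)) \<partial>gauss_vec K) \<partial>PiM J (\<lambda>_. gauss_vec K))"
      using product_integral_insert[OF J(1,2), of ?g] gi unfolding J(3) gauss_sample_def by blast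
    have inner: "(\<integral>y. ?g (x(m := y)) \<partial>gauss_vec K) \<le> D" for x
    proof -
      define A where "A p = triple_mean s N p (x(m := a))" for p
      have tm: "triple_mean s N p (x(m := y)) = A p + triple s p y / of_nat N" if p: "p \<in> ?I" for p y
      proof -
        have e: "(\<Sum>i=1..N. triple s p ((x(m := z)) i)) = triple s p z + (\<Sum>i\<in>J. triple s p (x i))" for z
        proof -
          have "(\<Sum>i=1..N. triple s p ((x(m := z)) i)) = (\<Sum>i\<in>insert m J. triple s p ((x(m := z)) i))"
            by (simp only: J(3))
          also have "\<dots> = triple s p z + (\<Sum>i\<in>J. triple s p ((x(m := z)) i))"
            using J by (subst sum.insert) auto
          also have "(\<Sum>i\<in>J. triple s p ((x(m := z)) i)) = (\<Sum>i\<in>J. triple s p (x i))"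
            using J by (intro sum.cong) auto
          finally show ?thesis .
        qed
        show ?thesis unfolding A_def triple_mean_def e using triple_zero[OF p, of s]
          by (simp add: a_def add_divide_distrib)
      qed
      have "F (x(m := y)) - F ((x(m := y))(m := a)) = (\<Sum>p\<in>?I. w p * (psi (A p + triple s p y / of_nat N) - psi (A p)))" for y
        unfolding F_def phase_noise_def sum_subtractf[symmetric]
        by (intro sum.cong refl) (simp add: tm A_def[symmetric] right_diff_distrib)
      thus ?thesis unfolding D_def
        using phase_noise_increment[OF K N s W wK, where A = A] by (simp only:)
    qed
    show ?thesis unfolding split
    \<comment> \<open>The integral of a non-integrable function is 0 by convention, so
      \<open>D0\<close> settles that case.\<close>
    proof (cases "integrable (PiM J (\<lambda>_. gauss_vec K)) (\<lambda>x. \<integral>y. ?g (x(m := y)) \<partial>gauss_vec K)")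
      case True
      hence "(\<integral>x. (\<integral>y. ?g (x(m := y)) \<partial>gauss_vec K) \<partial>PiM J (\<lambda>_. gauss_vec K)) \<le> (\<integral>x. D \<partial>PiM J (\<lambda>_. gauss_vec K))"
        using inner by (intro integral_mono) auto
      thus "(\<integral>x. (\<integral>y. ?g (x(m := y)) \<partial>gauss_vec K) \<partial>PiM J (\<lambda>_. gauss_vec K)) \<le> D"
        by (simp add: pj)
    next
      case False
      thus "(\<integral>x. (\<integral>y. ?g (x(m := y)) \<partial>gauss_vec K) \<partial>PiM J (\<lambda>_. gauss_vec K)) \<le> D"
        using D0 by (simp add: not_integrable_integral_eq)
    qed
  qed
  have "(\<integral>x. (F x)\<^sup>2 \<partial>?O) - (\<integral>x. F x \<partial>?O)\<^sup>2 \<le> (\<Sum>m\<in>{1..N}. \<integral>x. (F x - F (x(m := a)))\<^sup>2 \<partial>?O)"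
    unfolding gauss_sample_def
    by (rule efron_stein[OF _ prob_space_gauss_vec a _ FB])
       (use measurable_phase_noise in \<open>auto simp: F_def gauss_sample_def\<close>)
  also have "\<dots> \<le> (\<Sum>m\<in>{1..N}. D)" by (intro sum_mono inc)
  also have "\<dots> = real N * D" by simp
  also have "\<dots> = W\<^sup>2 * (3 * 10 ^ 7 * (S\<^sup>2 + S ^ 6 / real K) / real N + 2 * 10 ^ 15 * (S\<^sup>2 + S ^ 6)\<^sup>2 / real N ^ 3)"
    unfolding D_def using N0 by (simp add: power2_eq_square power3_eq_cube power4_eq_xxxx field_simps)
  also have "\<dots> \<le> W\<^sup>2 * (3 * 10 ^ 7 * (S\<^sup>2 / real N + S ^ 6 / (real N * real K)) + 2 * 10 ^ 15 * (4 * (S\<^sup>2 / real N)))"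
  proof (intro mult_left_mono add_mono)
    \<comment> \<open>Here \<open>S ^ 6 \<le> N\<close> absorbs the Taylor remainder: it gives
      \<open>S\<^sup>2 + S ^ 6 \<le> 2 * S * N\<close>, whose square divided by \<open>N ^ 3\<close>
      is of order \<open>S\<^sup>2 / N\<close>.\<close>
    have "S \<le> real N \<and> S ^ 5 \<le> real N"
    proof (cases "S \<le> 1")
      case True
      thus ?thesis using N0 power_le_one[OF S0 True, of 5] by linarith
    next
      case False
      hence "S ^ 1 \<le> S ^ 6" "S ^ 5 \<le> S ^ 6" by (intro power_increasing; simp)+
      thus ?thesis using SN by simp
    qed
    hence "S * S \<le> S * real N" "S * S ^ 5 \<le> S * real N" using S0 by (auto intro: mult_left_mono)
    hence "S\<^sup>2 + S ^ 6 \<le> 2 * (S * real N)" by (simp add: power2_eq_square power_numeral_reduce)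
    hence "(S\<^sup>2 + S ^ 6)\<^sup>2 \<le> (2 * (S * real N))\<^sup>2" using S0 by (intro power_mono) auto
    hence "(S\<^sup>2 + S ^ 6)\<^sup>2 / real N ^ 3 \<le> (2 * (S * real N))\<^sup>2 / real N ^ 3" by (intro divide_right_mono) auto
    also have "\<dots> = 4 * (S\<^sup>2 / real N)" using N0 by (simp add: power2_eq_square power3_eq_cube)
    finally show "2 * 10 ^ 15 * (S\<^sup>2 + S ^ 6)\<^sup>2 / real N ^ 3 \<le> 2 * 10 ^ 15 * (4 * (S\<^sup>2 / real N))"
      by simp
  qed (auto simp: add_divide_distrib mult.commute)
  also have "\<dots> \<le> W\<^sup>2 * (10 ^ 16 * (S\<^sup>2 / real N + S ^ 6 / (real N * real K)))"
    using S0 N0 by (intro mult_left_mono) (auto simp: distrib_left intro!: add_mono divide_right_mono mult_right_mono)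
  finally have "(\<integral>x. (F x)\<^sup>2 \<partial>?O) \<le> W\<^sup>2 * (10 ^ 16 * (S\<^sup>2 / real N + S ^ 6 / (real N * real K)))"
    unfolding zero zero_power2 diff_zero .
  thus ?thesis unfolding F_def by (simp only: mult_ac)
qed

subsection \<open>Large deviations of the triple means\<close>

text \<open>Truncating the modulus of each coordinate yields exponential moments and respects rotations, so
  that the truncated products still have mean zero.\<close>

definition trunc :: "real \<Rightarrow> complex \<Rightarrow> complex" where
  "trunc \<rho> z = (if cmod z \<le> \<rho> then z else 0)"

definition trunc_triple :: "real \<Rightarrow> (nat \<Rightarrow> real) \<Rightarrow> nat \<times> nat \<Rightarrow> (nat \<Rightarrow> complex) \<Rightarrow> complex" where
  "trunc_triple \<rho> s p t = triple s p (\<lambda>j. trunc \<rho> (t j))"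

lemma borel_measurable_trunc [measurable]: "trunc \<rho> \<in> borel_measurable borel"
  unfolding trunc_def[abs_def] by measurable

lemma measurable_trunc_triple [measurable]:
  assumes "p \<in> index_pairs K" shows "trunc_triple \<rho> s p \<in> borel_measurable (gauss_vec K)"
proof -
  obtain k l where p: "p = (k, l)" by force
  have [measurable]: "k + l \<in> {1..K}" "k \<in> {1..K}" "l \<in> {1..K}" using assms by (auto simp: p index_pairs_def)
  note [measurable] = gauss_vec_component[of "k + l" K] gauss_vec_component[of k K] gauss_vec_component[of l K]
  show ?thesis unfolding trunc_triple_def[abs_def] triple_def p prod.case by measurable
qed

text \<open>One number \<open>z\<close> serves three purposes: it is capped by the truncation level,
  controls the triple product, and has its Gaussian weight dominated by \<open>gexp\<close>. The
  moment generating function needs all three at once.\<close>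

lemma trunc_triple_norm_le:
  assumes p: "(k, l) \<in> index_pairs K" and s: "\<And>j. j \<in> {1..K} \<Longrightarrow> 0 \<le> s j \<and> s j \<le> S" and \<rho>: "\<rho> \<ge> 0"
  obtains z where "0 \<le> z" "z \<le> \<rho>" "exp (z\<^sup>2 / 4) \<le> gexp (k, l) t"
    "cmod (trunc_triple \<rho> s (k, l) t) \<le> 5 * (S * z + (S * z) ^ 3)"
proof -
  let ?t = "\<lambda>j. trunc \<rho> (t j)"
  obtain z where z: "z \<ge> 0" "cmod (?t (k + l)) \<le> z" "cmod (?t k) \<le> z" "cmod (?t l) \<le> z" "exp (z\<^sup>2 / 4) \<le> gexp (k, l) ?t"
    "z \<in> {cmod (?t (k + l)), cmod (?t k), cmod (?t l)}" by (rule gexp_max)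
  have tr: "cmod (trunc \<rho> x) \<le> \<rho>" "(cmod (trunc \<rho> x))\<^sup>2 \<le> (cmod x)\<^sup>2" for x using \<rho> by (auto simp: trunc_def)
  have "gexp (k, l) ?t \<le> gexp (k, l) t" unfolding gexp_def prod.case by (intro add_mono) (auto simp: tr(2))
  moreover have "z \<le> \<rho>" using z(6) tr(1) by auto
  moreover have "cmod (trunc_triple \<rho> s (k, l) t) \<le> 5 * (S * z + (S * z) ^ 3)"
    unfolding trunc_triple_def using p z by (intro triple_norm_le s) (auto simp: index_pairs_def)
  ultimately show ?thesis using that[of z] z by linarith
qed

lemma trunc_triple_bounded:
  assumes p: "p \<in> index_pairs K" and s: "\<And>j. j \<in> {1..K} \<Longrightarrow> 0 \<le> s j \<and> s j \<le> S" and \<rho>: "\<rho> \<ge> 0"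
  obtains B where "\<And>t. cmod (trunc_triple \<rho> s p t) \<le> B"
proof -
  obtain k l where kl: "p = (k, l)" by force
  have S0: "S \<ge> 0" using s[of k] p by (auto simp: kl index_pairs_def)
  have "cmod (trunc_triple \<rho> s p t) \<le> 5 * (S * \<rho> + (S * \<rho>) ^ 3)" for t
  proof -
    obtain z where z: "0 \<le> z" "z \<le> \<rho>" "cmod (trunc_triple \<rho> s (k, l) t) \<le> 5 * (S * z + (S * z) ^ 3)"
      using trunc_triple_norm_le[where s = s and S = S and t = t, OF p[unfolded kl] s \<rho>] by blast
    have "5 * (S * z + (S * z) ^ 3) \<le> 5 * (S * \<rho> + (S * \<rho>) ^ 3)"
      using z S0 by (intro mult_left_mono add_mono power_mono) auto
    thus ?thesis using z by (simp add: kl)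
  qed
  thus ?thesis by (rule that)
qed

text \<open>Rotating the three coordinates so that all factors turn by the same power of \<open>\<i>\<close> and summing
  over the four powers annihilates every monomial of degree one, two or three.\<close>

lemma integral_trunc_triple:
  assumes p: "p \<in> index_pairs K" and s: "\<And>j. j \<in> {1..K} \<Longrightarrow> 0 \<le> s j \<and> s j \<le> S" and \<rho>: "\<rho> \<ge> 0"
  shows "integrable (gauss_vec K) (trunc_triple \<rho> s p)" "(\<integral>t. trunc_triple \<rho> s p t \<partial>gauss_vec K) = 0"
proof -
  obtain k l where kl: "p = (k, l)" by force
  have mem: "k + l \<in> {1..K}" "k \<in> {1..K}" "l \<in> {1..K}" "k \<noteq> k + l" "l \<noteq> k + l"
    using p by (auto simp: kl index_pairs_def)
  interpret prob_space "gauss_vec K" by (rule prob_space_gauss_vec)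
  note m = measurable_trunc_triple[OF p, of \<rho> s]
  obtain B where B: "\<And>t. cmod (trunc_triple \<rho> s p t) \<le> B" using trunc_triple_bounded[where s = s and S = S, OF p s \<rho>] by blast
  show int: "integrable (gauss_vec K) (trunc_triple \<rho> s p)"
    by (rule integrable_const_bound[of _ B]) (use B m in auto)
  \<comment> \<open>Coordinates \<open>k\<close> and \<open>l\<close> enter conjugated and therefore
    turn by \<open>cnj u\<close>. This stays consistent for \<open>k = l\<close>, and
    \<open>k + l\<close> differs from both.\<close>
  define h where "h u j = (\<lambda>z::complex. (if j = k + l then u else if j = k \<or> j = l then cnj u else 1) * z)" for u j
  define R where "R u t = (\<lambda>j\<in>{1..K}. h u j (t j))" for u and t :: "nat \<Rightarrow> complex"
  have rot: "(\<integral>t. trunc_triple \<rho> s p (R u t) \<partial>gauss_vec K) = (\<integral>t. trunc_triple \<rho> s p t \<partial>gauss_vec K)"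
    "integrable (gauss_vec K) (\<lambda>t. trunc_triple \<rho> s p (R u t))"
    if u: "cmod u = 1" for u
  proof -
    have hm: "h u j \<in> borel_measurable borel" for j unfolding h_def by measurable
    have hd: "distr cgauss borel (h u j) = cgauss" for j unfolding h_def by (rule distr_cgauss_mult) (simp add: u)
    show "(\<integral>t. trunc_triple \<rho> s p (R u t) \<partial>gauss_vec K) = (\<integral>t. trunc_triple \<rho> s p t \<partial>gauss_vec K)"
      unfolding R_def by (rule integral_gauss_vec_map[OF hm hd m])
    have Rm: "R u \<in> gauss_vec K \<rightarrow>\<^sub>M gauss_vec K" unfolding R_def[abs_def] by (rule gauss_vec_map(1)[OF hm hd])
    show "integrable (gauss_vec K) (\<lambda>t. trunc_triple \<rho> s p (R u t))"
      by (rule integrable_const_bound[of _ B]) (use B measurable_compose[OF Rm m] in auto)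
  qed
  have tr: "trunc \<rho> (u * z) = u * trunc \<rho> z" if "cmod u = 1" for u z
    using that by (simp add: trunc_def norm_mult)
  define x y w where "x t = s (k + l) * trunc \<rho> (t (k + l))" and "y t = s k * cnj (trunc \<rho> (t k))" and "w t = s l * cnj (trunc \<rho> (t l))"
    for t :: "nat \<Rightarrow> complex"
  have val: "trunc_triple \<rho> s p (R u t) = (1 + u * x t) * (1 + u * y t) * (1 + u * w t) - 1" if u: "cmod u = 1" for u t
  proof -
    have R: "R u t (k + l) = u * t (k + l)" "R u t k = cnj u * t k" "R u t l = cnj u * t l"
      using mem by (auto simp: R_def h_def)
    have c: "cmod (cnj u) = 1" using u by simp
    show ?thesis
      unfolding trunc_triple_def triple_def kl prod.case R tr[OF u] tr[OF c] x_def y_def w_def by (simp add: mult_ac)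
  qed
  have ring: "((1 + x) * (1 + y) * (1 + w) - 1) + ((1 + \<i> * x) * (1 + \<i> * y) * (1 + \<i> * w) - 1) +
    ((1 + (-1) * x) * (1 + (-1) * y) * (1 + (-1) * w) - 1) + ((1 + (-\<i>) * x) * (1 + (-\<i>) * y) * (1 + (-\<i>) * w) - 1) = 0"
    for x y w :: complex by (simp add: algebra_simps)
  have "4 * (\<integral>t. trunc_triple \<rho> s p t \<partial>gauss_vec K) =
     (\<integral>t. trunc_triple \<rho> s p (R 1 t) \<partial>gauss_vec K) + (\<integral>t. trunc_triple \<rho> s p (R \<i> t) \<partial>gauss_vec K) +
     (\<integral>t. trunc_triple \<rho> s p (R (-1) t) \<partial>gauss_vec K) + (\<integral>t. trunc_triple \<rho> s p (R (-\<i>) t) \<partial>gauss_vec K)"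
    by (simp add: rot)
  also have "\<dots> = (\<integral>t. trunc_triple \<rho> s p (R 1 t) + trunc_triple \<rho> s p (R \<i> t) +
      trunc_triple \<rho> s p (R (-1) t) + trunc_triple \<rho> s p (R (-\<i>) t) \<partial>gauss_vec K)"
    using rot(2)[of 1] rot(2)[of \<i>] rot(2)[of "-1"] rot(2)[of "-\<i>"] by simp
  also have "\<dots> = (\<integral>t. 0 \<partial>gauss_vec K)"
    using ring by (intro Bochner_Integration.integral_cong refl) (simp add: val)
  finally show "(\<integral>t. trunc_triple \<rho> s p t \<partial>gauss_vec K) = 0" by simp
qed

lemma exp_le_quadratic: "exp x \<le> 1 + x + x\<^sup>2 * exp \<bar>x\<bar>" for x :: real
proof -
  obtain t where t: "\<bar>t\<bar> \<le> \<bar>x\<bar>" "exp x = (\<Sum>m<2. (x ^ m) / fact m) + (exp t / fact 2) * x ^ 2"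
    using Maclaurin_exp_le[of x 2] by blast
  have "exp t / 2 \<le> exp \<bar>x\<bar>" using t(1) exp_le_cancel_iff[of t "\<bar>x\<bar>"] exp_gt_zero[of t] by linarith
  hence "(exp t / 2) * x\<^sup>2 \<le> exp \<bar>x\<bar> * x\<^sup>2" by (intro mult_right_mono) auto
  thus ?thesis unfolding t(2) by (simp add: numeral_2_eq_2 mult.commute)
qed

text \<open>Centring kills the linear term of the exponential. In the remainder the exponent is at
  most \<open>z\<^sup>2 / 8\<close> plus a constant, which leaves another
  \<open>z\<^sup>2 / 8\<close> of the available weight \<open>z\<^sup>2 / 4\<close> for the
  polynomial factor.\<close>

lemma trunc_triple_mgf:
  assumes p: "p \<in> index_pairs K" and s: "\<And>j. j \<in> {1..K} \<Longrightarrow> 0 \<le> s j \<and> s j \<le> S"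
    and \<rho>: "\<rho> \<ge> 0" and \<mu>: "\<mu> \<ge> 0" "80 * \<mu> * S ^ 3 * \<rho> \<le> 1" and u: "cmod u = 1"
  shows "integrable (gauss_vec K) (\<lambda>t. exp (\<mu> * Re (u * trunc_triple \<rho> s p t)))"
    and "(\<integral>t. exp (\<mu> * Re (u * trunc_triple \<rho> s p t)) \<partial>gauss_vec K) \<le> exp (2 * (10 ^ 6 * (S\<^sup>2 + S ^ 6) * \<mu>\<^sup>2))"
proof -
  obtain k l where kl: "p = (k, l)" by force
  have S0: "S \<ge> 0" using s[of k] p by (auto simp: kl index_pairs_def)
  interpret prob_space "gauss_vec K" by (rule prob_space_gauss_vec)
  note m [measurable] = measurable_trunc_triple[OF p, of \<rho> s]
  obtain B where B: "\<And>t. cmod (trunc_triple \<rho> s p t) \<le> B" using trunc_triple_bounded[where s = s and S = S, OF p s \<rho>] by blast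
  define X where "X t = \<mu> * Re (u * trunc_triple \<rho> s p t)" for t
  have Xb: "\<bar>X t\<bar> \<le> \<mu> * cmod (trunc_triple \<rho> s p t)" for t
  proof -
    have "\<bar>Re (u * trunc_triple \<rho> s p t)\<bar> \<le> cmod (trunc_triple \<rho> s p t)"
      using abs_Re_le_cmod[of "u * trunc_triple \<rho> s p t"] u by (simp only: norm_mult mult_1)
    thus ?thesis using \<mu> by (auto simp: X_def abs_mult intro!: mult_left_mono)
  qed
  have XB: "X t \<le> \<mu> * B" for t using Xb[of t] mult_left_mono[OF B[of t] \<mu>(1)] by linarith
  have Xm [measurable]: "X \<in> borel_measurable (gauss_vec K)" unfolding X_def[abs_def] by measurable
  show int: "integrable (gauss_vec K) (\<lambda>t. exp (\<mu> * Re (u * trunc_triple \<rho> s p t)))"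
    unfolding X_def[symmetric] by (rule integrable_const_bound[of _ "exp (\<mu> * B)"]) (use XB in auto)
  have X0: "(\<integral>t. X t \<partial>gauss_vec K) = 0" "integrable (gauss_vec K) X"
  proof -
    have i: "integrable (gauss_vec K) (\<lambda>t. u * trunc_triple \<rho> s p t)"
      using integral_trunc_triple(1)[OF p s \<rho>] by simp
    show "integrable (gauss_vec K) X" unfolding X_def[abs_def] by (intro integrable_mult_right integrable_Re i)
    have "(\<integral>t. X t \<partial>gauss_vec K) = \<mu> * Re (\<integral>t. u * trunc_triple \<rho> s p t \<partial>gauss_vec K)"
      unfolding X_def by (simp only: integral_mult_right_zero integral_Re[OF i])
    thus "(\<integral>t. X t \<partial>gauss_vec K) = 0" using integral_trunc_triple(2)[OF p s \<rho>] by simp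
  qed
  define V where "V = S\<^sup>2 + S ^ 6"
  define y where "y = 10 ^ 6 * V * \<mu>\<^sup>2"
  have V0: "V \<ge> 0" unfolding V_def using S0 by simp
  have y0: "y \<ge> 0" unfolding y_def using V0 by simp
  \<comment> \<open>\<open>153600 = 25 * 2 * 3072\<close> with \<open>3072 = 8 ^ 3 * 3!\<close>; six
    times it stays below the factor \<open>10 ^ 6\<close> in \<open>y\<close>.\<close>
  define C where "C = 153600 * V * \<mu>\<^sup>2 * exp y"
  have C0: "C \<ge> 0" unfolding C_def using V0 by simp
  have main: "(X t)\<^sup>2 * exp \<bar>X t\<bar> \<le> C * gexp p t" for t
  proof -
    obtain z where z: "0 \<le> z" "z \<le> \<rho>" "exp (z\<^sup>2 / 4) \<le> gexp (k, l) t"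
        "cmod (trunc_triple \<rho> s (k, l) t) \<le> 5 * (S * z + (S * z) ^ 3)"
      using trunc_triple_norm_le[where s = s and S = S and t = t, OF p[unfolded kl] s \<rho>] by blast
    have X1: "\<bar>X t\<bar> \<le> \<mu> * (5 * (S * z + (S * z) ^ 3))"
      using Xb[of t] mult_left_mono[OF z(4) \<mu>(1)] by (simp only: kl)
    \<comment> \<open>This is the only use of truncation: \<open>z \<le> \<rho>\<close> trades one
      factor of the cubic term for a constant, leaving a multiple of
      \<open>z\<^sup>2\<close>.\<close>
    have "16 * (\<mu> * (5 * (S * z) ^ 3)) = (80 * \<mu> * S ^ 3 * z) * z\<^sup>2" by (simp add: power2_eq_square power3_eq_cube)
    also have "\<dots> \<le> 1 * z\<^sup>2"
    proof (rule mult_right_mono)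
      have "80 * \<mu> * S ^ 3 * z \<le> 80 * \<mu> * S ^ 3 * \<rho>" using z \<mu> S0 by (intro mult_left_mono) auto
      thus "80 * \<mu> * S ^ 3 * z \<le> 1" using \<mu> by linarith
    qed simp
    finally have b1: "\<mu> * (5 * (S * z) ^ 3) \<le> z\<^sup>2 / 16" by simp
    have b2: "\<mu> * (5 * (S * z)) \<le> z\<^sup>2 / 16 + 100 * \<mu>\<^sup>2 * S\<^sup>2"
      using sum_squares_bound[of "z / 4" "10 * (\<mu> * S)"] by (simp add: power_divide power_mult_distrib mult_ac)
    have "100 * \<mu>\<^sup>2 * S\<^sup>2 \<le> y" unfolding y_def V_def
    proof -
      have "100 * \<mu>\<^sup>2 * S\<^sup>2 \<le> 10 ^ 6 * \<mu>\<^sup>2 * (S\<^sup>2 + S ^ 6)" using S0 by (intro mult_mono) auto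
      thus "100 * \<mu>\<^sup>2 * S\<^sup>2 \<le> 10 ^ 6 * (S\<^sup>2 + S ^ 6) * \<mu>\<^sup>2" by (simp only: mult_ac)
    qed
    hence "\<bar>X t\<bar> \<le> z\<^sup>2 / 8 + y" using X1 b1 b2 by (simp add: distrib_left)
    hence e1: "exp \<bar>X t\<bar> \<le> exp (z\<^sup>2 / 8) * exp y" by (simp add: exp_add[symmetric])
    have "(X t)\<^sup>2 \<le> (\<mu> * (5 * (S * z + (S * z) ^ 3)))\<^sup>2"
      using power_mono[OF X1 abs_ge_zero, of 2] by simp
    also have "\<dots> = 25 * \<mu>\<^sup>2 * (S * z + (S * z) ^ 3)\<^sup>2" by (simp add: power_mult_distrib del: distrib_left_numeral)
    also have "\<dots> \<le> 25 * \<mu>\<^sup>2 * (2 * (S\<^sup>2 * z\<^sup>2) + 2 * (S ^ 6 * z ^ 6))"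
    proof (intro mult_left_mono)
      have "(S * z + (S * z) ^ 3)\<^sup>2 \<le> 2 * (S * z)\<^sup>2 + 2 * ((S * z) ^ 3)\<^sup>2"
        using sum_squares_bound[of "S * z" "(S * z) ^ 3"] unfolding power2_sum by linarith
      thus "(S * z + (S * z) ^ 3)\<^sup>2 \<le> 2 * (S\<^sup>2 * z\<^sup>2) + 2 * (S ^ 6 * z ^ 6)"
        by (simp add: power_mult_distrib power_mult[symmetric])
    qed simp
    also have "\<dots> \<le> 25 * \<mu>\<^sup>2 * (2 * (S\<^sup>2 * (3072 * exp (z\<^sup>2 / 8))) + 2 * (S ^ 6 * (3072 * exp (z\<^sup>2 / 8))))"
    proof (intro mult_left_mono add_mono)
      have "z\<^sup>2 \<le> 8 * exp (z\<^sup>2 / 8)" using power_le_fact_exp[of "z\<^sup>2 / 8" 1] by simp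
      thus "z\<^sup>2 \<le> 3072 * exp (z\<^sup>2 / 8)" using exp_gt_zero[of "z\<^sup>2 / 8"] by linarith
      show "z ^ 6 \<le> 3072 * exp (z\<^sup>2 / 8)"
        using power_le_fact_exp[of "z\<^sup>2 / 8" 3] by (simp add: power_divide fact_numeral power_mult[symmetric])
    qed (use S0 in auto)
    also have "\<dots> = 153600 * V * \<mu>\<^sup>2 * exp (z\<^sup>2 / 8)" by (simp add: V_def algebra_simps)
    finally have e2: "(X t)\<^sup>2 \<le> 153600 * V * \<mu>\<^sup>2 * exp (z\<^sup>2 / 8)" .
    have "(X t)\<^sup>2 * exp \<bar>X t\<bar> \<le> (153600 * V * \<mu>\<^sup>2 * exp (z\<^sup>2 / 8)) * (exp (z\<^sup>2 / 8) * exp y)"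
      using V0 by (intro mult_mono e1 e2) auto
    also have "\<dots> = C * (exp (z\<^sup>2 / 8) * exp (z\<^sup>2 / 8))" by (simp add: C_def)
    also have "exp (z\<^sup>2 / 8) * exp (z\<^sup>2 / 8) = exp (z\<^sup>2 / 4)" by (simp add: exp_add[symmetric])
    also have "C * exp (z\<^sup>2 / 4) \<le> C * gexp p t" using z C0 by (intro mult_left_mono) (auto simp: kl)
    finally show ?thesis .
  qed
  have "(\<integral>t. exp (X t) \<partial>gauss_vec K) \<le> (\<integral>t. 1 + X t + C * gexp p t \<partial>gauss_vec K)"
  proof (rule integral_mono)
    show "integrable (gauss_vec K) (\<lambda>t. exp (X t))" using int by (simp add: X_def)
    show "integrable (gauss_vec K) (\<lambda>t. 1 + X t + C * gexp p t)" using X0(2) integral_gexp(1)[OF p] by simp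
    show "exp (X t) \<le> 1 + X t + C * gexp p t" for t using exp_le_quadratic[of "X t"] main[of t] by linarith
  qed
  also have "\<dots> = 1 + 6 * C" using X0 integral_gexp[OF p] by (simp add: prob_space)
  also have "\<dots> \<le> 1 + y * exp y" unfolding C_def y_def using V0 by (simp add: mult_right_mono)
  also have "\<dots> \<le> exp y + y * exp y" using y0 by simp
  also have "\<dots> = (1 + y) * exp y" by (simp add: algebra_simps)
  also have "\<dots> \<le> exp y * exp y" by (intro mult_right_mono) (auto simp: exp_ge_add_one_self)
  also have "\<dots> = exp (2 * y)" by (simp add: exp_add[symmetric])
  finally show "(\<integral>t. exp (\<mu> * Re (u * trunc_triple \<rho> s p t)) \<partial>gauss_vec K) \<le> exp (2 * (10 ^ 6 * (S\<^sup>2 + S ^ 6) * \<mu>\<^sup>2))"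
    unfolding X_def y_def V_def .
qed

text \<open>Chernoff bound. The third condition on \<open>\<mu>\<close> makes the quadratic term at
  most \<open>\<mu> * N / 8\<close>, half of the linear gain \<open>\<mu> * N / 4\<close>.\<close>

lemma trunc_mean_tail:
  assumes N: "N \<ge> 1" and p: "p \<in> index_pairs K" and s: "\<And>j. j \<in> {1..K} \<Longrightarrow> 0 \<le> s j \<and> s j \<le> S"
    and \<rho>: "\<rho> \<ge> 0" and \<mu>: "\<mu> \<ge> 0" "80 * \<mu> * S ^ 3 * \<rho> \<le> 1" "16 * (10 ^ 6 * (S\<^sup>2 + S ^ 6)) * \<mu> \<le> 1"
    and u: "cmod u = 1"
  shows "measure (gauss_sample K N) {x \<in> space (gauss_sample K N).
      real N / 4 \<le> (\<Sum>m=1..N. Re (u * trunc_triple \<rho> s p (x m)))} \<le> exp (- (\<mu> * real N / 8))"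
proof -
  let ?O = "gauss_sample K N"
  interpret product_prob_space "\<lambda>_::nat. gauss_vec K" "{1..N}" by (simp add: prob_space_gauss_vec product_prob_spaceI)
  define V where "V = 10 ^ 6 * (S\<^sup>2 + S ^ 6)"
  define g where "g t = exp (\<mu> * Re (u * trunc_triple \<rho> s p t))" for t
  have g: "integrable (gauss_vec K) g" "(\<integral>t. g t \<partial>gauss_vec K) \<le> exp (2 * (V * \<mu>\<^sup>2))"
    unfolding g_def[abs_def] V_def by (rule trunc_triple_mgf[OF p s \<rho> \<mu>(1,2) u]; assumption)+
  define G where "G x = (\<Prod>m\<in>{1..N}. g (x m))" for x
  have G: "integrable ?O G" "(\<integral>x. G x \<partial>?O) = (\<integral>t. g t \<partial>gauss_vec K) ^ N"
    unfolding G_def[abs_def] gauss_sample_def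
    using product_integrable_prod[of "{1..N}" "\<lambda>_. g"] product_integral_prod[of "{1..N}" "\<lambda>_. g"] g(1) by simp_all
  have Gexp: "G x = exp (\<mu> * (\<Sum>m=1..N. Re (u * trunc_triple \<rho> s p (x m))))" for x
    unfolding G_def g_def sum_distrib_left by (simp add: exp_sum)
  have G0: "G x \<ge> 0" for x by (simp add: Gexp)
  define c where "c = exp (\<mu> * (real N / 4))"
  have sub: "{x \<in> space ?O. real N / 4 \<le> (\<Sum>m=1..N. Re (u * trunc_triple \<rho> s p (x m)))} \<subseteq> {x \<in> space ?O. c \<le> G x}"
    unfolding Gexp c_def exp_le_cancel_iff using \<mu>(1) by (blast intro: mult_left_mono)
  interpret O: prob_space ?O by (rule prob_space_gauss_sample)
  have [measurable]: "G \<in> borel_measurable ?O" using G(1) by (rule borel_measurable_integrable)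
  have "measure ?O {x \<in> space ?O. real N / 4 \<le> (\<Sum>m=1..N. Re (u * trunc_triple \<rho> s p (x m)))} \<le> measure ?O {x \<in> space ?O. c \<le> G x}"
    by (intro O.finite_measure_mono sub) measurable
  also have "\<dots> \<le> (\<integral>x. G x \<partial>?O) / c"
    by (rule integral_Markov_inequality_measure[OF G(1) sets.top]) (auto simp: G0 c_def)
  also have "\<dots> \<le> exp (2 * (V * \<mu>\<^sup>2)) ^ N / c"
    unfolding G(2) by (intro divide_right_mono power_mono g(2) integral_nonneg) (auto simp: g_def c_def)
  also have "\<dots> = exp (real N * (2 * (V * \<mu>\<^sup>2)) - \<mu> * (real N / 4))"
    unfolding c_def exp_diff exp_of_nat_mult by simp
  also have "\<dots> \<le> exp (- (\<mu> * real N / 8))"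
  proof -
    have "(16 * V * \<mu>) * \<mu> \<le> 1 * \<mu>" using \<mu> by (intro mult_right_mono) (auto simp: V_def)
    hence "2 * (V * \<mu>\<^sup>2) \<le> \<mu> / 8" by (simp add: power2_eq_square)
    hence "real N * (2 * (V * \<mu>\<^sup>2)) \<le> real N * (\<mu> / 8)" by (intro mult_left_mono) auto
    thus ?thesis by (simp add: mult.commute)
  qed
  finally show ?thesis .
qed

lemma cgauss_tail:
  assumes "\<rho> \<ge> 0" and k: "k \<in> {1..K}" and m: "m \<in> {1..N}"
  shows "measure (gauss_sample K N) {x \<in> space (gauss_sample K N). \<rho> < cmod (x m k)} \<le> 2 * exp (- \<rho>\<^sup>2 / 4)"
proof -
  let ?O = "gauss_sample K N"
  interpret O: prob_space ?O by (rule prob_space_gauss_sample)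
  have comp: "(\<lambda>x. x m) \<in> ?O \<rightarrow>\<^sub>M gauss_vec K" by (rule gauss_sample_component[OF m])
  have d: "distr ?O (gauss_vec K) (\<lambda>x. x m) = gauss_vec K"
    unfolding gauss_sample_def by (rule distr_PiM_component[OF prob_space_gauss_vec m])
  define f where "f z = exp ((cmod z)\<^sup>2 / 4)" for z
  have fb [measurable]: "f \<in> borel_measurable borel" unfolding f_def[abs_def] by measurable
  have fk: "(\<lambda>t. f (t k)) \<in> borel_measurable (gauss_vec K)"
    by (rule measurable_compose[OF gauss_vec_component[OF k] fb])
  have i1: "integrable (gauss_vec K) (\<lambda>t. f (t k))" "(\<integral>t. f (t k) \<partial>gauss_vec K) = 2"
    using integral_gauss_vec_component[OF k fb] integral_cgauss_exp unfolding f_def by auto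
  have i2: "integrable ?O (\<lambda>x. f (x m k))" using integrable_distr_eq[OF comp fk] i1 unfolding d by simp
  have i3: "(\<integral>x. f (x m k) \<partial>?O) = 2" using integral_distr[OF comp fk] i1 unfolding d by simp
  have mk [measurable]: "(\<lambda>x. f (x m k)) \<in> borel_measurable ?O" using i2 by (rule borel_measurable_integrable)
  have "measure ?O {x \<in> space ?O. \<rho> < cmod (x m k)} \<le> measure ?O {x \<in> space ?O. exp (\<rho>\<^sup>2 / 4) \<le> f (x m k)}"
  proof (rule O.finite_measure_mono)
    show "{x \<in> space ?O. \<rho> < cmod (x m k)} \<subseteq> {x \<in> space ?O. exp (\<rho>\<^sup>2 / 4) \<le> f (x m k)}"
      using \<open>\<rho> \<ge> 0\<close> by (auto simp: f_def intro!: power_mono)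
  qed measurable
  also have "\<dots> \<le> (\<integral>x. f (x m k) \<partial>?O) / exp (\<rho>\<^sup>2 / 4)"
    by (rule integral_Markov_inequality_measure[OF i2 sets.top]) (auto simp: f_def)
  also have "\<dots> = 2 * exp (- \<rho>\<^sup>2 / 4)" by (simp add: i3 exp_minus field_simps)
  finally show ?thesis .
qed

text \<open>If no coordinate is truncated and the sums projected on the four directions
  \<open>1, -1, \<i>, -\<i>\<close> stay below \<open>N / 4\<close>, then real and imaginary part of
  the sum are below \<open>N / 4\<close> in modulus and its modulus is below \<open>N / 2\<close>.
  The factors are four directions and at most three coordinates, each with tail constant 2.\<close>

lemma triple_mean_tail:
  assumes N: "N \<ge> 1" and p: "p \<in> index_pairs K" and s: "\<And>j. j \<in> {1..K} \<Longrightarrow> 0 \<le> s j \<and> s j \<le> S"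
    and \<rho>: "\<rho> \<ge> 0" and \<mu>: "\<mu> \<ge> 0" "80 * \<mu> * S ^ 3 * \<rho> \<le> 1" "16 * (10 ^ 6 * (S\<^sup>2 + S ^ 6)) * \<mu> \<le> 1"
  shows "measure (gauss_sample K N) {x \<in> space (gauss_sample K N). 1/2 < cmod (triple_mean s N p x)}
     \<le> 4 * exp (- (\<mu> * real N / 8)) + 6 * real N * exp (- \<rho>\<^sup>2 / 4)"
proof -
  let ?O = "gauss_sample K N"
  interpret O: prob_space ?O by (rule prob_space_gauss_sample)
  obtain k l where kl: "p = (k, l)" by force
  have mem: "k + l \<in> {1..K}" "k \<in> {1..K}" "l \<in> {1..K}" using p by (auto simp: kl index_pairs_def)
  define A where "A u = {x \<in> space ?O. real N / 4 \<le> (\<Sum>m=1..N. Re (u * trunc_triple \<rho> s p (x m)))}" for u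
  define T where "T m j = {x \<in> space ?O. \<rho> < cmod (x m j)}" for m j
  define U where "U = {1, -1, \<i>, -\<i>}"
  define J where "J = {k + l, k, l}"
  have JK: "J \<subseteq> {1..K}" "finite J" "card J \<le> 3" unfolding J_def using mem by (auto simp: card_insert_if)
  have U: "finite U" "card U \<le> 4" "\<And>u. u \<in> U \<Longrightarrow> cmod u = 1" unfolding U_def by (auto simp: card_insert_if)
  have Am: "A u \<in> sets ?O" for u
  proof -
    have [measurable]: "(\<lambda>x. \<Sum>m=1..N. Re (u * trunc_triple \<rho> s p (x m))) \<in> borel_measurable ?O"
    proof (rule borel_measurable_sum)
      fix m assume "m \<in> {1..N}"
      hence [measurable]: "(\<lambda>x. trunc_triple \<rho> s p (x m)) \<in> borel_measurable ?O"
        by (rule measurable_compose[OF gauss_sample_component measurable_trunc_triple[OF p]])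
      show "(\<lambda>x. Re (u * trunc_triple \<rho> s p (x m))) \<in> borel_measurable ?O" by measurable
    qed
    show ?thesis unfolding A_def by measurable
  qed
  have Tm: "T m j \<in> sets ?O" if "m \<in> {1..N}" "j \<in> J" for m j
  proof -
    have [measurable]: "(\<lambda>x. x m j) \<in> borel_measurable ?O" using that JK by (intro gauss_sample_component2) auto
    show ?thesis unfolding T_def by measurable
  qed
  have sub: "{x \<in> space ?O. 1/2 < cmod (triple_mean s N p x)} \<subseteq> (\<Union>u\<in>U. A u) \<union> (\<Union>(m, j)\<in>{1..N} \<times> J. T m j)"
  proof
    fix x assume x: "x \<in> {x \<in> space ?O. 1/2 < cmod (triple_mean s N p x)}"
    show "x \<in> (\<Union>u\<in>U. A u) \<union> (\<Union>(m, j)\<in>{1..N} \<times> J. T m j)"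
    proof (rule ccontr)
      assume neg: "\<not> ?thesis"
      hence tr: "cmod (x m j) \<le> \<rho>" if "m \<in> {1..N}" "j \<in> J" for m j using that x by (force simp: T_def not_le)
      have small: "(\<Sum>m=1..N. Re (u * trunc_triple \<rho> s p (x m))) < real N / 4" if "u \<in> U" for u
        using neg that x by (auto simp: A_def not_le)
      have eq: "trunc_triple \<rho> s p (x m) = triple s p (x m)" if "m \<in> {1..N}" for m
        using tr[OF that] by (simp add: trunc_triple_def triple_def kl J_def trunc_def)
      define Z where "Z = (\<Sum>m=1..N. triple s p (x m))"
      have "(\<Sum>m=1..N. Re (u * trunc_triple \<rho> s p (x m))) = Re (u * Z)" for u
        unfolding Z_def sum_distrib_left Re_sum using eq by (intro sum.cong refl) auto
      hence "Re (u * Z) < real N / 4" if "u \<in> U" for u using small[OF that] by simp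
      from this[of 1] this[of "-1"] this[of \<i>] this[of "-\<i>"]
      have "\<bar>Re Z\<bar> < real N / 4" "\<bar>Im Z\<bar> < real N / 4" by (auto simp: U_def)
      hence "cmod Z < real N / 2" using cmod_le[of Z] by linarith
      hence "cmod (triple_mean s N p x) < 1/2" 
      proof -
        have "triple_mean s N p x = Z / of_nat N" by (simp only: triple_mean_def Z_def)
        hence "cmod (triple_mean s N p x) = cmod Z / real N" by (simp add: norm_divide)
        moreover have "cmod Z / real N < 1 / 2" using N \<open>cmod Z < real N / 2\<close> by (simp add: divide_less_eq)
        ultimately show ?thesis by simp
      qed
      thus False using x by simp
    qed
  qed
  have meas: "(\<Union>u\<in>U. A u) \<in> sets ?O" "(\<Union>(m, j)\<in>{1..N} \<times> J. T m j) \<in> sets ?O"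
    using U JK Am Tm by (auto intro!: sets.finite_UN)
  have "measure ?O {x \<in> space ?O. 1/2 < cmod (triple_mean s N p x)} \<le>
      measure ?O ((\<Union>u\<in>U. A u) \<union> (\<Union>(m, j)\<in>{1..N} \<times> J. T m j))"
    using meas by (intro O.finite_measure_mono sub) auto
  also have "\<dots> \<le> measure ?O (\<Union>u\<in>U. A u) + measure ?O (\<Union>(m, j)\<in>{1..N} \<times> J. T m j)"
    using meas by (intro measure_Un_le)
  also have "measure ?O (\<Union>u\<in>U. A u) \<le> (\<Sum>u\<in>U. measure ?O (A u))"
    using U Am by (intro O.finite_measure_subadditive_finite) auto
  also have "\<dots> \<le> (\<Sum>u\<in>U. exp (- (\<mu> * real N / 8)))"
    unfolding A_def using U by (intro sum_mono trunc_mean_tail[OF N p s \<rho> \<mu>]) auto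
  also have "\<dots> \<le> 4 * exp (- (\<mu> * real N / 8))" using U(2) by simp
  also have "measure ?O (\<Union>(m, j)\<in>{1..N} \<times> J. T m j) \<le> (\<Sum>(m, j)\<in>{1..N} \<times> J. measure ?O (T m j))"
  proof -
    have "(\<lambda>(m, j). T m j) ` ({1..N} \<times> J) \<subseteq> sets ?O" using Tm by auto
    moreover have "finite ({1..N} \<times> J)" using JK by simp
    ultimately show ?thesis
      using O.finite_measure_subadditive_finite[of "{1..N} \<times> J" "\<lambda>(m, j). T m j"]
      by (simp only: case_prod_unfold)
  qed
  also have "\<dots> \<le> (\<Sum>(m, j)\<in>{1..N} \<times> J. 2 * exp (- \<rho>\<^sup>2 / 4))"
    unfolding T_def 
    by (rule sum_mono, unfold case_prod_unfold, rule cgauss_tail[OF \<rho>]) (use JK in auto)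
  also have "\<dots> = real N * real (card J) * (2 * exp (- \<rho>\<^sup>2 / 4))" by (simp add: card_cartesian_product)
  also have "\<dots> \<le> real N * 3 * (2 * exp (- \<rho>\<^sup>2 / 4))" using JK(3) by (intro mult_right_mono mult_left_mono) auto
  finally show ?thesis by simp
qed

section \<open>Union bound over all index pairs\<close>

text \<open>The denominator is \<open>2 * 8 * 16 * 10 ^ 6\<close>: 8 from the Chernoff exponent,
  \<open>16 * 10 ^ 6\<close> from the choice of \<open>\<mu>\<close>, and 2 from bounding
  \<open>S\<^sup>2 + S ^ 6\<close> by twice its larger term.\<close>

definition tail_rate :: real where "tail_rate = 1 / 256000000"

text \<open>The two coefficients arise when exponentials of rate \<open>tail_rate / 2\<close> are
  replaced by inverse powers of order one and six: \<open>8 = 4 * 2\<close> and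
  \<open>460800 = 10 * 2 ^ 6 * 6!\<close>.\<close>

definition tail_const :: real where "tail_const = 8 / tail_rate + 460800 / tail_rate ^ 6"

lemma exp_neg_le:
  assumes "y > (0::real)" shows "exp (- y) \<le> fact q / y ^ q"
  using power_le_fact_exp[of y q] assms by (simp add: exp_minus field_simps)

lemma cube_le_imp_le: "x ^ 3 \<le> y ^ 3 \<Longrightarrow> 0 \<le> y \<Longrightarrow> x \<le> (y::real)"
  by (rule power_le_imp_le_base[of x 2 y]) simp_all

text \<open>Half of each exponent is spent on a factor \<open>1 / K ^ 3\<close>, which pays for the
  at most \<open>K\<^sup>2\<close> pairs and leaves \<open>1 / K\<close>. The other half is
  converted into the powers of \<open>S\<close> and \<open>N\<close> that appear in the risk
  bound.\<close>

lemma sum_bad_events_le: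
  assumes K: "K \<ge> 2" and N: "N \<ge> 1" and S: "S > 0" and s: "\<And>j. j \<in> {1..K} \<Longrightarrow> 0 \<le> s j \<and> s j \<le> S"
    and hyp: "real N \<ge> 50000 ^ 3 * (S ^ 6 * ln (real K) + S ^ 3 * ln (real K) powr (3/2))"
  shows "(\<Sum>p\<in>index_pairs K. measure (gauss_sample K N) {x \<in> space (gauss_sample K N). 1/2 < cmod (triple_mean s N p x)})
     \<le> tail_const * (S\<^sup>2 / real N + S ^ 6 / (real N * real K))"
    and "S ^ 6 \<le> real N"
proof -
  define c where "c = tail_rate"
  have c: "c > 0" "c \<le> 1" "c \<le> 1/640" by (simp_all add: c_def tail_rate_def)
  define L where "L = ln (real K)"
  have K0: "real K \<ge> 2" using K by simp
  have half: "1/2 \<le> L"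
  proof -
    have "exp (1/2 :: real) ^ 2 = exp 1" by (simp add: power2_eq_square exp_add[symmetric])
    hence "exp (1/2 :: real) ^ 2 \<le> 2 ^ 2" using exp_le by simp
    hence "exp (1/2 :: real) \<le> 2" by (rule power2_le_imp_le) simp
    hence "exp (1/2) \<le> real K" using K0 by linarith
    thus ?thesis unfolding L_def using K0 by (subst ln_ge_iff) auto
  qed
  have L0: "L > 0" using half by linarith
  define b where "b = root 3 (real N)"
  have b3: "b ^ 3 = real N" unfolding b_def by (rule real_root_pow_pos2) auto
  have b1: "b \<ge> 1" unfolding b_def using N by simp
  have pw: "L powr (3/2) = sqrt L ^ 3"
  proof -
    have "L powr (3/2) = L powr (1/2 * 3)" by simp
    also have "\<dots> = (L powr (1/2)) powr 3" by (rule powr_powr[symmetric])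
    also have "\<dots> = sqrt L ^ 3" using L0 by (simp add: powr_half_sqrt powr_numeral)
    finally show ?thesis .
  qed
  have h1: "50000 ^ 3 * (S ^ 6 * L) \<le> real N" and h2: "50000 ^ 3 * (S ^ 3 * sqrt L ^ 3) \<le> real N"
  proof -
    have nn: "0 \<le> S ^ 6 * L" "0 \<le> S ^ 3 * sqrt L ^ 3" using S L0 by simp_all
    have "50000 ^ 3 * (S ^ 6 * L) + 50000 ^ 3 * (S ^ 3 * sqrt L ^ 3) \<le> real N"
      using hyp unfolding L_def[symmetric] pw by (simp only: distrib_left)
    note total = this
    have ar: "C * x \<le> n" "C * y \<le> n" if "C * x + C * y \<le> n" "0 \<le> x" "0 \<le> y" "0 \<le> C" for C x y n :: real
      using that mult_nonneg_nonneg[of C x] mult_nonneg_nonneg[of C y] by linarith+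
    show "50000 ^ 3 * (S ^ 6 * L) \<le> real N" by (rule ar(1)[OF total nn]) simp
    show "50000 ^ 3 * (S ^ 3 * sqrt L ^ 3) \<le> real N" by (rule ar(2)[OF total nn]) simp
  qed
  show SN: "S ^ 6 \<le> real N"
  proof -
    have "S ^ 6 * 1 \<le> S ^ 6 * (50000 ^ 3 * L)" using S half by (intro mult_left_mono) auto
    thus ?thesis using h1 by simp
  qed
  \<comment> \<open>Both \<open>\<rho>\<^sup>2\<close> and \<open>\<mu> * N\<close> are at least of the order of the smaller of \<open>N powr (2/3) / S\<^sup>2\<close> and \<open>N / S ^ 6\<close>.\<close>
  define \<rho> where "\<rho> = b / S"
  define R where "R = \<rho>\<^sup>2"
  define Q where "Q = real N / S ^ 6"
  have Q0: "Q > 0" and R0: "R > 0" using N S b1 by (auto simp: Q_def R_def \<rho>_def)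
  have QL: "50000 ^ 3 * L \<le> Q" using h1 S by (simp add: Q_def field_simps)
  have RL: "50000 ^ 2 * L \<le> R"
  proof -
    have "(50000 * (S * sqrt L)) ^ 3 \<le> b ^ 3" using h2 unfolding b3 by (simp add: power_mult_distrib)
    hence "50000 * (S * sqrt L) \<le> b" by (rule cube_le_imp_le) (use b1 in simp)
    hence "50000 * sqrt L \<le> \<rho>" using S by (simp add: \<rho>_def field_simps)
    hence "(50000 * sqrt L)\<^sup>2 \<le> R" unfolding R_def using L0 by (intro power_mono) auto
    thus ?thesis using L0 by (simp add: power_mult_distrib)
  qed
  \<comment> \<open>The largest value permitted by both conditions of the Chernoff bound, using
    \<open>S ^ 3 * \<rho> = S\<^sup>2 * b\<close>.\<close>
  define \<mu> where "\<mu> = min (1 / (80 * S\<^sup>2 * b)) (1 / (16 * (10 ^ 6 * (S\<^sup>2 + S ^ 6))))"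
  have pos: "80 * S\<^sup>2 * b > 0" "16 * (10 ^ 6 * (S\<^sup>2 + S ^ 6)) > 0" using S b1 by (auto simp: add_pos_pos)
  have \<mu>0: "\<mu> \<ge> 0" unfolding \<mu>_def using pos by simp
  have \<mu>1: "80 * \<mu> * S ^ 3 * \<rho> \<le> 1"
  proof -
    have "\<mu> \<le> 1 / (80 * S\<^sup>2 * b)" unfolding \<mu>_def by simp
    hence "\<mu> * (80 * S\<^sup>2 * b) \<le> 1" using pos by (simp add: field_simps)
    hence m: "\<mu> * (80 * S\<^sup>2 * b) \<le> 1" .
    have e: "S ^ 3 * \<rho> = S\<^sup>2 * b"
      using S by (simp add: \<rho>_def power2_eq_square power3_eq_cube)
    have "80 * \<mu> * S ^ 3 * \<rho> = 80 * \<mu> * (S ^ 3 * \<rho>)" by (rule mult.assoc)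
    also have "\<dots> = \<mu> * (80 * S\<^sup>2 * b)" unfolding e by (simp only: mult_ac)
    also note m
    finally show ?thesis .
  qed
  have \<mu>2: "16 * (10 ^ 6 * (S\<^sup>2 + S ^ 6)) * \<mu> \<le> 1"
  proof -
    have "\<mu> \<le> 1 / (16 * (10 ^ 6 * (S\<^sup>2 + S ^ 6)))" unfolding \<mu>_def by simp
    thus ?thesis using pos(2) by (simp add: field_simps)
  qed
  have exponent: "c * R \<le> \<mu> * real N / 8 \<or> c * Q \<le> \<mu> * real N / 8"
  proof (cases "\<mu> = 1 / (80 * S\<^sup>2 * b)")
    case True
    have "\<mu> * real N / 8 = R / 640"
      unfolding True R_def \<rho>_def b3[symmetric] using S b1 by (simp add: power2_eq_square power3_eq_cube field_simps)
    moreover have "c * R \<le> 1/640 * R" using c R0 by (intro mult_right_mono) auto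
    ultimately show ?thesis by simp
  next
    case False
    hence \<mu>: "\<mu> = 1 / (16 * (10 ^ 6 * (S\<^sup>2 + S ^ 6)))" unfolding \<mu>_def by (auto simp: min_def)
    have V0: "S\<^sup>2 + S ^ 6 > 0" using S by (simp add: add_pos_pos)
    have eq: "\<mu> * real N / 8 = 2 * c * (real N / (S\<^sup>2 + S ^ 6))" unfolding \<mu> c_def tail_rate_def by simp
    show ?thesis
    proof (cases "S \<ge> 1")
      case True
      have "S ^ 2 \<le> S ^ 6" using True by (intro power_increasing) auto
      hence "real N / (2 * S ^ 6) \<le> real N / (S\<^sup>2 + S ^ 6)" using S V0 by (intro divide_left_mono) auto
      hence "2 * c * (real N / (2 * S ^ 6)) \<le> \<mu> * real N / 8" unfolding eq using c by (intro mult_left_mono) auto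
      thus ?thesis by (simp add: Q_def)
    next
      case False
      have "S ^ 6 \<le> S ^ 2" using False S by (intro power_decreasing) auto
      hence "real N / (2 * S ^ 2) \<le> real N / (S\<^sup>2 + S ^ 6)" using S V0 by (intro divide_left_mono) auto
      hence "2 * c * (real N / (2 * S ^ 2)) \<le> \<mu> * real N / 8" unfolding eq using c by (intro mult_left_mono) auto
      moreover have "R \<le> real N / S\<^sup>2"
      proof -
        have "b\<^sup>2 \<le> b ^ 3" using b1 by (intro power_increasing) auto
        thus ?thesis unfolding R_def \<rho>_def power_divide b3 using S by (intro divide_right_mono) auto
      qed
      hence "c * R \<le> c * (real N / S\<^sup>2)" using c by (intro mult_left_mono) auto
      moreover have "2 * c * (real N / (2 * S\<^sup>2)) = c * (real N / S\<^sup>2)" by simp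
      ultimately show ?thesis by linarith
    qed
  qed
  define T where "T = 4 * exp (- (c * Q)) + 10 * real N * exp (- (c * R))"
  have tail: "measure (gauss_sample K N) {x \<in> space (gauss_sample K N). 1/2 < cmod (triple_mean s N p x)} \<le> T"
    if p: "p \<in> index_pairs K" for p
  proof -
    have e1: "exp (- (\<mu> * real N / 8)) \<le> exp (- (c * R)) + exp (- (c * Q))"
      using exponent exp_ge_zero[of "- (c * R)"] exp_ge_zero[of "- (c * Q)"]
        exp_le_cancel_iff[of "- (\<mu> * real N / 8)" "- (c * R)"] exp_le_cancel_iff[of "- (\<mu> * real N / 8)" "- (c * Q)"]
      by linarith
    have "c * R \<le> 1/4 * R" using c R0 by (intro mult_right_mono) auto
    hence e2: "exp (- \<rho>\<^sup>2 / 4) \<le> exp (- (c * R))" by (simp add: R_def)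
    have e3: "exp (- (c * R)) \<le> real N * exp (- (c * R))" using N by simp
    have "measure (gauss_sample K N) {x \<in> space (gauss_sample K N). 1/2 < cmod (triple_mean s N p x)}
      \<le> 4 * exp (- (\<mu> * real N / 8)) + 6 * real N * exp (- \<rho>\<^sup>2 / 4)"
      using S b1 by (intro triple_mean_tail[OF N p s _ \<mu>0 \<mu>1 \<mu>2]) (auto simp: \<rho>_def)
    also have "\<dots> \<le> 4 * (exp (- (c * R)) + exp (- (c * Q))) + 6 * real N * exp (- (c * R))"
      by (intro add_mono mult_left_mono e1 e2) auto
    also have "\<dots> \<le> T" unfolding T_def using e3 by (simp add: algebra_simps)
    finally show ?thesis .
  qed
  have K3: "exp (- (3 * L)) = 1 / real K ^ 3"
  proof -
    have "exp (3 * L) = real K ^ 3" unfolding L_def using K0 exp_of_nat_mult[of 3 "ln (real K)"] by simp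
    thus ?thesis by (simp add: exp_minus inverse_eq_divide)
  qed
  \<comment> \<open>This fixes the size of 50000: \<open>tail_rate / 2 * 50000 ^ 2\<close> has to be
    at least 3. The cube in the hypothesis turns into this square when \<open>R\<close>, of order
    \<open>N powr (2/3)\<close>, is compared with \<open>ln K\<close>.\<close>
  have split: "exp (- (c * X)) \<le> 1 / real K ^ 3 * exp (- (c / 2 * X))" if "50000 ^ 2 * L \<le> X" for X
  proof -
    have "3 * L \<le> c / 2 * (50000 ^ 2 * L)" using L0 by (simp add: c_def tail_rate_def)
    also have "\<dots> \<le> c / 2 * X" using that c by (intro mult_left_mono) auto
    finally have "- (c * X) \<le> - (3 * L) + - (c / 2 * X)" by (simp add: algebra_simps)
    hence "exp (- (c * X)) \<le> exp (- (3 * L)) * exp (- (c / 2 * X))" by (simp add: exp_add[symmetric])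
    thus ?thesis by (simp add: K3)
  qed
  have QL': "50000 ^ 2 * L \<le> Q"
  proof -
    have "50000 ^ 2 * L \<le> 50000 ^ 3 * L" using L0 by (intro mult_right_mono) auto
    thus ?thesis using QL by linarith
  qed
  have Qb: "exp (- (c / 2 * Q)) \<le> 2 / c * (S ^ 6 / real N)"
  proof -
    have "exp (- (c / 2 * Q)) \<le> fact 1 / (c / 2 * Q) ^ 1" using c Q0 by (intro exp_neg_le) simp
    also have "\<dots> = 2 / c * (S ^ 6 / real N)" by (simp add: Q_def)
    finally show ?thesis .
  qed
  have Rb: "real N * exp (- (c / 2 * R)) \<le> 46080 / c ^ 6 * (S\<^sup>2 / real N)"
  proof -
    have c6: "48 / c ^ 3 \<le> 46080 / c ^ 6"
    proof -
      have "48 * c ^ 6 \<le> 46080 * c ^ 3" 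
      proof -
        have "c ^ 6 \<le> c ^ 3" using c by (intro power_decreasing) auto
        moreover have "0 \<le> c ^ 3" using c by simp
        ultimately show ?thesis by linarith
      qed
      thus ?thesis using c by (simp add: field_simps)
    qed
    \<comment> \<open>For \<open>S \<ge> 1\<close> the bound \<open>S ^ 6 \<le> N\<close> gives
      \<open>b \<le> R\<close>, and a sixth power of \<open>R\<close> beats
      \<open>N\<^sup>2\<close>. For smaller \<open>S\<close> a third power suffices and
      \<open>S ^ 6\<close> is weakened to \<open>S\<^sup>2\<close>.\<close>
    have "(real N)\<^sup>2 * exp (- (c / 2 * R)) \<le> 46080 / c ^ 6 * S\<^sup>2"
    proof (cases "S \<ge> 1")
      case True
      have "(S\<^sup>2) ^ 3 \<le> b ^ 3" using SN unfolding b3 by (simp add: power_mult[symmetric])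
      hence "S\<^sup>2 \<le> b" by (rule cube_le_imp_le) (use b1 in simp)
      hence "b * S\<^sup>2 \<le> b * b" using b1 by (intro mult_left_mono) auto
      hence "b \<le> R" using S by (simp add: R_def \<rho>_def power_divide field_simps power2_eq_square)
      hence "b ^ 6 \<le> R ^ 6" using b1 by (intro power_mono) auto
      moreover have "b ^ 6 = (real N)\<^sup>2" unfolding b3[symmetric] by (simp add: power_mult[symmetric])
      ultimately have NR: "(real N)\<^sup>2 \<le> R ^ 6" by simp
      have "(real N)\<^sup>2 * exp (- (c / 2 * R)) \<le> R ^ 6 * (fact 6 / (c / 2 * R) ^ 6)"
        using c R0 by (intro mult_mono NR exp_neg_le) auto
      also have "\<dots> = 46080 / c ^ 6" using c R0 by (simp add: fact_numeral power_mult_distrib power_divide)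
      also have "\<dots> \<le> 46080 / c ^ 6 * S\<^sup>2" 
        using mult_left_mono[of 1 "S\<^sup>2" "46080 / c ^ 6"] one_le_power[OF True, of 2] c by simp
      finally show ?thesis .
    next
      case False
      have R3: "R ^ 3 = (real N)\<^sup>2 / S ^ 6"
        unfolding R_def \<rho>_def b3[symmetric] by (simp add: power_divide power_mult[symmetric])
      have "(real N)\<^sup>2 * exp (- (c / 2 * R)) \<le> (real N)\<^sup>2 * (fact 3 / (c / 2 * R) ^ 3)"
        using c R0 by (intro mult_left_mono exp_neg_le) auto
      also have "\<dots> = 48 / c ^ 3 * S ^ 6"
        unfolding power_mult_distrib R3 using c N S by (simp add: fact_numeral power_divide)
      also have "\<dots> \<le> 46080 / c ^ 6 * S\<^sup>2"
        using False S c by (intro mult_mono c6 power_decreasing) auto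
      finally show ?thesis .
    qed
    note bound = this
    have gen: "x * e \<le> y * (z / x)" if "x\<^sup>2 * e \<le> y * z" "x > 0" for x y z e :: real
      using that by (simp add: pos_le_divide_eq power2_eq_square mult_ac)
    show ?thesis by (rule gen[OF bound]) (use N in simp)
  qed
  have T1: "T \<le> 1 / real K ^ 3 * (8 / c * (S ^ 6 / real N) + 460800 / c ^ 6 * (S\<^sup>2 / real N))"
  proof -
    have "exp (- (c * Q)) \<le> 1 / real K ^ 3 * (2 / c * (S ^ 6 / real N))"
      by (rule order.trans[OF split[OF QL'] mult_left_mono[OF Qb]]) simp
    moreover have "real N * exp (- (c * R)) \<le> 1 / real K ^ 3 * (46080 / c ^ 6 * (S\<^sup>2 / real N))"
    proof -
      have "real N * exp (- (c * R)) \<le> real N * (1 / real K ^ 3 * exp (- (c / 2 * R)))"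
        by (intro mult_left_mono split RL) auto
      also have "\<dots> = 1 / real K ^ 3 * (real N * exp (- (c / 2 * R)))" by simp
      also have "\<dots> \<le> 1 / real K ^ 3 * (46080 / c ^ 6 * (S\<^sup>2 / real N))" by (intro mult_left_mono Rb) auto
      finally show ?thesis .
    qed
    ultimately have "T \<le> 4 * (1 / real K ^ 3 * (2 / c * (S ^ 6 / real N))) + 10 * (1 / real K ^ 3 * (46080 / c ^ 6 * (S\<^sup>2 / real N)))"
      unfolding T_def by linarith
    thus ?thesis by (simp add: algebra_simps)
  qed
  have T0: "T \<ge> 0" unfolding T_def by simp
  have "(\<Sum>p\<in>index_pairs K. measure (gauss_sample K N) {x \<in> space (gauss_sample K N). 1/2 < cmod (triple_mean s N p x)})
     \<le> (\<Sum>p\<in>index_pairs K. T)" by (intro sum_mono tail)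
  also have "\<dots> = real (card (index_pairs K)) * T" by simp
  also have "\<dots> \<le> real (K\<^sup>2) * T" by (intro mult_right_mono T0 of_nat_mono card_index_pairs_le)
  also have "\<dots> \<le> real (K\<^sup>2) * (1 / real K ^ 3 * (8 / c * (S ^ 6 / real N) + 460800 / c ^ 6 * (S\<^sup>2 / real N)))"
    by (intro mult_left_mono T1) auto
  also have "\<dots> = 8 / c * (S ^ 6 / (real N * real K)) + 460800 / c ^ 6 * (S\<^sup>2 / real N / real K)"
    using K0 by (simp add: power2_eq_square power3_eq_cube field_simps)
  also have "\<dots> \<le> tail_const * (S ^ 6 / (real N * real K)) + tail_const * (S\<^sup>2 / real N)"
  proof (intro add_mono mult_mono)
    have "S\<^sup>2 / real N / real K \<le> S\<^sup>2 / real N / 1" using K0 by (intro divide_left_mono) auto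
    thus "S\<^sup>2 / real N / real K \<le> S\<^sup>2 / real N" by simp
  qed (use c in \<open>auto simp: tail_const_def c_def\<close>)
  finally show "(\<Sum>p\<in>index_pairs K. measure (gauss_sample K N) {x \<in> space (gauss_sample K N). 1/2 < cmod (triple_mean s N p x)})
     \<le> tail_const * (S\<^sup>2 / real N + S ^ 6 / (real N * real K))" by (simp add: algebra_simps)
qed

subsection \<open>The magnitude estimator\<close>

text \<open>The squared magnitude estimate before its positive part is taken; the noise alone
  contributes \<open>2 * \<sigma>\<^sup>2\<close> on average.\<close>

definition power_mean :: "nat \<Rightarrow> real \<Rightarrow> real \<Rightarrow> nat \<Rightarrow> (nat \<Rightarrow> nat \<Rightarrow> complex) \<Rightarrow> real" where
  "power_mean N \<sigma> r k x = (1 / real N) * (\<Sum>m=1..N. (cmod (r + \<sigma> * x m k))\<^sup>2) - 2 * \<sigma>\<^sup>2"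

lemma cgauss_moments:
  "integrable cgauss (\<lambda>z. Re z)" "(\<integral>z. Re z \<partial>cgauss) = 0"
  "integrable cgauss (\<lambda>z. (cmod z)\<^sup>2)" "(\<integral>z. (cmod z)\<^sup>2 \<partial>cgauss) = 2"
proof -
  have m2: "(\<lambda>z. (cmod z)\<^sup>2) \<in> borel_measurable cgauss" by measurable
  have mR: "Re \<in> borel_measurable cgauss" by (subst measurable_cong_sets[OF sets_cgauss refl]) simp
  show i2: "integrable cgauss (\<lambda>z. (cmod z)\<^sup>2)"
    by (rule integrableI_nonneg[OF m2]) (auto simp: cgauss_second_moment)
  show "(\<integral>z. (cmod z)\<^sup>2 \<partial>cgauss) = 2"
    by (subst integral_eq_nn_integral[OF m2]) (auto simp: cgauss_second_moment)
  have le: "\<bar>Re z\<bar> \<le> 1 + (cmod z)\<^sup>2" for z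
    using abs_Re_le_cmod[of z] sum_squares_bound[of 1 "cmod z"] zero_le_power2[of "cmod z"] by simp
  show iR: "integrable cgauss (\<lambda>z. Re z)"
  proof (rule Bochner_Integration.integrable_bound)
    show "integrable cgauss (\<lambda>z. 1 + (cmod z)\<^sup>2)" using i2 by simp
    show "AE z in cgauss. norm (Re z) \<le> norm (1 + (cmod z)\<^sup>2)" using le by (auto intro!: AE_I2)
  qed (rule mR)
  have "distr cgauss borel (\<lambda>z. (-1) * z) = cgauss" by (rule distr_cgauss_mult) simp
  moreover have "(\<integral>z. Re z \<partial>distr cgauss borel (\<lambda>z. (-1) * z)) = (\<integral>z. Re ((-1) * z) \<partial>cgauss)"
    by (rule integral_distr) auto
  ultimately have "(\<integral>z. Re z \<partial>cgauss) = (\<integral>z. - Re z \<partial>cgauss)" by simp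
  thus "(\<integral>z. Re z \<partial>cgauss) = 0" by simp
qed

lemma gauss_sample_mean_variance:
  fixes h :: "complex \<Rightarrow> real"
  assumes N: "N \<ge> 1" and k: "k \<in> {1..K}" and h: "h \<in> borel_measurable borel"
    and i: "integrable cgauss h" "(\<integral>z. h z \<partial>cgauss) = 0"
    and i2: "integrable cgauss (\<lambda>z. (h z)\<^sup>2)" "(\<integral>z. (h z)\<^sup>2 \<partial>cgauss) \<le> B"
  shows "integrable (gauss_sample K N) (\<lambda>x. ((\<Sum>m=1..N. h (x m k)) / real N)\<^sup>2)"
    and "(\<integral>x. ((\<Sum>m=1..N. h (x m k)) / real N)\<^sup>2 \<partial>gauss_sample K N) \<le> B / real N"
proof -
  let ?O = "gauss_sample K N"
  interpret product_prob_space "\<lambda>_::nat. gauss_vec K" "{1..N}" by (simp add: prob_space_gauss_vec product_prob_spaceI)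
  interpret V: prob_space "gauss_vec K" by (rule prob_space_gauss_vec)
  have h2: "(\<lambda>z. (h z)\<^sup>2) \<in> borel_measurable borel" using h by simp
  have v: "integrable (gauss_vec K) (\<lambda>t. h (t k))" "(\<integral>t. h (t k) \<partial>gauss_vec K) = 0"
    using integral_gauss_vec_component[OF k h] i by auto
  have v2: "integrable (gauss_vec K) (\<lambda>t. (h (t k))\<^sup>2)" "(\<integral>t. (h (t k))\<^sup>2 \<partial>gauss_vec K) \<le> B"
    using integral_gauss_vec_component[OF k h2] i2 by auto
  \<comment> \<open>The real summands are viewed as complex so that
    \<open>integral_orthogonal_sum_le\<close> can be applied; distinct samples are orthogonal
    because they are independent and centred.\<close>
  define f where "f m x = complex_of_real (h (x m k))" for m and x :: "nat \<Rightarrow> nat \<Rightarrow> complex"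
  have comp: "(\<lambda>x. x m) \<in> ?O \<rightarrow>\<^sub>M gauss_vec K" "distr ?O (gauss_vec K) (\<lambda>x. x m) = gauss_vec K" if "m \<in> {1..N}" for m
    using gauss_sample_component[OF that] distr_PiM_component[OF prob_space_gauss_vec that] by (auto simp: gauss_sample_def)
  have hk: "(\<lambda>t. h (t k)) \<in> borel_measurable (gauss_vec K)" "(\<lambda>t. (h (t k))\<^sup>2) \<in> borel_measurable (gauss_vec K)"
    using v(1) v2(1) by (auto intro: borel_measurable_integrable)
  have fm: "f m \<in> borel_measurable ?O" if "m \<in> {1..N}" for m
    unfolding f_def[abs_def] using measurable_compose[OF comp(1)[OF that] hk(1)] by simp
  have fsq: "(cmod (f m x))\<^sup>2 = (h (x m k))\<^sup>2" for m x by (simp add: f_def)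
  have fi: "integrable ?O (\<lambda>x. (cmod (f m x))\<^sup>2)" "(\<integral>x. (cmod (f m x))\<^sup>2 \<partial>?O) \<le> B" if "m \<in> {1..N}" for m
    unfolding fsq
    using integrable_distr_eq[OF comp(1)[OF that] hk(2)] integral_distr[OF comp(1)[OF that] hk(2)] v2 unfolding comp(2)[OF that] by simp_all
  have orth: "(\<integral>x. f m x * cnj (f m' x) \<partial>?O) = 0" if m: "m \<in> {1..N}" "m' \<in> {1..N}" "m \<noteq> m'" for m m'
  proof -
    define g where "g i = (if i = m \<or> i = m' then (\<lambda>t. h (t k)) else (\<lambda>_. 1))" for i :: nat
    have gi: "integrable (gauss_vec K) (g i)" for i unfolding g_def using v(1) by auto
    have "(\<Prod>i\<in>{1..N}. g i (x i)) = h (x m k) * h (x m' k)" for x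
    proof -
      have "(\<Prod>i\<in>{1..N}. g i (x i)) = (\<Prod>i\<in>{m, m'}. g i (x i))"
        using m by (intro prod.mono_neutral_right) (auto simp: g_def)
      thus ?thesis using m(3) by (simp add: g_def)
    qed
    moreover have "(\<integral>x. (\<Prod>i\<in>{1..N}. g i (x i)) \<partial>PiM {1..N} (\<lambda>_. gauss_vec K)) = (\<Prod>i\<in>{1..N}. \<integral>t. g i t \<partial>gauss_vec K)"
      using gi by (intro product_integral_prod) auto
    moreover have "(\<Prod>i\<in>{1..N}. \<integral>t. g i t \<partial>gauss_vec K) = 0"
      using m(1) v(2) by (intro prod_zero) (auto simp: g_def intro!: bexI[of _ m])
    ultimately have "(\<integral>x. h (x m k) * h (x m' k) \<partial>?O) = 0" unfolding gauss_sample_def by simp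
    moreover have "f m x * cnj (f m' x) = complex_of_real (h (x m k) * h (x m' k))" for x by (simp add: f_def)
    ultimately show ?thesis by (simp only: integral_complex_of_real) simp
  qed
  have eq: "((\<Sum>m=1..N. h (x m k)) / real N)\<^sup>2 = (cmod (\<Sum>m\<in>{1..N}. (1 / complex_of_real (real N)) * f m x))\<^sup>2" for x
  proof -
    have "(\<Sum>m\<in>{1..N}. (1 / complex_of_real (real N)) * f m x) = complex_of_real ((\<Sum>m=1..N. h (x m k)) / real N)"
      by (simp add: f_def sum_divide_distrib)
    thus ?thesis by (simp only: norm_of_real power2_abs)
  qed
  show "integrable ?O (\<lambda>x. ((\<Sum>m=1..N. h (x m k)) / real N)\<^sup>2)"
    unfolding eq by (rule integral_orthogonal_sum_le(1)[OF _ fm fi orth]) auto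
  have "(\<integral>x. ((\<Sum>m=1..N. h (x m k)) / real N)\<^sup>2 \<partial>?O) \<le> B * (\<Sum>m\<in>{1..N}. (cmod (1 / complex_of_real (real N)))\<^sup>2)"
    unfolding eq by (rule integral_orthogonal_sum_le(2)[OF _ fm fi orth]) auto
  also have "\<dots> = B / real N" using N by (simp add: norm_divide power_divide power2_eq_square)
  finally show "(\<integral>x. ((\<Sum>m=1..N. h (x m k)) / real N)\<^sup>2 \<partial>?O) \<le> B / real N" .
qed

text \<open>With \<open>q\<close> the estimate, \<open>\<bar>q - r\<bar> * r \<le> \<bar>q\<^sup>2 -
  r\<^sup>2\<bar>\<close>, and the positive part only moves the squared estimate closer to
  \<open>r\<^sup>2\<close>. The error is thus the error of an unbiased mean divided by
  \<open>r\<close>.\<close>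

lemma magnitude_error:
  assumes N: "N \<ge> 1" and k: "k \<in> {1..K}" and r: "r > 0"
  shows "integrable (gauss_sample K N) (\<lambda>x. (sqrt (max 0 (power_mean N \<sigma> r k x)) - r)\<^sup>2)"
    and "(\<integral>x. (sqrt (max 0 (power_mean N \<sigma> r k x)) - r)\<^sup>2 \<partial>gauss_sample K N) \<le> 136 * (\<sigma>\<^sup>2 / real N + \<sigma> ^ 4 / (real N * r\<^sup>2))"
proof -
  let ?O = "gauss_sample K N"
  \<comment> \<open>The centred summand: what remains of the squared modulus of
    \<open>r + \<sigma> * z\<close> after subtracting its mean
    \<open>r\<^sup>2 + 2 * \<sigma>\<^sup>2\<close>.\<close>
  define h where "h z = 2 * r * \<sigma> * Re z + \<sigma>\<^sup>2 * ((cmod z)\<^sup>2 - 2)" for z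
  have h: "h \<in> borel_measurable borel" unfolding h_def[abs_def] by measurable
  have i: "integrable cgauss h" "(\<integral>z. h z \<partial>cgauss) = 0"
    unfolding h_def[abs_def] using cgauss_moments by (auto simp: cgauss.prob_space[simplified])
  define B where "B = 136 * (r\<^sup>2 * \<sigma>\<^sup>2 + \<sigma> ^ 4)"
  have hb: "(h z)\<^sup>2 \<le> B / 2 * exp ((cmod z)\<^sup>2 / 4)" for z
  proof -
    define e where "e = exp ((cmod z)\<^sup>2 / 4)"
    have e1: "1 \<le> e" by (simp add: e_def)
    have e2: "(cmod z)\<^sup>2 \<le> 4 * e" using power_le_fact_exp[of "(cmod z)\<^sup>2 / 4" 1] by (simp add: e_def)
    have e3: "((cmod z)\<^sup>2)\<^sup>2 \<le> 32 * e" using power_le_fact_exp[of "(cmod z)\<^sup>2 / 4" 2] by (simp add: e_def power_divide fact_numeral)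
    have "(h z)\<^sup>2 \<le> 2 * (2 * r * \<sigma> * Re z)\<^sup>2 + 2 * (\<sigma>\<^sup>2 * ((cmod z)\<^sup>2 - 2))\<^sup>2"
      using sum_squares_bound[of "2 * r * \<sigma> * Re z" "\<sigma>\<^sup>2 * ((cmod z)\<^sup>2 - 2)"] unfolding h_def power2_sum by linarith
    also have "\<dots> = 8 * (r\<^sup>2 * \<sigma>\<^sup>2) * (Re z)\<^sup>2 + 2 * \<sigma> ^ 4 * ((cmod z)\<^sup>2 - 2)\<^sup>2"
      by (simp add: power_mult_distrib)
    also have "\<dots> \<le> 8 * (r\<^sup>2 * \<sigma>\<^sup>2) * (4 * e) + 2 * \<sigma> ^ 4 * (34 * e)"
    proof (intro add_mono mult_left_mono)
      have "(Re z)\<^sup>2 \<le> (cmod z)\<^sup>2" using abs_Re_le_cmod[of z] by (intro abs_le_square_iff[THEN iffD1]) simp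
      thus "(Re z)\<^sup>2 \<le> 4 * e" using e2 by linarith
      show "((cmod z)\<^sup>2 - 2)\<^sup>2 \<le> 34 * e"
      proof -
        have "((cmod z)\<^sup>2 - 2)\<^sup>2 = ((cmod z)\<^sup>2)\<^sup>2 - 4 * (cmod z)\<^sup>2 + 4" by (simp add: power2_diff)
        moreover have "((cmod z)\<^sup>2 - 2)\<^sup>2 \<le> max 4 (((cmod z)\<^sup>2)\<^sup>2)"
        proof (cases "(cmod z)\<^sup>2 \<ge> 2")
          case True
          hence "((cmod z)\<^sup>2 - 2)\<^sup>2 \<le> ((cmod z)\<^sup>2)\<^sup>2" by (intro power_mono) auto
          thus ?thesis by simp
        next
          case False
          hence "(2 - (cmod z)\<^sup>2)\<^sup>2 \<le> 2\<^sup>2" by (intro power_mono) auto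
          thus ?thesis by (simp add: power2_commute)
        qed
        ultimately show ?thesis using e1 e3 by linarith
      qed
    qed auto
    also have "\<dots> \<le> B / 2 * e" using e1 by (simp add: B_def algebra_simps add_mono)
    finally show ?thesis by (simp add: e_def)
  qed
  have ib: "integrable cgauss (\<lambda>z. B / 2 * exp ((cmod z)\<^sup>2 / 4))" using integral_cgauss_exp(1) by simp
  have i2: "integrable cgauss (\<lambda>z. (h z)\<^sup>2)"
  proof (rule Bochner_Integration.integrable_bound[OF ib])
    show "(\<lambda>z. (h z)\<^sup>2) \<in> borel_measurable cgauss" using i(1) by (auto intro: borel_measurable_integrable)
    show "AE z in cgauss. norm ((h z)\<^sup>2) \<le> norm (B / 2 * exp ((cmod z)\<^sup>2 / 4))"
      using hb by (intro AE_I2) (auto intro: order.trans[OF _ abs_ge_self])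
  qed
  have i2b: "(\<integral>z. (h z)\<^sup>2 \<partial>cgauss) \<le> B"
  proof -
    have "(\<integral>z. (h z)\<^sup>2 \<partial>cgauss) \<le> (\<integral>z. B / 2 * exp ((cmod z)\<^sup>2 / 4) \<partial>cgauss)" by (intro integral_mono i2 ib hb)
    thus ?thesis using integral_cgauss_exp(2) by simp
  qed
  note var = gauss_sample_mean_variance[OF N k h i i2 i2b]
  have pm: "power_mean N \<sigma> r k x - r\<^sup>2 = (\<Sum>m=1..N. h (x m k)) / real N" for x
  proof -
    have "(cmod (r + \<sigma> * z))\<^sup>2 = h z + (r\<^sup>2 + 2 * \<sigma>\<^sup>2)" for z :: complex
      unfolding h_def cmod_power2 by (simp add: power2_eq_square algebra_simps)
    hence "(\<Sum>m=1..N. (cmod (r + \<sigma> * x m k))\<^sup>2) = (\<Sum>m=1..N. h (x m k)) + real N * (r\<^sup>2 + 2 * \<sigma>\<^sup>2)"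
      by (simp add: sum.distrib)
    thus ?thesis unfolding power_mean_def using N by (simp add: field_simps)
  qed
  have le: "(sqrt (max 0 (power_mean N \<sigma> r k x)) - r)\<^sup>2 \<le> ((\<Sum>m=1..N. h (x m k)) / real N)\<^sup>2 / r\<^sup>2" for x
  proof -
    define q where "q = sqrt (max 0 (power_mean N \<sigma> r k x))"
    have q: "q \<ge> 0" "q\<^sup>2 = max 0 (power_mean N \<sigma> r k x)" unfolding q_def by auto
    have "\<bar>q - r\<bar> * r \<le> \<bar>q - r\<bar> * (q + r)" using q by (intro mult_left_mono) auto
    also have "\<dots> = \<bar>(q - r) * (q + r)\<bar>" using q r by (simp add: abs_mult)
    also have "(q - r) * (q + r) = q\<^sup>2 - r\<^sup>2" by (simp add: power2_eq_square algebra_simps)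
    also have "\<bar>q\<^sup>2 - r\<^sup>2\<bar> \<le> \<bar>power_mean N \<sigma> r k x - r\<^sup>2\<bar>" 
      unfolding q(2) using zero_le_power2[of r] by linarith
    finally have "(\<bar>q - r\<bar> * r)\<^sup>2 \<le> \<bar>power_mean N \<sigma> r k x - r\<^sup>2\<bar>\<^sup>2" using r by (intro power_mono) auto
    hence "(q - r)\<^sup>2 * r\<^sup>2 \<le> ((\<Sum>m=1..N. h (x m k)) / real N)\<^sup>2" by (simp only: power_mult_distrib pm power2_abs)
    moreover have "0 < r\<^sup>2" using r by simp
    ultimately show ?thesis by (simp only: pos_le_divide_eq q_def)
  qed
  have pmm: "power_mean N \<sigma> r k \<in> borel_measurable ?O"
  proof -
    have [measurable]: "(\<lambda>x. x m k) \<in> borel_measurable ?O" if "m \<in> {1..N}" for m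
      using gauss_sample_component2[OF that k] .
    show ?thesis unfolding power_mean_def[abs_def] by measurable
  qed
  have vi: "integrable ?O (\<lambda>x. ((\<Sum>m=1..N. h (x m k)) / real N)\<^sup>2 / r\<^sup>2)" using var(1) by simp
  show int: "integrable ?O (\<lambda>x. (sqrt (max 0 (power_mean N \<sigma> r k x)) - r)\<^sup>2)"
  proof (rule Bochner_Integration.integrable_bound[OF vi])
    show "(\<lambda>x. (sqrt (max 0 (power_mean N \<sigma> r k x)) - r)\<^sup>2) \<in> borel_measurable ?O" using pmm by measurable
    show "AE x in ?O. norm ((sqrt (max 0 (power_mean N \<sigma> r k x)) - r)\<^sup>2) \<le> norm (((\<Sum>m=1..N. h (x m k)) / real N)\<^sup>2 / r\<^sup>2)"
      using le by (intro AE_I2) (auto intro: order.trans[OF _ abs_ge_self])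
  qed
  have "(\<integral>x. (sqrt (max 0 (power_mean N \<sigma> r k x)) - r)\<^sup>2 \<partial>?O) \<le> (\<integral>x. ((\<Sum>m=1..N. h (x m k)) / real N)\<^sup>2 / r\<^sup>2 \<partial>?O)"
    by (intro integral_mono int vi le)
  also have "\<dots> \<le> (B / real N) / r\<^sup>2" using divide_right_mono[OF var(2), of "r\<^sup>2"] by simp
  also have "\<dots> = 136 * (\<sigma>\<^sup>2 / real N + \<sigma> ^ 4 / (real N * r\<^sup>2))" 
    unfolding B_def using r by (simp add: add_divide_distrib distrib_left)
  finally show "(\<integral>x. (sqrt (max 0 (power_mean N \<sigma> r k x)) - r)\<^sup>2 \<partial>?O) \<le> 136 * (\<sigma>\<^sup>2 / real N + \<sigma> ^ 4 / (real N * r\<^sup>2))" .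
qed

subsection \<open>Loss and phase unwrapping\<close>

lemma two_minus_two_cos_le: "2 - 2 * cos t \<le> t\<^sup>2" "2 - 2 * cos t \<le> (4::real)"
proof -
  have "2 - 2 * cos t = (2 * sin (t / 2))\<^sup>2"
    using cos_double_sin[of "t / 2"] by (simp add: power_mult_distrib)
  also have "\<dots> \<le> (2 * (t / 2))\<^sup>2"
    unfolding power_mult_distrib using abs_sin_x_le_abs_x[of "t / 2"]
    by (intro mult_left_mono abs_le_square_iff[THEN iffD1]) auto
  finally show "2 - 2 * cos t \<le> t\<^sup>2" by simp
  show "2 - 2 * cos t \<le> 4" using cos_ge_minus_one[of t] by linarith
qed

lemma act_from_polar: "act \<alpha> (from_polar r \<phi>) k = from_polar r (\<lambda>k. \<phi> k + real k * \<alpha>) k"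
  by (simp add: vec_eq_iff forall_2 act_def from_polar_def rotation_def matrix_vector_mult_def sum_2
        cos_add sin_add algebra_simps)

lemma norm_from_polar: "(norm (from_polar r \<phi> k))\<^sup>2 = (r k)\<^sup>2"
proof -
  have "(norm (from_polar r \<phi> k))\<^sup>2 = (r k * cos (\<phi> k))\<^sup>2 + (r k * sin (\<phi> k))\<^sup>2"
    by (simp add: norm_vec_def L2_set_def sum_2 from_polar_def)
  also have "\<dots> = (r k)\<^sup>2 * ((sin (\<phi> k))\<^sup>2 + (cos (\<phi> k))\<^sup>2)"
    by (simp only: power_mult_distrib distrib_left add.commute)
  finally show ?thesis by simp
qed

lemma power2_sum_le: "(a + b)\<^sup>2 \<le> 2 * a\<^sup>2 + 2 * (b::real)\<^sup>2"
  using sum_squares_bound[of a b] by (simp add: power2_sum)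

text \<open>Radial and angular error are separated; \<open>2 - 2 * cos\<close> is the squared chord
  between two points of the unit circle.\<close>

lemma from_polar_diff_le:
  "(norm (from_polar r' \<phi>' k - from_polar r \<phi> k))\<^sup>2 \<le> 2 * (r' k - r k)\<^sup>2 + 2 * (r k)\<^sup>2 * (2 - 2 * cos (\<phi>' k - \<phi> k))"
proof -
  define a b where "a = \<phi>' k" and "b = \<phi> k"
  define x y where "x = (r' k - r k) * cos a" and "y = r k * (cos a - cos b)"
  define x' y' where "x' = (r' k - r k) * sin a" and "y' = r k * (sin a - sin b)"
  have "(norm (from_polar r' \<phi>' k - from_polar r \<phi> k))\<^sup>2 = (x + y)\<^sup>2 + (x' + y')\<^sup>2"
    by (simp add: norm_vec_def L2_set_def sum_2 from_polar_def x_def y_def x'_def y'_def a_def b_def algebra_simps)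
  also have "\<dots> \<le> 2 * (x\<^sup>2 + x'\<^sup>2) + 2 * (y\<^sup>2 + y'\<^sup>2)"
    by (rule order.trans[OF add_mono[OF power2_sum_le power2_sum_le]]) (simp add: algebra_simps)
  also have "x\<^sup>2 + x'\<^sup>2 = (r' k - r k)\<^sup>2 * ((sin a)\<^sup>2 + (cos a)\<^sup>2)"
    by (simp only: x_def x'_def power_mult_distrib) (simp only: distrib_left add.commute)
  also have "y\<^sup>2 + y'\<^sup>2 = (r k)\<^sup>2 * (((sin a)\<^sup>2 + (cos a)\<^sup>2) + ((sin b)\<^sup>2 + (cos b)\<^sup>2) - 2 * cos (a - b))"
    by (simp only: y_def y'_def power_mult_distrib power2_diff cos_diff) (simp only: algebra_simps)
  finally show ?thesis by (simp add: a_def b_def)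
qed

text \<open>Any real angle can be reduced to \<open>[-pi, pi)\<close>: block indices are integers,
  so a full turn of \<open>\<alpha>\<close> changes every phase by a multiple of
  \<open>2 * pi\<close>.\<close>

lemma loss_le_any:
  fixes \<alpha> :: real
  shows "loss K \<theta>' (from_polar r \<phi>) \<le> sq_norm K (\<lambda>k. \<theta>' k - from_polar r (\<lambda>k. \<phi> k + real k * \<alpha>) k)"
proof -
  define n where "n = \<lfloor>(\<alpha> + pi) / (2 * pi)\<rfloor>"
  define \<beta> where "\<beta> = \<alpha> - 2 * pi * of_int n"
  have "of_int n \<le> (\<alpha> + pi) / (2 * pi)" "(\<alpha> + pi) / (2 * pi) < of_int n + 1" unfolding n_def by linarith+
  hence "of_int n * (2 * pi) \<le> \<alpha> + pi" "\<alpha> + pi < (of_int n + 1) * (2 * pi)"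
    using pi_gt_zero by (simp_all add: field_simps)
  hence \<beta>: "\<beta> \<in> {-pi..<pi}" by (auto simp: \<beta>_def algebra_simps)
  have eq: "from_polar r (\<lambda>k. \<phi> k + real k * \<beta>) k = from_polar r (\<lambda>k. \<phi> k + real k * \<alpha>) k" for k
  proof -
    have "\<phi> k + real k * \<alpha> = (\<phi> k + real k * \<beta>) + 2 * pi * of_int (int k * n)"
      by (simp add: \<beta>_def algebra_simps)
    moreover have "cos (x + 2 * pi * of_int j) = cos x" "sin (x + 2 * pi * of_int j) = sin x" for x and j :: int
      by (simp_all add: cos_add sin_add)
    ultimately show ?thesis by (simp only: from_polar_def)
  qed
  have "loss K \<theta>' (from_polar r \<phi>) \<le> sq_norm K (\<lambda>k. \<theta>' k - act \<beta> (from_polar r \<phi>) k)"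
    unfolding loss_def using \<beta> by (intro cINF_lower bdd_belowI[of _ 0]) (auto simp: sq_norm_def intro!: sum_nonneg)
  thus ?thesis unfolding act_from_polar eq .
qed

lemma loss_polar_le:
  assumes "\<And>k. k \<in> {1..K} \<Longrightarrow> \<phi>' k = \<phi> k + real k * \<alpha> + 2 * pi * of_int (j k) + d k"
  shows "loss K (from_polar r' \<phi>') (from_polar r \<phi>) \<le> (\<Sum>k=1..K. 2 * (r' k - r k)\<^sup>2 + 2 * (r k)\<^sup>2 * (d k)\<^sup>2)"
proof -
  have "loss K (from_polar r' \<phi>') (from_polar r \<phi>) \<le> (\<Sum>k=1..K. (norm (from_polar r' \<phi>' k - from_polar r (\<lambda>k. \<phi> k + real k * \<alpha>) k))\<^sup>2)"
    using loss_le_any unfolding sq_norm_def .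
  also have "\<dots> \<le> (\<Sum>k=1..K. 2 * (r' k - r k)\<^sup>2 + 2 * (r k)\<^sup>2 * (d k)\<^sup>2)"
  proof (intro sum_mono order.trans[OF from_polar_diff_le] add_mono order.refl mult_left_mono)
    fix k assume k: "k \<in> {1..K}"
    have "cos (\<phi>' k - (\<phi> k + real k * \<alpha>)) = cos (d k + 2 * pi * of_int (j k))" using assms[OF k] by (simp add: algebra_simps)
    also have "\<dots> = cos (d k)" by (simp add: cos_add)
    finally show "2 - 2 * cos (\<phi>' k - (\<phi> k + real k * \<alpha>)) \<le> (d k)\<^sup>2" using two_minus_two_cos_le(1)[of "d k"] by simp
  qed auto
  finally show ?thesis .
qed

text \<open>For the bad event, where nothing is known about the phases.\<close>

lemma loss_polar_le_crude:
  "loss K (from_polar r' \<phi>') (from_polar r \<phi>) \<le> (\<Sum>k=1..K. 2 * (r' k - r k)\<^sup>2 + 2 * (r k)\<^sup>2 * 4)"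
proof -
  have "loss K (from_polar r' \<phi>') (from_polar r \<phi>) \<le> (\<Sum>k=1..K. (norm (from_polar r' \<phi>' k - from_polar r (\<lambda>k. \<phi> k + real k * 0) k))\<^sup>2)"
    using loss_le_any unfolding sq_norm_def .
  also have "\<dots> \<le> (\<Sum>k=1..K. 2 * (r' k - r k)\<^sup>2 + 2 * (r k)\<^sup>2 * 4)"
    by (intro sum_mono order.trans[OF from_polar_diff_le] add_mono order.refl mult_left_mono two_minus_two_cos_le(2)) auto
  finally show ?thesis .
qed

section \<open>Selecting versions of the arguments\<close>

lemma princ_arg_rcis:
  assumes "z = of_real \<rho> * cis v" "\<rho> > 0"
  obtains j :: int where "princ_arg z = v + 2 * pi * of_int j"
proof -
  have z: "z \<noteq> 0" using assms by auto
  have "sgn z = cis v" using assms by (simp add: sgn_mult sgn_of_real)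
  hence "cis (Arg z) = cis v" using cis_Arg[OF z] by simp
  hence "cos (Arg z) = cos v" "sin (Arg z) = sin v" by (simp_all add: complex_eq_iff)
  hence "\<exists>n::int. Arg z = v + 2 * pi * n" using sin_cos_eq_iff[of "Arg z" v] by (metis)
  then obtain n :: int where n: "Arg z = v + 2 * pi * of_int n" by blast
  show ?thesis
  proof (cases "Arg z = pi")
    case True
    thus ?thesis using that[of "n - 1"] n by (simp add: princ_arg_def algebra_simps)
  next
    case False
    thus ?thesis using that[of n] n by (simp add: princ_arg_def)
  qed
qed

lemma arg_near_rcis:
  assumes z: "z = of_real \<rho> * cis v" "\<rho> > 0" and v: "c - pi \<le> v" "v < c + pi"
  shows "arg_near c z = v"
  unfolding arg_near_def
proof (rule the_equality)
  obtain j :: int where j: "princ_arg z = v + 2 * pi * of_int j" using princ_arg_rcis[OF z] by blast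
  show "v \<in> {c - pi..<c + pi} \<and> (\<exists>j::int. v - princ_arg z = 2 * pi * of_int j)"
    using v j by (auto intro!: exI[of _ "- j"])
  fix v' assume v': "v' \<in> {c - pi..<c + pi} \<and> (\<exists>j::int. v' - princ_arg z = 2 * pi * of_int j)"
  then obtain i :: int where "v' - princ_arg z = 2 * pi * of_int i" by blast
  hence d: "v' - v = 2 * pi * of_int (i + j)" using j by (simp add: algebra_simps)
  have "\<bar>v' - v\<bar> < 2 * pi" using v v' by auto
  hence "\<bar>of_int (i + j) :: real\<bar> < 1" unfolding d abs_mult using pi_gt_zero by simp
  hence "i + j = 0" by linarith
  thus "v' = v" using d by simp
qed

text \<open>The integers are fixed by the pairs \<open>(k, 1)\<close>. Passing from \<open>(k, l)\<close> to \<open>(k, l + 1)\<close> then changes the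
  defect by less than \<open>2 * \<eta>\<close>, too little for its nearest multiple of \<open>2 * pi\<close> to change.\<close>

lemma phase_lift:
  assumes "\<And>p. p \<in> index_pairs K \<Longrightarrow> \<exists>n::int. \<bar>phase_diff d p - 2 * pi * of_int n\<bar> < \<eta>" and \<eta>: "\<eta> \<le> pi / 2"
  obtains J :: "nat \<Rightarrow> int" where "\<And>p. p \<in> index_pairs K \<Longrightarrow> \<bar>phase_diff (\<lambda>k. d k - 2 * pi * of_int (J k)) p\<bar> < \<eta>"
proof -
  obtain n :: "nat \<times> nat \<Rightarrow> int" where n: "\<And>p. p \<in> index_pairs K \<Longrightarrow> \<bar>phase_diff d p - 2 * pi * of_int (n p)\<bar> < \<eta>"
    using assms(1) by metis
  define J where "J k = (\<Sum>i=1..<k. n (i, 1))" for k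
  define x where "x k = d k - 2 * pi * of_int (J k)" for k
  define e where "e k l = x (k + l) - x k - x l" for k l
  have J1: "J 1 = 0" and JS: "J (k + 1) = J k + n (k, 1)" if "k \<ge> 1" for k
    using that by (auto simp: J_def)
  have e_one: "\<bar>e k 1\<bar> < \<eta>" if "k \<ge> 1" "k + 1 \<le> K" for k
  proof -
    have "(k, 1) \<in> index_pairs K" using that by (auto simp: index_pairs_def)
    from n[OF this] show ?thesis using J1 JS[OF that(1)] that(1)
      by (simp add: e_def x_def phase_diff_def algebra_simps)
  qed
  have main: "\<bar>e k (Suc l)\<bar> < \<eta>" if "k \<ge> 1" "k + Suc l \<le> K" for k l
    using that(2)
  proof (induction l)
    case 0
    thus ?case using e_one[OF that(1)] by simp
  next
    case (Suc l)
    let ?l = "Suc l"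
    have IH: "\<bar>e k ?l\<bar> < \<eta>" using Suc by simp
    have a: "\<bar>e (k + ?l) 1\<bar> < \<eta>" and b: "\<bar>e ?l 1\<bar> < \<eta>" 
      using Suc.prems that(1) e_one[of "k + ?l"] e_one[of ?l] by auto
    have "e k (Suc ?l) = e k ?l + e (k + ?l) 1 - e ?l 1" by (simp add: e_def)
    hence small: "\<bar>e k (Suc ?l)\<bar> < 3 * \<eta>" using IH a b by linarith
    have p: "(k, Suc ?l) \<in> index_pairs K" using Suc.prems that(1) by (auto simp: index_pairs_def)
    define i where "i = n (k, Suc ?l) - (J (k + Suc ?l) - J k - J (Suc ?l))"
    have "e k (Suc ?l) - 2 * pi * of_int i = phase_diff d (k, Suc ?l) - 2 * pi * of_int (n (k, Suc ?l))"
      by (simp add: i_def e_def x_def phase_diff_def algebra_simps)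
    hence g: "\<bar>e k (Suc ?l) - 2 * pi * of_int i\<bar> < \<eta>" using n[OF p] by simp
    hence "\<bar>2 * pi * of_int i\<bar> < 4 * \<eta>" using small by linarith
    hence "\<bar>2 * pi * of_int i\<bar> < 2 * pi" using \<eta> by linarith
    hence "\<bar>of_int i :: real\<bar> < 1" unfolding abs_mult using pi_gt_zero by simp
    hence "i = 0" by linarith
    thus ?case using g by simp
  qed
  show ?thesis
  proof (rule that[of J])
    fix p assume p: "p \<in> index_pairs K"
    obtain k l where kl: "p = (k, l)" by force
    have "k \<ge> 1" "k + Suc (l - 1) \<le> K" "Suc (l - 1) = l" using p by (auto simp: kl index_pairs_def)
    with main[of k "l - 1"] show "\<bar>phase_diff (\<lambda>k. d k - 2 * pi * of_int (J k)) p\<bar> < \<eta>"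
      by (simp add: e_def x_def kl phase_diff_def)
  qed
qed

lemma circ_abs_le: "circ_abs x \<le> \<bar>x + 2 * pi * of_int j\<bar>"
  unfolding circ_abs_def by (intro cINF_lower bdd_belowI[of _ 0]) auto

lemma circ_abs_less:
  assumes "circ_abs x < c" obtains j :: int where "\<bar>x + 2 * pi * of_int j\<bar> < c"
  using assms unfolding circ_abs_def by (subst (asm) cINF_less_iff) (auto intro: bdd_belowI[of _ 0])

text \<open>The true phases are an admissible competitor of value at most \<open>pi / 6\<close>, so
  the minimiser does no worse and its phase differences agree with the true ones modulo
  \<open>2 * pi\<close> up to \<open>pi / 6 + pi / 5 = 11 * pi / 30\<close>. This is below
  \<open>pi / 2\<close>, so \<open>phase_lift\<close> yields integers consistent over all pairs;
  adding \<open>\<delta>\<close> keeps the distance below \<open>pi\<close>, which identifies the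
  chosen version.\<close>

lemma opt_phases_lift:
  assumes K: "K \<ge> 2" and B: "\<And>p. p \<in> index_pairs K \<Longrightarrow> \<exists>\<rho>>0. B_hat N y p = of_real \<rho> * cis (phase_diff \<phi> p + \<delta> p)"
    and \<delta>: "\<And>p. p \<in> index_pairs K \<Longrightarrow> \<bar>\<delta> p\<bar> \<le> pi / 6"
    and \<phi>: "\<forall>k\<in>{1..K}. \<phi> k \<in> {-pi..<pi}" and opt: "opt_phases K N y \<psi>"
  obtains J :: "nat \<Rightarrow> int" where "\<And>p. p \<in> index_pairs K \<Longrightarrow>
     arg_near (phase_diff \<psi> p) (B_hat N y p) = phase_diff (\<lambda>k. \<phi> k + 2 * pi * of_int (J k)) p + \<delta> p"
proof -
  let ?I = "index_pairs K"
  define f where "f \<phi>' = Max ((\<lambda>p. circ_abs (princ_arg (B_hat N y p) - phase_diff \<phi>' p)) ` ?I)" for \<phi>'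
  have "(1, 1) \<in> ?I" using K by (auto simp: index_pairs_def)
  hence ne: "?I \<noteq> {}" by auto
  have fle: "circ_abs (princ_arg (B_hat N y p) - phase_diff \<phi>' p) \<le> f \<phi>'" if "p \<in> ?I" for p \<phi>'
    unfolding f_def using that by (intro Max_ge) auto
  obtain \<rho> where \<rho>: "\<And>p. p \<in> ?I \<Longrightarrow> \<rho> p > 0 \<and> B_hat N y p = of_real (\<rho> p) * cis (phase_diff \<phi> p + \<delta> p)"
    using B by metis
  have "\<exists>j::int. princ_arg (B_hat N y p) = phase_diff \<phi> p + \<delta> p + 2 * pi * of_int j" if "p \<in> ?I" for p
    using princ_arg_rcis[of "B_hat N y p" "\<rho> p" "phase_diff \<phi> p + \<delta> p"] \<rho>[OF that] by metis
  then obtain j :: "nat \<times> nat \<Rightarrow> int" where j: "\<And>p. p \<in> ?I \<Longrightarrow> princ_arg (B_hat N y p) = phase_diff \<phi> p + \<delta> p + 2 * pi * of_int (j p)"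
    by metis
  have "f \<phi> \<le> pi / 6" unfolding f_def
  proof (subst Max_le_iff; (intro ballI)?)
    fix a assume "a \<in> (\<lambda>p. circ_abs (princ_arg (B_hat N y p) - phase_diff \<phi> p)) ` ?I"
    then obtain p where p: "p \<in> ?I" "a = circ_abs (princ_arg (B_hat N y p) - phase_diff \<phi> p)" by blast
    have "a \<le> \<bar>princ_arg (B_hat N y p) - phase_diff \<phi> p + 2 * pi * of_int (- j p)\<bar>" unfolding p(2) by (rule circ_abs_le)
    also have "\<dots> = \<bar>\<delta> p\<bar>" using j[OF p(1)] by simp
    finally show "a \<le> pi / 6" using \<delta>[OF p(1)] by linarith
  qed (use ne in auto)
  moreover have "f \<psi> \<le> f \<phi>"
    using opt \<phi> unfolding opt_phases_def f_def[abs_def] is_arg_min_def by (auto simp: not_less)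
  \<comment> \<open>The slack from \<open>pi / 6\<close> to \<open>pi / 5\<close> gives the strict
    inequality from which \<open>circ_abs_less\<close> extracts a shift realising the bound.\<close>
  ultimately have f\<psi>: "f \<psi> < pi / 5" using pi_gt_zero by linarith
  have lift: "\<exists>n::int. \<bar>phase_diff (\<lambda>k. \<psi> k - \<phi> k) p - 2 * pi * of_int n\<bar> < 11 * pi / 30" if p: "p \<in> ?I" for p
  proof -
    obtain i :: int where i: "\<bar>princ_arg (B_hat N y p) - phase_diff \<psi> p + 2 * pi * of_int i\<bar> < pi / 5"
      using circ_abs_less[of "princ_arg (B_hat N y p) - phase_diff \<psi> p" "pi / 5"] fle[OF p, of \<psi>] f\<psi> by (metis order.strict_trans1)
    define q where "q = phase_diff (\<lambda>k. \<psi> k - \<phi> k) p - 2 * pi * of_int (i + j p)"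
    have "q = \<delta> p - (princ_arg (B_hat N y p) - phase_diff \<psi> p + 2 * pi * of_int i)"
      unfolding q_def phase_diff_diff j[OF p] by (simp add: algebra_simps)
    hence "\<bar>q\<bar> < pi / 6 + pi / 5" using i \<delta>[OF p] by linarith
    thus ?thesis unfolding q_def by (intro exI[of _ "i + j p"]) simp
  qed
  have \<eta>: "11 * pi / 30 \<le> pi / 2" using pi_gt_zero by linarith
  obtain J :: "nat \<Rightarrow> int" where J: "\<And>p. p \<in> ?I \<Longrightarrow> \<bar>phase_diff (\<lambda>k. (\<psi> k - \<phi> k) - 2 * pi * of_int (J k)) p\<bar> < 11 * pi / 30"
    using phase_lift[where K = K and d = "\<lambda>k. \<psi> k - \<phi> k", OF lift \<eta>] by blast
  show ?thesis
  proof (rule that[of J])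
    fix p assume p: "p \<in> ?I"
    obtain k l where kl: "p = (k, l)" by force
    define v where "v = phase_diff (\<lambda>k. \<phi> k + 2 * pi * of_int (J k)) p + \<delta> p"
    have v: "v = phase_diff \<phi> p + \<delta> p + 2 * pi * of_int (J (k + l) - J k - J l)"
      by (simp add: v_def kl phase_diff_def algebra_simps)
    have "cis v = cis (phase_diff \<phi> p + \<delta> p)" 
      unfolding v cis_mult[symmetric, of _ "2 * pi * of_int (J (k + l) - J k - J l)"]
      by (simp only: cis_multiple_2pi[OF Ints_of_int] mult_1_right)
    hence B': "B_hat N y p = of_real (\<rho> p) * cis v" "\<rho> p > 0" using \<rho>[OF p] by auto
    have "phase_diff \<psi> p - v = phase_diff (\<lambda>k. (\<psi> k - \<phi> k) - 2 * pi * of_int (J k)) p - \<delta> p"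
      by (simp add: v_def kl phase_diff_def algebra_simps)
    hence "\<bar>phase_diff \<psi> p - v\<bar> < 11 * pi / 30 + pi / 6" using J[OF p] \<delta>[OF p] by linarith
    hence "\<bar>phase_diff \<psi> p - v\<bar> < pi" using pi_gt_zero by linarith
    hence "arg_near (phase_diff \<psi> p) (B_hat N y p) = v" by (intro arg_near_rcis[OF B']) linarith+
    thus "arg_near (phase_diff \<psi> p) (B_hat N y p) = phase_diff (\<lambda>k. \<phi> k + 2 * pi * of_int (J k)) p + \<delta> p"
      by (simp add: v_def)
  qed
qed

subsection \<open>The risk bound\<close>

text \<open>The noise of block \<open>k\<close> of sample \<open>m\<close>, seen in the frame in which the signal is real and positive.\<close>

definition framed_noise :: "nat \<Rightarrow> nat \<Rightarrow> (nat \<Rightarrow> real) \<Rightarrow> sample \<Rightarrow> nat \<Rightarrow> nat \<Rightarrow> complex" where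
  "framed_noise K N \<phi> \<omega> = rotate_noise K N (\<lambda>m k. cis (- (\<phi> k + real k * fst \<omega> m))) (snd \<omega>)"

lemma ytilde_obs:
  assumes "m \<in> {1..N}" "k \<in> {1..K}"
  shows "ytilde (obs \<sigma> (from_polar r \<phi>) \<omega>) m k =
    cis (\<phi> k + real k * fst \<omega> m) * (r k + \<sigma> * framed_noise K N \<phi> \<omega> m k)"
proof -
  define a where "a = \<phi> k + real k * fst \<omega> m"
  define z where "z = Complex (snd \<omega> (m, k, 1)) (snd \<omega> (m, k, 2))"
  have "ytilde (obs \<sigma> (from_polar r \<phi>) \<omega>) m k = r k * cis a + \<sigma> * z"
    by (simp add: ytilde_def obs_def act_from_polar from_polar_def a_def z_def complex_eq_iff)
  also have "\<dots> = r k * cis a + \<sigma> * ((cis a * cis (- a)) * z)" by (simp add: cis_mult)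
  also have "\<dots> = cis a * (r k + \<sigma> * (cis (- a) * z))" by (simp only: distrib_left mult_ac)
  finally show ?thesis using assms by (simp add: framed_noise_def rotate_noise_def a_def z_def)
qed

lemma r_hat_obs:
  assumes "k \<in> {1..K}"
  shows "r_hat N \<sigma> (obs \<sigma> (from_polar r \<phi>) \<omega>) k = sqrt (max 0 (power_mean N \<sigma> (r k) k (framed_noise K N \<phi> \<omega>)))"
proof -
  have "(\<Sum>m=1..N. (cmod (ytilde (obs \<sigma> (from_polar r \<phi>) \<omega>) m k))\<^sup>2) = (\<Sum>m=1..N. (cmod (r k + \<sigma> * framed_noise K N \<phi> \<omega> m k))\<^sup>2)"
  proof (rule sum.cong[OF refl])
    fix m assume "m \<in> {1..N}"
    from ytilde_obs[OF this assms] show "(cmod (ytilde (obs \<sigma> (from_polar r \<phi>) \<omega>) m k))\<^sup>2 = (cmod (r k + \<sigma> * framed_noise K N \<phi> \<omega> m k))\<^sup>2"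
      by (simp only: norm_mult norm_cis mult_1)
  qed
  thus ?thesis by (simp only: r_hat_def power_mean_def)
qed

text \<open>The rotation angle drops out because it enters with the factor
  \<open>(k + l) - k - l = 0\<close>.\<close>

lemma B_hat_obs:
  assumes p: "p \<in> index_pairs K" and N: "N \<ge> 1" and r: "\<And>k. k \<in> {1..K} \<Longrightarrow> r k > 0"
  shows "\<exists>c>0. B_hat N (obs \<sigma> (from_polar r \<phi>) \<omega>) p =
    of_real c * cis (phase_diff \<phi> p) * (1 + triple_mean (\<lambda>k. \<sigma> / r k) N p (framed_noise K N \<phi> \<omega>))"
proof -
  obtain k l where kl: "p = (k, l)" by force
  have mem: "k + l \<in> {1..K}" "k \<in> {1..K}" "l \<in> {1..K}" using p by (auto simp: kl index_pairs_def)
  define x where "x = framed_noise K N \<phi> \<omega>"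
  define s where "s k = \<sigma> / r k" for k
  define c where "c = r (k + l) * r k * r l"
  have c: "c > 0" using r mem by (simp add: c_def)
  have summand: "ytilde (obs \<sigma> (from_polar r \<phi>) \<omega>) m (k + l) * cnj (ytilde (obs \<sigma> (from_polar r \<phi>) \<omega>) m k) * cnj (ytilde (obs \<sigma> (from_polar r \<phi>) \<omega>) m l)
    = of_real c * cis (phase_diff \<phi> p) * (1 + triple s p (x m))" if m: "m \<in> {1..N}" for m
  proof -
    have f: "of_real (r j) + of_real \<sigma> * z = of_real (r j) * (1 + of_real (s j) * z)" if "j \<in> {1..K}" for j and z :: complex
      using r[OF that] by (simp add: s_def field_simps)
    define a where "a j = \<phi> j + real j * fst \<omega> m" for j
    have "a (k + l) - a k - a l = phase_diff \<phi> p" by (simp add: a_def kl phase_diff_def algebra_simps)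
    moreover have "cis (a (k + l)) * cis (- a k) * cis (- a l) = cis (a (k + l) - a k - a l)" by (simp add: cis_mult algebra_simps)
    ultimately have cisp: "cis (a (k + l)) * cis (- a k) * cis (- a l) = cis (phase_diff \<phi> p)" by simp
    have "ytilde (obs \<sigma> (from_polar r \<phi>) \<omega>) m j = cis (a j) * (of_real (r j) * (1 + of_real (s j) * x m j))" if "j \<in> {1..K}" for j
      unfolding ytilde_obs[OF m that] x_def[symmetric] a_def[symmetric] f[OF that] ..
    hence "ytilde (obs \<sigma> (from_polar r \<phi>) \<omega>) m (k + l) * cnj (ytilde (obs \<sigma> (from_polar r \<phi>) \<omega>) m k) * cnj (ytilde (obs \<sigma> (from_polar r \<phi>) \<omega>) m l)
      = (cis (a (k + l)) * cis (- a k) * cis (- a l)) * of_real c * (1 + triple s p (x m))"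
      using mem by (simp add: kl triple_def c_def cis_cnj mult_ac)
    thus ?thesis unfolding cisp by (simp only: mult_ac)
  qed
  have "B_hat N (obs \<sigma> (from_polar r \<phi>) \<omega>) p = (1 / of_nat N) * (\<Sum>m=1..N. of_real c * cis (phase_diff \<phi> p) * (1 + triple s p (x m)))"
    unfolding B_hat_def kl prod.case
    by (rule arg_cong[where f = "(*) (1 / of_nat N)"], rule sum.cong[OF refl], rule summand[unfolded kl])
  also have "\<dots> = of_real c * cis (phase_diff \<phi> p) * ((of_nat N + (\<Sum>m=1..N. triple s p (x m))) / of_nat N)"
    by (simp add: sum_distrib_left[symmetric] sum.distrib)
  also have "(of_nat N + (\<Sum>m=1..N. triple s p (x m))) / of_nat N = 1 + triple_mean s N p x"
    using N by (simp add: triple_mean_def add_divide_distrib)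
  finally show ?thesis using c unfolding s_def x_def by blast
qed

lemma B_hat_obs_polar:
  assumes p: "p \<in> index_pairs K" and N: "N \<ge> 1" and r: "\<And>k. k \<in> {1..K} \<Longrightarrow> r k > 0"
    and good: "cmod (triple_mean (\<lambda>k. \<sigma> / r k) N p (framed_noise K N \<phi> \<omega>)) \<le> 1/2"
  shows "\<exists>\<rho>>0. B_hat N (obs \<sigma> (from_polar r \<phi>) \<omega>) p =
    of_real \<rho> * cis (phase_diff \<phi> p + psi (triple_mean (\<lambda>k. \<sigma> / r k) N p (framed_noise K N \<phi> \<omega>)))"
proof -
  define z where "z = triple_mean (\<lambda>k. \<sigma> / r k) N p (framed_noise K N \<phi> \<omega>)"
  obtain c where c: "c > 0" "B_hat N (obs \<sigma> (from_polar r \<phi>) \<omega>) p = of_real c * cis (phase_diff \<phi> p) * (1 + z)"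
    using B_hat_obs[where K = K and r = r, OF p N r] unfolding z_def by blast
  have ne: "1 + z \<noteq> 0"
  proof
    assume "1 + z = 0"
    hence "z = -1" by (simp add: add_eq_0_iff)
    thus False using good by (simp add: z_def[symmetric])
  qed
  have "1 + z = of_real (cmod (1 + z)) * cis (psi z)"
    using cis_Arg[OF ne] ne psi_eq_Arg(1)[OF good[folded z_def]] by (simp add: sgn_eq)
  hence "of_real c * cis (phase_diff \<phi> p) * (1 + z) = of_real c * cis (phase_diff \<phi> p) * (of_real (cmod (1 + z)) * cis (psi z))"
    by (rule arg_cong)
  hence "B_hat N (obs \<sigma> (from_polar r \<phi>) \<omega>) p = of_real (c * cmod (1 + z)) * (cis (phase_diff \<phi> p) * cis (psi z))"
    unfolding c(2) of_real_mult by (simp only: mult_ac)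
  moreover have "c * cmod (1 + z) > 0" using c ne by simp
  ultimately show ?thesis unfolding z_def[symmetric] cis_mult by blast
qed

section \<open>Expectation of a majorant of the loss\<close>

text \<open>A function of the framed noise alone that dominates the loss of both estimators. It is
  measurable even where a selection of minimisers is not. The sum of indicators stands for the bad
  event, and 4 is the maximum of \<open>2 - 2 * cos\<close>.\<close>

definition loss_majorant :: "nat \<Rightarrow> nat \<Rightarrow> real \<Rightarrow> (nat \<Rightarrow> real) \<Rightarrow> (nat \<Rightarrow> nat \<Rightarrow> complex) \<Rightarrow> real" where
  "loss_majorant K N \<sigma> r x = (\<Sum>k=1..K. 2 * (sqrt (max 0 (power_mean N \<sigma> (r k) k x)) - r k)\<^sup>2 +
     2 * (r k)\<^sup>2 * ((phase_noise (pinv (index_pairs K) {1..K} phase_mat k) (\<lambda>k. \<sigma> / r k) K N x)\<^sup>2 +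
       4 * (\<Sum>p\<in>index_pairs K. indicator {x \<in> space (gauss_sample K N). 1/2 < cmod (triple_mean (\<lambda>k. \<sigma> / r k) N p x)} x)))"

text \<open>The assumption \<open>phases\<close> isolates what the oracle and the optimised
  reference have in common: on the good event the chosen versions come from the true phases shifted
  by integer multiples of \<open>2 * pi\<close>, plus the small errors.\<close>

lemma loss_mom_le_majorant:
  assumes K: "K \<ge> 2" and N: "N \<ge> 1" and r: "\<And>k. k \<in> {1..K} \<Longrightarrow> r k > 0"
    and x: "framed_noise K N \<phi> \<omega> \<in> space (gauss_sample K N)"
    and phases: "\<And>\<delta>. (\<And>p. p \<in> index_pairs K \<Longrightarrow> \<exists>\<rho>>0. B_hat N (obs \<sigma> (from_polar r \<phi>) \<omega>) p = of_real \<rho> * cis (phase_diff \<phi> p + \<delta> p)) \<Longrightarrow>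
       (\<And>p. p \<in> index_pairs K \<Longrightarrow> \<bar>\<delta> p\<bar> \<le> pi / 6) \<Longrightarrow>
       \<exists>J :: nat \<Rightarrow> int. \<forall>p\<in>index_pairs K. arg_near (phase_diff \<psi> p) (B_hat N (obs \<sigma> (from_polar r \<phi>) \<omega>) p) =
          phase_diff (\<lambda>k. \<phi> k + 2 * pi * of_int (J k)) p + \<delta> p"
  shows "loss K (mom_estimator K N \<sigma> (obs \<sigma> (from_polar r \<phi>) \<omega>) \<psi>) (from_polar r \<phi>) \<le> loss_majorant K N \<sigma> r (framed_noise K N \<phi> \<omega>)"
proof -
  let ?I = "index_pairs K"
  define X where "X = framed_noise K N \<phi> \<omega>"
  define y where "y = obs \<sigma> (from_polar r \<phi>) \<omega>"
  define s where "s k = \<sigma> / r k" for k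
  define bad where "bad p = {x \<in> space (gauss_sample K N). 1/2 < cmod (triple_mean s N p x)}" for p
  define F where "F k = phase_noise (pinv ?I {1..K} phase_mat k) s K N X" for k
  define rh where "rh = r_hat N \<sigma> y"
  define ph where "ph = phi_hat K (\<lambda>p. arg_near (phase_diff \<psi> p) (B_hat N y p))"
  have rh: "rh k = sqrt (max 0 (power_mean N \<sigma> (r k) k X))" if "k \<in> {1..K}" for k
    unfolding rh_def y_def X_def by (rule r_hat_obs[OF that])
  have maj: "loss_majorant K N \<sigma> r X = (\<Sum>k=1..K. 2 * (rh k - r k)\<^sup>2 + 2 * (r k)\<^sup>2 * ((F k)\<^sup>2 + 4 * (\<Sum>p\<in>?I. indicator (bad p) X)))"
    unfolding loss_majorant_def F_def bad_def s_def[abs_def] by (intro sum.cong refl) (simp only: rh)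
  have "loss K (from_polar rh ph) (from_polar r \<phi>) \<le> loss_majorant K N \<sigma> r X"
  proof (cases "\<exists>p\<in>?I. 1/2 < cmod (triple_mean s N p X)")
    case True
    then obtain p where p: "p \<in> ?I" "1/2 < cmod (triple_mean s N p X)" by blast
    have "(1::real) = indicator (bad p) X" using p x by (simp add: bad_def X_def)
    also have "\<dots> \<le> (\<Sum>p\<in>?I. indicator (bad p) X)" using p(1) by (intro member_le_sum) auto
    finally have one: "(1::real) \<le> (\<Sum>p\<in>?I. indicator (bad p) X)" .
    have "loss K (from_polar rh ph) (from_polar r \<phi>) \<le> (\<Sum>k=1..K. 2 * (rh k - r k)\<^sup>2 + 2 * (r k)\<^sup>2 * 4)"
      by (rule loss_polar_le_crude)
    also have "\<dots> \<le> loss_majorant K N \<sigma> r X"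
      unfolding maj
    proof (intro sum_mono add_mono order.refl mult_left_mono)
      fix k show "4 \<le> (F k)\<^sup>2 + 4 * (\<Sum>p\<in>?I. indicator (bad p) X)"
        using one zero_le_power2[of "F k"] by linarith
    qed auto
    finally show ?thesis .
  next
    case False
    hence good: "cmod (triple_mean s N p X) \<le> 1/2" if "p \<in> ?I" for p using that by force
    define \<delta> where "\<delta> p = psi (triple_mean s N p X)" for p
    have "\<exists>\<rho>>0. B_hat N y p = of_real \<rho> * cis (phase_diff \<phi> p + \<delta> p)" if "p \<in> ?I" for p
      using B_hat_obs_polar[where K = K and r = r, OF that N r] good[OF that]
      unfolding y_def \<delta>_def X_def s_def[abs_def] by blast
    moreover have "\<bar>\<delta> p\<bar> \<le> pi / 6" if "p \<in> ?I" for p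
      unfolding \<delta>_def by (rule psi_eq_Arg(2)[OF good[OF that]])
    ultimately obtain J :: "nat \<Rightarrow> int" where J: "\<forall>p\<in>?I. arg_near (phase_diff \<psi> p) (B_hat N y p) =
          phase_diff (\<lambda>k. \<phi> k + 2 * pi * of_int (J k)) p + \<delta> p"
      using phases[of \<delta>] unfolding y_def by blast
    \<comment> \<open>The rotation by which least squares misses the lifted true phases, as given by
      \<open>pinv_phase_diff\<close>.\<close>
    define a where "a = - ((\<Sum>j=1..K. real j * (\<phi> j + 2 * pi * of_int (J j))) / sum_sq K)"
    have ph: "ph k = \<phi> k + real k * a + 2 * pi * of_int (J k) + F k" if k: "k \<in> {1..K}" for k
    proof -
      let ?P = "pinv ?I {1..K} phase_mat k"
      have "ph k = (\<Sum>p\<in>?I. ?P p * (phase_diff (\<lambda>k. \<phi> k + 2 * pi * of_int (J k)) p + \<delta> p))"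
        unfolding ph_def phi_hat_def using J by (intro sum.cong refl) simp
      also have "\<dots> = (\<Sum>p\<in>?I. ?P p * phase_diff (\<lambda>k. \<phi> k + 2 * pi * of_int (J k)) p) + F k"
        unfolding F_def phase_noise_def \<delta>_def by (simp add: distrib_left sum.distrib)
      also have "(\<Sum>p\<in>?I. ?P p * phase_diff (\<lambda>k. \<phi> k + 2 * pi * of_int (J k)) p) =
          (\<phi> k + 2 * pi * of_int (J k)) - real k / sum_sq K * (\<Sum>j=1..K. real j * (\<phi> j + 2 * pi * of_int (J j)))"
        using K k by (intro pinv_phase_diff) auto
      finally show ?thesis by (simp add: a_def)
    qed
    have "loss K (from_polar rh ph) (from_polar r \<phi>) \<le> (\<Sum>k=1..K. 2 * (rh k - r k)\<^sup>2 + 2 * (r k)\<^sup>2 * (F k)\<^sup>2)"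
      by (rule loss_polar_le[OF ph])
    also have "\<dots> \<le> loss_majorant K N \<sigma> r X"
      unfolding maj by (intro sum_mono add_mono order.refl mult_left_mono) (auto intro!: sum_nonneg)
    finally show ?thesis .
  qed
  thus ?thesis unfolding mom_estimator_def rh_def ph_def y_def X_def .
qed

text \<open>In \<open>C\<close>, 272 is twice the magnitude constant 136;
  \<open>10 ^ 16 * 2000\<^sup>2\<close> is the phase constant at row norm 2000, and
  \<open>4 * tail_const\<close> accounts for the bad event.\<close>

lemma loss_majorant_expectation:
  assumes K: "K \<ge> 2" and N: "N \<ge> 1" and \<sigma>: "\<sigma> > 0" and r0: "r0 > 0" and r: "\<And>k. k \<in> {1..K} \<Longrightarrow> r k \<ge> r0"
    and hyp: "real N \<ge> 50000 ^ 3 * (\<sigma>^6 / r0^6 * ln (real K) + \<sigma>^3 / r0^3 * ln (real K) powr (3/2))"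
    and C: "C = 272 + 2 * (10 ^ 16 * 2000\<^sup>2 + 4 * tail_const)"
  shows "loss_majorant K N \<sigma> r \<in> borel_measurable (gauss_sample K N)"
    and "(\<integral>\<^sup>+x. ennreal (loss_majorant K N \<sigma> r x) \<partial>gauss_sample K N) \<le> ennreal (risk_bound C K N \<sigma> r0 (from_polar r \<phi>))"
proof -
  let ?O = "gauss_sample K N" and ?I = "index_pairs K"
  interpret O: prob_space ?O by (rule prob_space_gauss_sample)
  define S where "S = \<sigma> / r0"
  define s where "s k = \<sigma> / r k" for k
  have S: "S > 0" using \<sigma> r0 by (simp add: S_def)
  have rpos: "r k > 0" if "k \<in> {1..K}" for k using r[OF that] r0 by linarith
  have s: "0 \<le> s j \<and> s j \<le> S" if "j \<in> {1..K}" for j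
    using r[OF that] rpos[OF that] r0 \<sigma> by (auto simp: s_def S_def intro!: divide_left_mono)
  have hyp': "real N \<ge> 50000 ^ 3 * (S ^ 6 * ln (real K) + S ^ 3 * ln (real K) powr (3/2))"
    using hyp by (simp add: S_def power_divide)
  define bad where "bad p = {x \<in> space ?O. 1/2 < cmod (triple_mean s N p x)}" for p
  note tail = sum_bad_events_le[where s = s and S = S and K = K and N = N, OF K N S s hyp', folded bad_def]
  define F where "F k = phase_noise (pinv ?I {1..K} phase_mat k) s K N" for k
  define E where "E = S\<^sup>2 / real N + S ^ 6 / (real N * real K)"
  define R where "R k x = (sqrt (max 0 (power_mean N \<sigma> (r k) k x)) - r k)\<^sup>2" for k x
  have maj: "loss_majorant K N \<sigma> r x = (\<Sum>k=1..K. 2 * R k x + 2 * (r k)\<^sup>2 * ((F k x)\<^sup>2 + 4 * (\<Sum>p\<in>?I. indicator (bad p) x)))" for x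
    unfolding loss_majorant_def F_def bad_def s_def[abs_def] R_def ..
  have badm: "bad p \<in> sets ?O" if "p \<in> ?I" for p
  proof -
    have [measurable]: "triple_mean s N p \<in> borel_measurable ?O" using that by (rule measurable_triple_mean)
    show ?thesis unfolding bad_def by measurable
  qed
  have Ri: "integrable ?O (R k)" "(\<integral>x. R k x \<partial>?O) \<le> 136 * (\<sigma>\<^sup>2 / real N + \<sigma> ^ 4 / (real N * (r k)\<^sup>2))" if "k \<in> {1..K}" for k
    unfolding R_def[abs_def] by (rule magnitude_error[OF N that rpos[OF that]])+
  have Fm: "F k \<in> borel_measurable ?O" for k unfolding F_def by (rule measurable_phase_noise)
  have Fi: "integrable ?O (\<lambda>x. (F k x)\<^sup>2)" for k
  proof (rule O.integrable_const_bound)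
    define B where "B = (\<Sum>p\<in>?I. \<bar>pinv ?I {1..K} phase_mat k p\<bar> * 2)"
    have "\<bar>F k x\<bar> \<le> B" for x
      unfolding F_def phase_noise_def B_def
      by (rule order.trans[OF sum_abs]) (auto intro!: sum_mono mult_left_mono psi_bound simp: abs_mult)
    hence "(F k x)\<^sup>2 \<le> B\<^sup>2" for x using power_mono[of "\<bar>F k x\<bar>" B 2] by simp
    thus "AE x in ?O. norm ((F k x)\<^sup>2) \<le> B\<^sup>2" by simp
    show "(\<lambda>x. (F k x)\<^sup>2) \<in> borel_measurable ?O" using Fm by simp
  qed
  have Fb: "(\<integral>x. (F k x)\<^sup>2 \<partial>?O) \<le> 10 ^ 16 * 2000\<^sup>2 * E" if k: "k \<in> {1..K}" for k
    unfolding F_def E_def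
  proof (rule phase_noise_second_moment)
    show "(\<Sum>p\<in>?I. \<bar>pinv ?I {1..K} phase_mat k p\<bar>) \<le> 2000" using K k by (intro pinv_phase_mat_l1) auto
    show "\<bar>pinv ?I {1..K} phase_mat k p\<bar> \<le> 2000 / real K" if "p \<in> ?I" for p
      using K k that by (intro pinv_phase_mat_max) auto
  qed (use K N s tail(2) in auto)
  have Ii: "integrable ?O (\<lambda>x. \<Sum>p\<in>?I. indicator (bad p) x :: real)"
    using badm by (intro Bochner_Integration.integrable_sum) (auto simp: O.emeasure_eq_measure)
  have Ib: "(\<integral>x. (\<Sum>p\<in>?I. indicator (bad p) x :: real) \<partial>?O) \<le> tail_const * E"
  proof -
    have "(\<integral>x. (\<Sum>p\<in>?I. indicator (bad p) x :: real) \<partial>?O) = (\<Sum>p\<in>?I. \<integral>x. indicator (bad p) x \<partial>?O)"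
      using badm by (intro Bochner_Integration.integral_sum) (auto simp: O.emeasure_eq_measure)
    also have "\<dots> = (\<Sum>p\<in>?I. measure ?O (bad p))" using badm by (intro sum.cong refl) simp
    finally show ?thesis using tail(1) unfolding E_def by simp
  qed
  define G where "G k x = 2 * R k x + 2 * (r k)\<^sup>2 * ((F k x)\<^sup>2 + 4 * (\<Sum>p\<in>?I. indicator (bad p) x))" for k x
  have Gi: "integrable ?O (G k)" if "k \<in> {1..K}" for k
    unfolding G_def[abs_def] by (intro Bochner_Integration.integrable_add integrable_mult_right Ri(1)[OF that] Fi Ii)
  have Gb: "(\<integral>x. G k x \<partial>?O) \<le> C * (\<sigma>\<^sup>2 / real N + \<sigma> ^ 4 / (real N * r0\<^sup>2)) + C * (r k)\<^sup>2 * E" if k: "k \<in> {1..K}" for k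
  proof -
    have E0: "E \<ge> 0" unfolding E_def using S by simp
    have tc: "tail_const \<ge> 0" by (simp add: tail_const_def tail_rate_def)
    have "(\<integral>x. G k x \<partial>?O) = 2 * (\<integral>x. R k x \<partial>?O) + 2 * (r k)\<^sup>2 * ((\<integral>x. (F k x)\<^sup>2 \<partial>?O) + 4 * (\<integral>x. (\<Sum>p\<in>?I. indicator (bad p) x) \<partial>?O))"
      unfolding G_def using Ri(1)[OF k] Fi Ii by simp
    also have "\<dots> \<le> 2 * (136 * (\<sigma>\<^sup>2 / real N + \<sigma> ^ 4 / (real N * (r k)\<^sup>2))) + 2 * (r k)\<^sup>2 * (10 ^ 16 * 2000\<^sup>2 * E + 4 * (tail_const * E))"
      by (intro add_mono mult_left_mono Ri(2) Fb Ib k) auto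
    also have "\<dots> \<le> C * (\<sigma>\<^sup>2 / real N + \<sigma> ^ 4 / (real N * r0\<^sup>2)) + C * ((r k)\<^sup>2 * E)"
    proof (rule add_mono)
      have "\<sigma> ^ 4 / (real N * (r k)\<^sup>2) \<le> \<sigma> ^ 4 / (real N * r0\<^sup>2)"
        using N r[OF k] r0 rpos[OF k] by (intro divide_left_mono mult_left_mono power_mono) auto
      hence "2 * (136 * (\<sigma>\<^sup>2 / real N + \<sigma> ^ 4 / (real N * (r k)\<^sup>2))) \<le> 272 * (\<sigma>\<^sup>2 / real N + \<sigma> ^ 4 / (real N * r0\<^sup>2))" by simp
      also have "\<dots> \<le> C * (\<sigma>\<^sup>2 / real N + \<sigma> ^ 4 / (real N * r0\<^sup>2))" using tc by (intro mult_right_mono) (auto simp: C)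
      finally show "2 * (136 * (\<sigma>\<^sup>2 / real N + \<sigma> ^ 4 / (real N * (r k)\<^sup>2))) \<le> C * (\<sigma>\<^sup>2 / real N + \<sigma> ^ 4 / (real N * r0\<^sup>2))" .
      have "2 * (r k)\<^sup>2 * (10 ^ 16 * 2000\<^sup>2 * E + 4 * (tail_const * E)) = (2 * (10 ^ 16 * 2000\<^sup>2 + 4 * tail_const)) * ((r k)\<^sup>2 * E)"
        by (simp add: algebra_simps)
      also have "\<dots> \<le> C * ((r k)\<^sup>2 * E)" using E0 by (intro mult_right_mono) (auto simp: C)
      finally show "2 * (r k)\<^sup>2 * (10 ^ 16 * 2000\<^sup>2 * E + 4 * (tail_const * E)) \<le> C * ((r k)\<^sup>2 * E)" .
    qed
    finally show ?thesis by (simp only: mult.assoc)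
  qed
  have majG: "loss_majorant K N \<sigma> r = (\<lambda>x. \<Sum>k=1..K. G k x)" unfolding G_def by (simp add: maj fun_eq_iff)
  have int: "integrable ?O (loss_majorant K N \<sigma> r)" unfolding majG by (intro Bochner_Integration.integrable_sum Gi)
  thus "loss_majorant K N \<sigma> r \<in> borel_measurable ?O" by (rule borel_measurable_integrable)
  have nonneg: "loss_majorant K N \<sigma> r x \<ge> 0" for x
    unfolding maj R_def by (intro sum_nonneg add_nonneg_nonneg mult_nonneg_nonneg) auto
  have "(\<integral>x. loss_majorant K N \<sigma> r x \<partial>?O) = (\<Sum>k=1..K. \<integral>x. G k x \<partial>?O)"
    unfolding majG by (intro Bochner_Integration.integral_sum Gi)
  also have "\<dots> \<le> (\<Sum>k=1..K. C * (\<sigma>\<^sup>2 / real N + \<sigma> ^ 4 / (real N * r0\<^sup>2)) + C * (r k)\<^sup>2 * E)" by (intro sum_mono Gb)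
  also have "\<dots> = real K * (C * (\<sigma>\<^sup>2 / real N + \<sigma> ^ 4 / (real N * r0\<^sup>2))) + (\<Sum>k=1..K. (r k)\<^sup>2) * (C * E)"
    unfolding sum.distrib sum_distrib_right by (simp add: mult_ac)
  also have "(\<Sum>k=1..K. (r k)\<^sup>2) = sq_norm K (from_polar r \<phi>)" by (simp add: sq_norm_def norm_from_polar)
  also have "C * E = C / real K * (real K * \<sigma>^2 / (real N * r0^2) + \<sigma>^6 / (real N * r0^6))"
  proof -
    have "E = (1 / real K) * (real K * \<sigma>^2 / (real N * r0^2) + \<sigma>^6 / (real N * r0^6))"
      unfolding E_def S_def power_divide using K by (simp add: distrib_left mult_ac)
    thus ?thesis by simp
  qed
  finally have "(\<integral>x. loss_majorant K N \<sigma> r x \<partial>?O) \<le> risk_bound C K N \<sigma> r0 (from_polar r \<phi>)"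
    unfolding risk_bound_def by (simp only: mult_ac times_divide_eq_right times_divide_eq_left)
  thus "(\<integral>\<^sup>+x. ennreal (loss_majorant K N \<sigma> r x) \<partial>?O) \<le> ennreal (risk_bound C K N \<sigma> r0 (from_polar r \<phi>))"
    using nonneg by (subst nn_integral_eq_integral[OF int]) (auto intro!: ennreal_leI)
qed

section \<open>From the model to the framed noise\<close>

definition rotation_space :: "nat \<Rightarrow> (nat \<Rightarrow> real) measure" where
  "rotation_space N = (\<Pi>\<^sub>M m\<in>{1..N}. uniform_measure lborel {-pi..<pi})"

lemma sample_space_eq: "sample_space K N = rotation_space N \<Otimes>\<^sub>M noise_space K N"
  unfolding sample_space_def rotation_space_def noise_space_def std_normal_def ..

lemma prob_space_rotation_space: "prob_space (rotation_space N)"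
  unfolding rotation_space_def
  by (intro prob_space_PiM prob_space_uniform_measure) (auto simp: pi_gt_zero)

lemma prob_space_noise_space: "prob_space (noise_space K N)"
  unfolding noise_space_def by (intro prob_space_PiM prob_space_std_normal)

lemma measurable_framed_noise: "framed_noise K N \<phi> \<in> sample_space K N \<rightarrow>\<^sub>M gauss_sample K N"
  unfolding framed_noise_def[abs_def] rotate_noise_def gauss_sample_def gauss_vec_def
proof (intro measurable_restrict)
  fix m k assume mk: "m \<in> {1..N}" "k \<in> {1..K}"
  have c1 [measurable]: "(\<lambda>\<omega>. fst \<omega> m) \<in> borel_measurable (sample_space K N)"
  proof -
    have "(\<lambda>a. a m) \<in> rotation_space N \<rightarrow>\<^sub>M uniform_measure lborel {-pi..<pi}"
      unfolding rotation_space_def by (rule measurable_component_singleton[OF mk(1)])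
    hence "(\<lambda>a. a m) \<in> rotation_space N \<rightarrow>\<^sub>M borel" by (simp cong: measurable_cong_sets)
    thus ?thesis unfolding sample_space_eq by (rule measurable_compose[OF measurable_fst])
  qed
  have c2 [measurable]: "(\<lambda>\<omega>. snd \<omega> (m, k, j)) \<in> borel_measurable (sample_space K N)" for j
    unfolding sample_space_eq using mk by (intro measurable_compose[OF measurable_snd noise_component]) auto
  have "(\<lambda>\<omega>. cis (- (\<phi> k + real k * fst \<omega> m)) * Complex (snd \<omega> (m, k, 1)) (snd \<omega> (m, k, 2))) \<in> borel_measurable (sample_space K N)"
    unfolding cis.ctr by measurable
  thus "(\<lambda>\<omega>. cis (- (\<phi> k + real k * fst \<omega> m)) * Complex (snd \<omega> (m, k, 1)) (snd \<omega> (m, k, 2))) \<in> sample_space K N \<rightarrow>\<^sub>M cgauss"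
    by simp
qed

text \<open>For fixed rotations the framed noise is the Gaussian noise turned by deterministic unit
  numbers, so its conditional law is the same for all rotations.\<close>

lemma nn_integral_framed_noise:
  assumes [measurable]: "f \<in> borel_measurable (gauss_sample K N)"
  shows "(\<integral>\<^sup>+\<omega>. f (framed_noise K N \<phi> \<omega>) \<partial>sample_space K N) = (\<integral>\<^sup>+x. f x \<partial>gauss_sample K N)"
proof -
  interpret A: prob_space "rotation_space N" by (rule prob_space_rotation_space)
  interpret B: prob_space "noise_space K N" by (rule prob_space_noise_space)
  have m: "(\<lambda>\<omega>. f (framed_noise K N \<phi> \<omega>)) \<in> borel_measurable (rotation_space N \<Otimes>\<^sub>M noise_space K N)"
    using measurable_compose[OF measurable_framed_noise assms] unfolding sample_space_eq .
  have inner: "(\<integral>\<^sup>+e. f (framed_noise K N \<phi> (a, e)) \<partial>noise_space K N) = (\<integral>\<^sup>+x. f x \<partial>gauss_sample K N)" for a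
  proof -
    let ?u = "\<lambda>m k. cis (- (\<phi> k + real k * a m))"
    have "(\<integral>\<^sup>+x. f x \<partial>gauss_sample K N) = (\<integral>\<^sup>+x. f x \<partial>distr (noise_space K N) (gauss_sample K N) (rotate_noise K N ?u))"
      by (subst distr_rotate_noise) auto
    also have "\<dots> = (\<integral>\<^sup>+e. f (rotate_noise K N ?u e) \<partial>noise_space K N)"
      by (intro nn_integral_distr measurable_rotate_noise) (use assms in simp)
    finally show ?thesis by (simp add: framed_noise_def)
  qed
  have "(\<integral>\<^sup>+\<omega>. f (framed_noise K N \<phi> \<omega>) \<partial>sample_space K N) =
      (\<integral>\<^sup>+a. \<integral>\<^sup>+e. f (framed_noise K N \<phi> (a, e)) \<partial>noise_space K N \<partial>rotation_space N)"
    unfolding sample_space_eq by (rule B.nn_integral_fst[OF m, symmetric])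
  thus ?thesis by (simp add: inner A.emeasure_space_1)
qed

theorem theorem4p1:
  shows "\<exists>C C0 :: real. C > 0 \<and> C0 > 0 \<and>
    (\<forall>(K::nat) (N::nat) (\<sigma>::real) (r0::real) (r :: nat \<Rightarrow> real) (\<phi> :: nat \<Rightarrow> real).
      K \<ge> 2 \<longrightarrow> N \<ge> 1 \<longrightarrow> \<sigma> > 0 \<longrightarrow> r0 > 0 \<longrightarrow>
      (\<forall>k\<in>{1..K}. r k \<ge> r0) \<longrightarrow> (\<forall>k\<in>{1..K}. \<phi> k \<in> {-pi..<pi}) \<longrightarrow>
      real N \<ge> C0 * (\<sigma>^6 / r0^6 * ln (real K) + \<sigma>^3 / r0^3 * ln (real K) powr (3/2)) \<longrightarrow>
      (let \<theta> = from_polar r \<phi>; y = obs \<sigma> \<theta> in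
        risk K N (\<lambda>\<omega>. mom_estimator K N \<sigma> (y \<omega>) \<phi>) \<theta>
          \<le> ennreal (risk_bound C K N \<sigma> r0 \<theta>) \<and>
        (\<forall>\<psi> :: sample \<Rightarrow> nat \<Rightarrow> real.
          (\<forall>\<omega>\<in>space (sample_space K N). opt_phases K N (y \<omega>) (\<psi> \<omega>)) \<longrightarrow>
          risk K N (\<lambda>\<omega>. mom_estimator K N \<sigma> (y \<omega>) (\<psi> \<omega>)) \<theta>
            \<le> ennreal (risk_bound C K N \<sigma> r0 \<theta>))))"
proof -
  define C where "C = 272 + 2 * (10 ^ 16 * 2000\<^sup>2 + 4 * tail_const)"
  have "tail_const \<ge> 0" by (simp add: tail_const_def tail_rate_def)
  hence C0: "C > 0" by (simp add: C_def)
  show ?thesis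
  proof (rule exI[of _ C], rule exI[of _ "50000 ^ 3"], intro conjI allI impI)
    fix K N :: nat and \<sigma> r0 :: real and r \<phi> :: "nat \<Rightarrow> real"
    assume K: "K \<ge> 2" and N: "N \<ge> 1" and \<sigma>: "\<sigma> > 0" and r0: "r0 > 0"
      and r: "\<forall>k\<in>{1..K}. r k \<ge> r0" and \<phi>: "\<forall>k\<in>{1..K}. \<phi> k \<in> {-pi..<pi}"
      and hyp: "real N \<ge> 50000 ^ 3 * (\<sigma>^6 / r0^6 * ln (real K) + \<sigma>^3 / r0^3 * ln (real K) powr (3/2))"
    have rpos: "r k > 0" if "k \<in> {1..K}" for k using r r0 that by force
    define y where "y = obs \<sigma> (from_polar r \<phi>)"
    note maj = loss_majorant_expectation[OF K N \<sigma> r0 r[rule_format] hyp C_def]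
    have risk: "risk K N (\<lambda>\<omega>. mom_estimator K N \<sigma> (y \<omega>) (\<psi> \<omega>)) (from_polar r \<phi>) \<le> ennreal (risk_bound C K N \<sigma> r0 (from_polar r \<phi>))"
      if phases: "\<And>\<omega> \<delta>. \<omega> \<in> space (sample_space K N) \<Longrightarrow>
        (\<And>p. p \<in> index_pairs K \<Longrightarrow> \<exists>\<rho>>0. B_hat N (y \<omega>) p = of_real \<rho> * cis (phase_diff \<phi> p + \<delta> p)) \<Longrightarrow>
        (\<And>p. p \<in> index_pairs K \<Longrightarrow> \<bar>\<delta> p\<bar> \<le> pi / 6) \<Longrightarrow>
        \<exists>J :: nat \<Rightarrow> int. \<forall>p\<in>index_pairs K. arg_near (phase_diff (\<psi> \<omega>) p) (B_hat N (y \<omega>) p) =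
          phase_diff (\<lambda>k. \<phi> k + 2 * pi * of_int (J k)) p + \<delta> p" for \<psi>
    proof -
      have "risk K N (\<lambda>\<omega>. mom_estimator K N \<sigma> (y \<omega>) (\<psi> \<omega>)) (from_polar r \<phi>)
         \<le> (\<integral>\<^sup>+\<omega>. ennreal (loss_majorant K N \<sigma> r (framed_noise K N \<phi> \<omega>)) \<partial>sample_space K N)"
        unfolding risk_def
      \<comment> \<open>Monotonicity of the nonnegative integral covers a non-measurable loss as
        well; only the majorant is evaluated.\<close>
      proof (intro nn_integral_mono ennreal_leI)
        fix \<omega> assume \<omega>: "\<omega> \<in> space (sample_space K N)"
        show "loss K (mom_estimator K N \<sigma> (y \<omega>) (\<psi> \<omega>)) (from_polar r \<phi>) \<le> loss_majorant K N \<sigma> r (framed_noise K N \<phi> \<omega>)"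
          unfolding y_def
          by (rule loss_mom_le_majorant[OF K N rpos measurable_space[OF measurable_framed_noise \<omega>] phases[OF \<omega>, unfolded y_def]])
      qed
      also have "\<dots> = (\<integral>\<^sup>+x. ennreal (loss_majorant K N \<sigma> r x) \<partial>gauss_sample K N)"
        using maj(1) by (intro nn_integral_framed_noise) simp
      also have "\<dots> \<le> ennreal (risk_bound C K N \<sigma> r0 (from_polar r \<phi>))" by (rule maj(2))
      finally show ?thesis .
    qed
    have risk_oracle: "risk K N (\<lambda>\<omega>. mom_estimator K N \<sigma> (y \<omega>) \<phi>) (from_polar r \<phi>) \<le> ennreal (risk_bound C K N \<sigma> r0 (from_polar r \<phi>))"
    \<comment> \<open>With the true phases as reference, no unwrapping is required: the small errors
      stay inside the window around the true phase difference.\<close>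
    proof (rule risk, intro exI[of _ "\<lambda>_. 0 :: int"] ballI)
      fix \<omega> \<delta> p
      assume "\<And>p. p \<in> index_pairs K \<Longrightarrow> \<exists>\<rho>>0. B_hat N (y \<omega>) p = of_real \<rho> * cis (phase_diff \<phi> p + \<delta> p)"
        and \<delta>: "\<And>p. p \<in> index_pairs K \<Longrightarrow> \<bar>\<delta> p\<bar> \<le> pi / 6" and p: "p \<in> index_pairs K"
      then obtain \<rho> where "\<rho> > 0" "B_hat N (y \<omega>) p = of_real \<rho> * cis (phase_diff \<phi> p + \<delta> p)" by blast
      moreover have "\<bar>\<delta> p\<bar> < pi" using \<delta>[OF p] pi_gt_zero by linarith
      ultimately show "arg_near (phase_diff \<phi> p) (B_hat N (y \<omega>) p) = phase_diff (\<lambda>k. \<phi> k + 2 * pi * of_int 0) p + \<delta> p"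
        using arg_near_rcis[of "B_hat N (y \<omega>) p" \<rho> "phase_diff \<phi> p + \<delta> p" "phase_diff \<phi> p"] by simp
    qed
    have risk_opt: "risk K N (\<lambda>\<omega>. mom_estimator K N \<sigma> (y \<omega>) (\<psi> \<omega>)) (from_polar r \<phi>) \<le> ennreal (risk_bound C K N \<sigma> r0 (from_polar r \<phi>))"
      if \<psi>: "\<forall>\<omega>\<in>space (sample_space K N). opt_phases K N (y \<omega>) (\<psi> \<omega>)" for \<psi>
    proof (rule risk)
      fix \<omega> \<delta>
      assume \<omega>: "\<omega> \<in> space (sample_space K N)"
        and B: "\<And>p. p \<in> index_pairs K \<Longrightarrow> \<exists>\<rho>>0. B_hat N (y \<omega>) p = of_real \<rho> * cis (phase_diff \<phi> p + \<delta> p)"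
        and \<delta>: "\<And>p. p \<in> index_pairs K \<Longrightarrow> \<bar>\<delta> p\<bar> \<le> pi / 6"
      show "\<exists>J :: nat \<Rightarrow> int. \<forall>p\<in>index_pairs K. arg_near (phase_diff (\<psi> \<omega>) p) (B_hat N (y \<omega>) p) =
          phase_diff (\<lambda>k. \<phi> k + 2 * pi * of_int (J k)) p + \<delta> p"
      proof (rule opt_phases_lift[OF K B \<delta> \<phi> bspec[OF \<psi> \<omega>]])
        fix J :: "nat \<Rightarrow> int"
        assume J: "\<And>p. p \<in> index_pairs K \<Longrightarrow> arg_near (phase_diff (\<psi> \<omega>) p) (B_hat N (y \<omega>) p) =
          phase_diff (\<lambda>k. \<phi> k + 2 * pi * of_int (J k)) p + \<delta> p"
        show ?thesis by (rule exI[of _ J], rule ballI, rule J)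
      qed
    qed
    show "let \<theta> = from_polar r \<phi>; y = obs \<sigma> \<theta> in
        risk K N (\<lambda>\<omega>. mom_estimator K N \<sigma> (y \<omega>) \<phi>) \<theta>
          \<le> ennreal (risk_bound C K N \<sigma> r0 \<theta>) \<and>
        (\<forall>\<psi> :: sample \<Rightarrow> nat \<Rightarrow> real.
          (\<forall>\<omega>\<in>space (sample_space K N). opt_phases K N (y \<omega>) (\<psi> \<omega>)) \<longrightarrow>
          risk K N (\<lambda>\<omega>. mom_estimator K N \<sigma> (y \<omega>) (\<psi> \<omega>)) \<theta>
            \<le> ennreal (risk_bound C K N \<sigma> r0 \<theta>))"
      unfolding Let_def y_def[symmetric] by (intro conjI allI impI risk_oracle risk_opt)
  qed (use C0 in auto)
qed

end
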